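(* Let $X$ be a finite set of points in the plane in general position (no three collinear), and let $G_X^{S}$ be the flip graph of plane spanning trees on $X$ (defined in the context). Then: (i) if $|X|\geq 3$, then $G_X^{S}$ has a $1$-rainbow cycle; (ii) if $|X|\geq 4$, then for every $r\in\{2,3,\dots,m\}$, where $m:=|X|-1$ if $|X|$ is odd and $m:=|X|-2$ if $|X|$ is even, $G_X^{S}$ has an $r$-rainbow cycle.
   Context: A plane spanning tree on $X$ is a spanning tree on vertex set $X$ whose edges are drawn as straight-line segments with no two edges crossing. The directed graph $G_X^{S}$ has as vertices all plane spanning trees on $X$, and an arc $(T,T')$ whenever $T'=T-e+f$ for some edge $e\in T$ and some segment $f\notin T$ (a flip); the arc $(T,T')$ is labeled $f$ (the edge entering the tree). The set of possible labels is the set $\binom{X}{2}$ of all pairs of points of $X$. For an integer $r\geq 1$, an $r$-rainbow cycle in $G_X^{S}$ is a directed cycle (no repeated vertices) along which every pair in $\binom{X}{2}$ appears exactly $r$ times as an arc label. *)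

theory Defs
  imports "HOL-Analysis.Analysis" "Graph_Theory.Graph_Theory"
begin

definition general_position :: "(real^2) set \<Rightarrow> bool" where
  "general_position X \<longleftrightarrow>
     (\<forall>a\<in>X. \<forall>b\<in>X. \<forall>c\<in>X. a \<noteq> b \<and> a \<noteq> c \<and> b \<noteq> c \<longrightarrow> \<not> collinear {a, b, c})"

definition point_pairs :: "'a set \<Rightarrow> 'a set set" where
  "point_pairs X = {e. e \<subseteq> X \<and> card e = 2}"

text \<open>
  An edge is the two-element set of its end points, drawn as the segment \<^term>\<open>convex hull e\<close>.
  Distinct edges may meet only in a common end point.
\<close>

definition crossing :: "(real^2) set \<Rightarrow> (real^2) set \<Rightarrow> bool" where
  "crossing e f \<longleftrightarrow> e \<noteq> f \<and> \<not> convex hull e \<inter> convex hull f \<subseteq> e \<inter> f"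

definition sym_digraph :: "'a set \<Rightarrow> 'a set set \<Rightarrow> ('a, 'a \<times> 'a) pre_digraph" where
  "sym_digraph X T = \<lparr>verts = X, arcs = {(u, v). {u, v} \<in> T}, tail = fst, head = snd\<rparr>"

text \<open>
  The predicate \<^const>\<open>tree\<close> forbids directed cycles only, including those of length two, so it is
  not applicable to the symmetric digraph of an undirected graph. The cycles of an undirected
  simple graph are the directed cycles of length at least three of its symmetric digraph.
\<close>

definition spanning_tree_on :: "'a set \<Rightarrow> 'a set set \<Rightarrow> bool" where
  "spanning_tree_on X T \<longleftrightarrow>
     T \<subseteq> point_pairs X \<and>
     Digraph_Component.connected (sym_digraph X T) \<and>
     \<not> (\<exists>p. pre_digraph.cycle (sym_digraph X T) p \<and> length p \<ge> 3)"

definition plane_spanning_tree :: "(real^2) set \<Rightarrow> (real^2) set set \<Rightarrow> bool" where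
  "plane_spanning_tree X T \<longleftrightarrow>
     spanning_tree_on X T \<and> (\<forall>e\<in>T. \<forall>f\<in>T. \<not> crossing e f)"

text \<open>\<open>flip T f T'\<close>: the tree \<open>T'\<close> arises from \<open>T\<close> by a flip with entering edge \<open>f\<close>;
  \<open>f\<close> is determined by \<open>T\<close> and \<open>T'\<close> and is the label of the arc \<open>(T, T')\<close>.\<close>

definition flip :: "'a set set \<Rightarrow> 'a set \<Rightarrow> 'a set set \<Rightarrow> bool" where
  "flip T f T' \<longleftrightarrow> f \<notin> T \<and> (\<exists>e\<in>T. T' = insert f (T - {e}))"

definition tree_flip_graph ::
    "(real^2) set \<Rightarrow> ((real^2) set set, (real^2) set set \<times> (real^2) set set) pre_digraph" where
  "tree_flip_graph X =
     \<lparr>verts = {T. plane_spanning_tree X T},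
      arcs = {(T, T'). plane_spanning_tree X T \<and> plane_spanning_tree X T' \<and> (\<exists>f. flip T f T')},
      tail = fst, head = snd\<rparr>"

definition rainbow_cycle ::
    "(real^2) set \<Rightarrow> nat \<Rightarrow> ((real^2) set set \<times> (real^2) set set) list \<Rightarrow> bool" where
  "rainbow_cycle X r p \<longleftrightarrow>
     pre_digraph.cycle (tree_flip_graph X) p \<and>
     (\<forall>f\<in>point_pairs X. length (filter (\<lambda>(T, T'). flip T f T') p) = r)"

end

theory Submission
  imports Defs
begin

text \<open>
  Write \<open>S\<^sub>b\<close> for the star with centre \<open>b\<close>. A star \<open>S\<^sub>a\<close> is turned into \<open>S\<^sub>b\<close> by replacing the
  edges \<open>ak\<close> by \<open>bk\<close> one after the other, in an order given by the angles at \<open>a\<close> and \<open>b\<close>; one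
  extra flip removes the edge \<open>ab\<close> and one puts it back, so that every edge at \<open>b\<close> enters exactly
  once. Moving along an Euler tour of a \<open>d\<close>-regular oriented graph on \<open>X\<close> therefore uses every
  label \<open>2 d\<close> times, and circulant graphs provide all \<open>d\<close> with \<open>2 d < |X|\<close>. A star may be visited
  only once; further passages \<open>a \<rightarrow> b \<rightarrow> c\<close> avoid it by starting the move to \<open>c\<close> before the move
  from \<open>a\<close> is complete, which is possible because the last edge of the one and the first edge of
  the other lie in different sectors between rotationally consecutive points around \<open>b\<close>.

  For \<open>r = 1\<close>, let \<open>v\<^sub>0\<close> be a vertex of the convex hull and \<open>v\<^sub>1, v\<^sub>2, \<dots>\<close> the other points in
  angular order around it. Moving from the star at \<open>v\<^sub>0\<close> through the stars of \<open>{v\<^sub>j, v\<^sub>j\<^sub>+\<^sub>1, \<dots>}\<close>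
  at \<open>v\<^sub>j\<close> to the path \<open>v\<^sub>0 v\<^sub>1 v\<^sub>2 \<dots>\<close> uses all labels without \<open>v\<^sub>0\<close>, and the edges at \<open>v\<^sub>0\<close> lead
  back to the star. For odd \<open>r\<close> this cycle is inserted into a tour that avoids certain pairs of
  points; for \<open>r = |X| - 2\<close> one tours a regular tournament without the extra flips instead. Four
  and five points are left to explicitly given cycles.
\<close>

subsection \<open>Trees grown by adding leaves\<close>

lemma (in pre_digraph) cas_tails_heads: "cas u p v \<Longrightarrow> map (tail G) p @ [v] = u # map (head G) p"
  by (induction u p v rule: cas.induct) auto

lemma (in pre_digraph) closed_cas_heads: "cas u p u \<Longrightarrow> map (head G) p = rotate1 (map (tail G) p)"
  using cas_tails_heads[of u p u] by (cases p) auto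

definition parent_tree :: "'a \<Rightarrow> ('a \<Rightarrow> 'a) \<Rightarrow> 'a set \<Rightarrow> 'a set set" where
  "parent_tree r par X = (\<lambda>x. {x, par x}) ` (X - {r})"

definition is_parent_map :: "'a \<Rightarrow> ('a \<Rightarrow> 'a) \<Rightarrow> ('a \<Rightarrow> nat) \<Rightarrow> 'a set \<Rightarrow> bool" where
  "is_parent_map r par height X \<longleftrightarrow> r \<in> X \<and> (\<forall>x\<in>X - {r}. par x \<in> X \<and> height (par x) < height x)"

lemma parent_tree_subset_point_pairs:
  assumes "is_parent_map r par height X"
  shows "parent_tree r par X \<subseteq> point_pairs X"
proof
  fix e assume "e \<in> parent_tree r par X"
  then obtain x where x: "x \<in> X - {r}" "e = {x, par x}" by (auto simp: parent_tree_def)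
  then have "par x \<in> X" "height (par x) < height x"
    using assms by (auto simp: is_parent_map_def)
  then show "e \<in> point_pairs X" using x by (auto simp: point_pairs_def card_insert_if)
qed

lemma parent_tree_edge_down:
  assumes "is_parent_map r par height X" "{x, y} \<in> parent_tree r par X" "height x \<le> height y"
  shows "x = par y"
proof -
  obtain z where z: "z \<in> X - {r}" "{x, y} = {z, par z}"
    using assms(2) by (auto simp: parent_tree_def)
  then have "height (par z) < height z" using assms(1) by (auto simp: is_parent_map_def)
  with z assms(3) show ?thesis by (auto simp: doubleton_eq_iff)
qed

lemma connected_if_reachable_from:
  assumes "r \<in> verts G"
    and "\<And>x. x \<in> verts G \<Longrightarrow> (r, x) \<in> rtrancl_on (verts G) (symcl (arcs_ends G))"
  shows "Digraph_Component.connected G"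
proof -
  have "sym (rtrancl_on (verts G) (symcl (arcs_ends G)))"
    by (rule rtrancl_on_sym) (auto simp: symcl_def sym_def)
  then have "(x, y) \<in> rtrancl_on (verts G) (symcl (arcs_ends G))"
    if "x \<in> verts G" "y \<in> verts G" for x y
    using assms(2) that by (meson rtrancl_on_trans symD)
  then show ?thesis using assms(1) by (auto simp: connected_conv)
qed

lemma connected_parent_tree:
  assumes parent: "is_parent_map r par height X"
  shows "Digraph_Component.connected (sym_digraph X (parent_tree r par X))"
    (is "Digraph_Component.connected ?G")
proof (rule connected_if_reachable_from)
  show "r \<in> verts ?G" using parent by (simp add: is_parent_map_def sym_digraph_def)
next
  fix x assume "x \<in> verts ?G"
  then show "(r, x) \<in> rtrancl_on (verts ?G) (symcl (arcs_ends ?G))"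
  proof (induction "height x" arbitrary: x rule: less_induct)
    case less
    show ?case
    proof (cases "x = r")
      case True
      then show ?thesis using less.prems by auto
    next
      case False
      then have par: "par x \<in> verts ?G" "height (par x) < height x"
        using parent less.prems by (auto simp: is_parent_map_def sym_digraph_def)
      have "(par x, x) \<in> symcl (arcs_ends ?G)"
        using False less.prems
        by (auto simp: arcs_ends_def arc_to_ends_def sym_digraph_def symcl_def parent_tree_def)
      with less.hyps[OF par(2,1)] show ?thesis
        using less.prems by (rule rtrancl_on_into_rtrancl_on)
    qed
  qed
qed

text \<open>A cycle would enter and leave its vertex of maximal height through the same edge.\<close>

lemma no_closed_walk_parent_tree:
  assumes parent: "is_parent_map r par height X"
    and edges: "\<And>i. i < length p \<Longrightarrow> {fst (p ! i), snd (p ! i)} \<in> parent_tree r par X"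
    and heads: "map snd p = rotate1 (map fst p)" and distinct: "distinct (map fst p)"
    and long: "3 \<le> length p"
  shows False
proof -
  define L where "L = length p"
  have "finite (height ` set (map snd p))" "height ` set (map snd p) \<noteq> {}" using long by auto
  from Max_in[OF this] obtain m where "m \<in> set (map snd p)"
    and "height m = Max (height ` set (map snd p))" by (metis imageE)
  then have m: "m \<in> set (map snd p)" "\<And>x. x \<in> set (map snd p) \<Longrightarrow> height x \<le> height m"
    by simp_all
  then obtain i where i: "i < L" "snd (p ! i) = m" by (auto simp: in_set_conv_nth L_def)
  have next_less: "Suc k mod L < L" for k using long by (intro mod_less_divisor) (auto simp: L_def)
  define j where "j = Suc i mod L"
  have j: "j < L" unfolding j_def by (rule next_less)
  have head: "snd (p ! k) = fst (p ! (Suc k mod L))" if "k < L" for k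
    using arg_cong[OF heads, of "\<lambda>xs. xs ! k"] that next_less[of k]
    by (simp add: nth_rotate1 L_def)
  have tail_le: "height (fst (p ! k)) \<le> height m" if "k < L" for k
    using m(2)[of "fst (p ! k)"] that by (simp add: heads L_def)
  have "fst (p ! i) = par m"
    using parent_tree_edge_down[OF parent] edges[of i] tail_le[OF i(1)] i by (simp add: L_def)
  moreover have "snd (p ! j) = par m"
  proof (rule parent_tree_edge_down[OF parent])
    show "{snd (p ! j), m} \<in> parent_tree r par X"
      using edges[of j] head[OF i(1)] i j by (simp add: L_def j_def insert_commute)
    show "height (snd (p ! j)) \<le> height m" using j by (intro m(2)) (simp add: L_def)
  qed
  ultimately have "fst (p ! i) = fst (p ! (Suc j mod L))" using head[OF j] by simp
  then have "i = Suc j mod L"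
    using distinct i(1) next_less[of j] nth_eq_iff_index_eq[of "map fst p" i "Suc j mod L"]
    by (simp add: L_def)
  then show False using i long by (auto simp: j_def L_def mod_Suc split: if_splits)
qed

lemma no_cycle_parent_tree:
  assumes parent: "is_parent_map r par height X"
    and cycle: "pre_digraph.cycle (sym_digraph X (parent_tree r par X)) p"
  shows "length p < 3"
proof (rule ccontr)
  assume "\<not> length p < 3"
  then have long: "3 \<le> length p" by simp
  let ?G = "sym_digraph X (parent_tree r par X)"
  obtain u where walk: "pre_digraph.cas ?G u p u" "set p \<subseteq> arcs ?G"
    and distinct_verts: "distinct (tl (pre_digraph.awalk_verts ?G u p))"
    using cycle by (auto simp: pre_digraph.cycle_def pre_digraph.awalk_def)
  have heads: "map snd p = rotate1 (map fst p)"
    using pre_digraph.closed_cas_heads[OF walk(1)] by (simp add: sym_digraph_def)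
  have "distinct (map snd p)"
    using long distinct_verts pre_digraph.awalk_verts_conv'[OF walk(1)]
    by (auto simp: sym_digraph_def split: if_splits)
  then have "distinct (map fst p)" by (simp add: heads)
  moreover have "{fst (p ! i), snd (p ! i)} \<in> parent_tree r par X" if "i < length p" for i
    using walk(2) nth_mem[OF that] by (force simp: sym_digraph_def)
  ultimately show False using no_closed_walk_parent_tree[OF parent _ heads _ long] by blast
qed

lemma spanning_tree_on_parent_tree:
  assumes "is_parent_map r par height X"
  shows "spanning_tree_on X (parent_tree r par X)"
  using parent_tree_subset_point_pairs[OF assms] connected_parent_tree[OF assms]
    no_cycle_parent_tree[OF assms]
  by (auto simp: spanning_tree_on_def not_le)

inductive tree_on :: "'a set \<Rightarrow> 'a set set \<Rightarrow> bool" where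
  tree_on_single: "tree_on {r} {}"
| tree_on_insert: "tree_on X T \<Longrightarrow> x \<in> X \<Longrightarrow> y \<notin> X \<Longrightarrow> tree_on (insert y X) (insert {x, y} T)"

lemma tree_on_subset_point_pairs: "tree_on X T \<Longrightarrow> T \<subseteq> point_pairs X"
  by (induction rule: tree_on.induct) (auto simp: point_pairs_def card_insert_if)

lemma tree_on_eq_parent_tree:
  "tree_on X T \<Longrightarrow> \<exists>r par height. is_parent_map r par height X \<and> T = parent_tree r par X"
proof (induction rule: tree_on.induct)
  case (tree_on_single r)
  have "is_parent_map r id (\<lambda>x. 0) {r}" "parent_tree r id {r} = {}"
    by (simp_all add: is_parent_map_def parent_tree_def)
  then show ?case by metis
next
  case (tree_on_insert X T x y)
  then obtain r par height where parent: "is_parent_map r par height X" "T = parent_tree r par X"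
    by blast
  then have y: "y \<noteq> r" using tree_on_insert.hyps by (auto simp: is_parent_map_def)
  define par' height' where "par' = par(y := x)" and "height' = height(y := Suc (height x))"
  have "is_parent_map r par' height' (insert y X)"
    using parent(1) tree_on_insert.hyps by (auto simp: is_parent_map_def par'_def height'_def)
  moreover have "(\<lambda>z. {z, par' z}) ` (X - {r}) = T"
    unfolding parent(2) parent_tree_def par'_def
    using tree_on_insert.hyps by (intro image_cong) auto
  then have "insert {x, y} T = parent_tree r par' (insert y X)"
    using y by (simp add: parent_tree_def par'_def insert_Diff_if insert_commute)
  ultimately show ?case by blast
qed

lemma spanning_tree_on_if_tree_on:
  assumes "tree_on X T"
  shows "spanning_tree_on X T"
  using tree_on_eq_parent_tree[OF assms] by (auto intro: spanning_tree_on_parent_tree)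

subsection \<open>Orientations and crossings\<close>

type_synonym point = "real^2"

definition orient :: "point \<Rightarrow> point \<Rightarrow> point \<Rightarrow> real" where
  "orient p q r = (q$1 - p$1) * (r$2 - p$2) - (q$2 - p$2) * (r$1 - p$1)"

lemma orient_self [simp]: "orient a b a = 0" "orient a b b = 0" "orient a a b = 0"
  by (simp_all add: orient_def algebra_simps)

lemma orient_swap: "orient a c b = - orient a b c"
  by (simp add: orient_def algebra_simps)

lemma orient_rotate: "orient b c a = orient a b c"
  by (simp add: orient_def algebra_simps)

lemma orient_flip: "orient b a c = - orient a b c"
  by (simp add: orient_def algebra_simps)

lemma orient_affine:
  "orient a b ((1 - u) *\<^sub>R p + u *\<^sub>R q) = (1 - u) * orient a b p + u * orient a b q"
  by (simp add: orient_def algebra_simps)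

lemma collinear_if_orient_eq_0:
  assumes "orient a b c = 0"
  shows "collinear {a, b, c}"
proof (cases "a = b")
  case False
  define d where "d = (b$1 - a$1)\<^sup>2 + (b$2 - a$2)\<^sup>2"
  define u where "u = ((c$1 - a$1) * (b$1 - a$1) + (c$2 - a$2) * (b$2 - a$2)) / d"
  have "d \<noteq> 0" using False by (auto simp: d_def vec_eq_iff forall_2 sum_power2_eq_zero_iff)
  then have "u * d = (c$1 - a$1) * (b$1 - a$1) + (c$2 - a$2) * (b$2 - a$2)" by (simp add: u_def)
  then have "d * (c$1 - a$1) = d * (u * (b$1 - a$1))" "d * (c$2 - a$2) = d * (u * (b$2 - a$2))"
    using assms unfolding orient_def d_def by algebra+
  then have "c - a = u *\<^sub>R (b - a)" using \<open>d \<noteq> 0\<close> by (simp add: vec_eq_iff forall_2)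
  then have "collinear {0, b - a, c - a}" by (auto simp: collinear_lemma)
  then have "collinear {b, a, c}" by (simp add: collinear_3[of b a c])
  then show ?thesis by (simp add: insert_commute)
qed simp

lemma in_convex_hull_pair:
  "x \<in> convex hull {p, q} \<longleftrightarrow> (\<exists>u. 0 \<le> u \<and> u \<le> 1 \<and> x = (1 - u) *\<^sub>R p + u *\<^sub>R q)"
  by (simp flip: segment_convex_hull add: in_segment)

lemma crossing_commute: "crossing e f \<longleftrightarrow> crossing f e"
  unfolding crossing_def by auto

lemma not_crossing_self [simp]: "\<not> crossing e e"
  by (simp add: crossing_def)

lemma not_crossing_if_separated:
  assumes "orient a b p \<le> 0" "orient a b q < 0" "orient a b r \<ge> 0" "orient a b s \<ge> 0"
    and "orient a b p < 0 \<or> orient a b s > 0"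
  shows "\<not> crossing {p, q} {r, s}"
proof -
  have "x \<in> {p, q} \<inter> {r, s}" if "x \<in> convex hull {p, q}" "x \<in> convex hull {r, s}" for x
  proof -
    from that obtain u w where u: "0 \<le> u" "u \<le> 1" "x = (1 - u) *\<^sub>R p + u *\<^sub>R q"
      and w: "0 \<le> w" "w \<le> 1" "x = (1 - w) *\<^sub>R r + w *\<^sub>R s"
      by (auto simp: in_convex_hull_pair)
    have "(1 - u) * orient a b p \<le> 0" "u * orient a b q \<le> 0"
      using u assms by (auto intro: mult_nonneg_nonpos)
    moreover have "(1 - w) * orient a b r \<ge> 0" "w * orient a b s \<ge> 0"
      using w assms by auto
    moreover have "(1 - u) * orient a b p + u * orient a b q =
        (1 - w) * orient a b r + w * orient a b s"
      using u(3) w(3) orient_affine by metis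
    ultimately have "u * orient a b q = 0" "(1 - u) * orient a b p = 0" "w * orient a b s = 0"
      by linarith+
    then have "u = 0" "w = 0" using assms by auto
    then show ?thesis using u w by simp
  qed
  then show ?thesis unfolding crossing_def by blast
qed

lemma not_crossing_if_common_end:
  assumes "orient a b c \<noteq> 0"
  shows "\<not> crossing {a, b} {a, c}"
proof -
  have "x = a" if "x \<in> convex hull {a, b}" "x \<in> convex hull {a, c}" for x
  proof -
    from that obtain u w where u: "x = (1 - u) *\<^sub>R a + u *\<^sub>R b"
      and w: "x = (1 - w) *\<^sub>R a + w *\<^sub>R c"
      unfolding in_convex_hull_pair by blast
    have "orient a b x = 0" unfolding u orient_affine by simp
    moreover have "orient a b x = w * orient a b c" unfolding w orient_affine by simp
    ultimately show ?thesis using assms w by simp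
  qed
  then show ?thesis unfolding crossing_def by blast
qed

definition cross_free :: "point set set \<Rightarrow> point set set \<Rightarrow> bool" where
  "cross_free A B \<longleftrightarrow> (\<forall>e\<in>A. \<forall>f\<in>B. \<not> crossing e f)"

lemma cross_free_commute: "cross_free A B \<longleftrightarrow> cross_free B A"
  unfolding cross_free_def by (metis crossing_commute)

lemma cross_free_simps [simp]:
  "cross_free {} B" "cross_free A {}"
  "cross_free (A \<union> A') B \<longleftrightarrow> cross_free A B \<and> cross_free A' B"
  "cross_free A (B \<union> B') \<longleftrightarrow> cross_free A B \<and> cross_free A B'"
  by (auto simp: cross_free_def)

lemma cross_free_Un_self:
  "cross_free (A \<union> B) (A \<union> B) \<longleftrightarrow> cross_free A A \<and> cross_free B B \<and> cross_free A B"
  using cross_free_commute[of A B] by auto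

lemma cross_free_mono: "cross_free A B \<Longrightarrow> A' \<subseteq> A \<Longrightarrow> B' \<subseteq> B \<Longrightarrow> cross_free A' B'"
  by (auto simp: cross_free_def)

definition plane_tree :: "point set \<Rightarrow> point set set \<Rightarrow> bool" where
  "plane_tree X T \<longleftrightarrow> tree_on X T \<and> cross_free T T"

lemma plane_treeI: "tree_on X T \<Longrightarrow> cross_free T T \<Longrightarrow> plane_tree X T"
  by (simp add: plane_tree_def)

lemma plane_spanning_tree_if_plane_tree: "plane_tree X T \<Longrightarrow> plane_spanning_tree X T"
  by (simp add: plane_tree_def plane_spanning_tree_def cross_free_def spanning_tree_on_if_tree_on)

lemma point_pairs_mono: "X \<subseteq> Y \<Longrightarrow> point_pairs X \<subseteq> point_pairs Y"
  by (auto simp: point_pairs_def)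

locale points =
  fixes X :: "point set"
  assumes finite_X: "finite X" and general_position: "general_position X"
begin

lemma points_subset: "Y \<subseteq> X \<Longrightarrow> points Y"
  using finite_X general_position finite_subset
  by unfold_locales (auto simp: general_position_def subset_iff)

lemma orient_nonzero:
  "a \<in> X \<Longrightarrow> b \<in> X \<Longrightarrow> c \<in> X \<Longrightarrow> a \<noteq> b \<Longrightarrow> a \<noteq> c \<Longrightarrow> b \<noteq> c \<Longrightarrow> orient a b c \<noteq> 0"
  using general_position collinear_if_orient_eq_0 unfolding general_position_def by metis

lemma not_crossing_if_shared:
  assumes "a \<in> X" "b \<in> X" "c \<in> X" "a \<noteq> b" "a \<noteq> c"
  shows "\<not> crossing {a, b} {a, c}"
  using assms orient_nonzero[of a b c] by (cases "b = c") (simp_all add: not_crossing_if_common_end)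

lemma not_crossing_if_meet:
  assumes "e \<in> point_pairs X" "f \<in> point_pairs X" "e \<inter> f \<noteq> {}"
  shows "\<not> crossing e f"
proof -
  obtain a where "a \<in> e" "a \<in> f" using assms by auto
  with assms(1,2) obtain b c where "e = {a, b}" "a \<noteq> b" "f = {a, c}" "a \<noteq> c"
    by (auto simp: point_pairs_def card_2_iff)
  then show ?thesis using not_crossing_if_shared[of a b c] assms(1,2)
    by (auto simp: point_pairs_def)
qed

end

subsection \<open>Flip sequences\<close>

text \<open>A flip sequence lists the trees it leaves, each with the label of the flip leaving it; the
  tree it arrives at is a separate argument.\<close>

type_synonym flips = "(point set set \<times> point set) list"

fun source :: "('t \<times> 'l) list \<Rightarrow> 't \<Rightarrow> 't" where
  "source [] T' = T'"
| "source ((T, f) # ps) T' = T"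

fun flip_path :: "point set \<Rightarrow> flips \<Rightarrow> point set set \<Rightarrow> bool" where
  "flip_path X [] T' \<longleftrightarrow> True"
| "flip_path X ((T, f) # ps) T' \<longleftrightarrow>
     plane_tree X T \<and> flip T f (source ps T') \<and> flip_path X ps T'"

fun flip_arcs :: "('t \<times> 'l) list \<Rightarrow> 't \<Rightarrow> ('t \<times> 't) list" where
  "flip_arcs [] T' = []"
| "flip_arcs ((T, f) # ps) T' = (T, source ps T') # flip_arcs ps T'"

lemma source_append [simp]: "source (ps @ qs) T' = source ps (source qs T')"
  by (cases ps rule: list.exhaust) auto

lemma source_map_upt:
  "i \<le> j \<Longrightarrow> source (map (\<lambda>t. (T t, f t)) [i..<j]) (T j) = T i"
  by (cases "i = j") (auto simp: upt_conv_Cons)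

lemma flip_path_append:
  "flip_path X (ps @ qs) T' \<longleftrightarrow> flip_path X ps (source qs T') \<and> flip_path X qs T'"
  by (induction ps) auto

lemma flip_path_map_upt:
  assumes "i \<le> j"
    and "\<And>t. i \<le> t \<Longrightarrow> t < j \<Longrightarrow> plane_tree X (T t)"
    and "\<And>t. i \<le> t \<Longrightarrow> t < j \<Longrightarrow> flip (T t) (f t) (T (Suc t))"
  shows "flip_path X (map (\<lambda>t. (T t, f t)) [i..<j]) (T j)"
  using assms
proof (induction j rule: dec_induct)
  case (step j)
  then show ?case by (simp add: flip_path_append)
qed simp

lemma source_concat_map:
  assumes "\<And>x T'. x \<in> set xs \<Longrightarrow> source (block x) T' = start x" and "xs \<noteq> []"
  shows "source (concat (map block xs)) T' = start (hd xs)"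
  using assms by (cases xs) auto

lemma flip_path_concat_map:
  assumes source: "\<And>x T'. x \<in> set xs \<Longrightarrow> source (block x) T' = start x"
    and "successively (\<lambda>x y. flip_path X (block x) (start y)) xs"
    and "xs \<noteq> [] \<Longrightarrow> flip_path X (block (last xs)) T"
  shows "flip_path X (concat (map block xs)) T"
  using assms
proof (induction xs)
  case (Cons x xs)
  then show ?case
    by (cases "xs = []")
      (auto simp: successively_Cons flip_path_append source_concat_map[of xs block start])
qed simp

lemma distinct_concat_map:
  assumes "distinct xs" "\<And>x. x \<in> set xs \<Longrightarrow> distinct (block x)"
    and "\<And>x y. x \<in> set xs \<Longrightarrow> y \<in> set xs \<Longrightarrow> x \<noteq> y \<Longrightarrow> set (block x) \<inter> set (block y) = {}"
  shows "distinct (concat (map block xs))"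
  using assms
proof (induction xs)
  case (Cons x xs)
  then have "set (block x) \<inter> set (concat (map block xs)) = {}" by fastforce
  with Cons show ?case by auto
qed simp

lemma count_list_distinct: "distinct xs \<Longrightarrow> count_list xs x = of_bool (x \<in> set xs)"
  by (induction xs) auto

lemma count_list_concat_map:
  "count_list (map g (concat (map block xs))) f = (\<Sum>x\<leftarrow>xs. count_list (map g (block x)) f)"
  by (induction xs) auto

lemma flip_label_unique: "flip T f U \<Longrightarrow> flip T g U \<longleftrightarrow> f = g"
  unfolding flip_def by auto

lemma map_fst_flip_arcs [simp]: "map fst (flip_arcs ps T') = map fst ps"
  by (induction ps T' rule: flip_arcs.induct) auto

lemma cas_flip_arcs:
  "pre_digraph.cas (tree_flip_graph X) (source ps T') (flip_arcs ps T') T'"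
  by (induction ps T' rule: flip_arcs.induct)
    (auto simp: pre_digraph.cas.simps tree_flip_graph_def)

lemma plane_tree_source:
  "flip_path X ps T' \<Longrightarrow> plane_tree X T' \<Longrightarrow> plane_tree X (source ps T')"
  by (cases "(ps, T')" rule: source.cases) auto

lemma flip_arcs_subset:
  "flip_path X ps T' \<Longrightarrow> plane_tree X T' \<Longrightarrow>
    set (flip_arcs ps T') \<subseteq> arcs (tree_flip_graph X)"
  by (induction ps T' rule: flip_arcs.induct)
    (auto simp: tree_flip_graph_def plane_tree_source plane_spanning_tree_if_plane_tree)

lemma count_label_flip_arcs:
  "flip_path X ps T' \<Longrightarrow>
    length (filter (\<lambda>(T, U). flip T f U) (flip_arcs ps T')) = count_list (map snd ps) f"
  by (induction ps T' rule: flip_arcs.induct) (auto simp: flip_label_unique)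

lemma cycle_flip_arcs:
  assumes ps: "ps \<noteq> []" "flip_path X ps T" "source ps T = T" and distinct: "distinct (map fst ps)"
  shows "pre_digraph.cycle (tree_flip_graph X) (flip_arcs ps T)"
proof -
  let ?G = "tree_flip_graph X" and ?p = "flip_arcs ps T"
  have closed: "pre_digraph.cas ?G T ?p T" using cas_flip_arcs[of X ps T] ps(3) by simp
  have nonempty: "?p \<noteq> []" using map_fst_flip_arcs[of ps T] ps(1) by force
  have T: "plane_tree X T" using ps by (cases "(ps, T)" rule: source.cases) auto
  have "map snd ?p = rotate1 (map fst ps)"
    using pre_digraph.closed_cas_heads[OF closed] by (simp add: tree_flip_graph_def)
  moreover have "tl (pre_digraph.awalk_verts ?G T ?p) = map snd ?p"
    using pre_digraph.awalk_verts_conv'[OF closed] nonempty by (simp add: tree_flip_graph_def)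
  ultimately have "distinct (tl (pre_digraph.awalk_verts ?G T ?p))" using distinct by simp
  then show ?thesis
    unfolding pre_digraph.cycle_def pre_digraph.awalk_def
    using closed nonempty T flip_arcs_subset[OF ps(2) T] plane_spanning_tree_if_plane_tree[OF T]
    by (auto simp: tree_flip_graph_def)
qed

lemma rainbow_cycleI:
  assumes "ps \<noteq> []" "flip_path X ps T" "source ps T = T" "distinct (map fst ps)"
    and "\<And>f. f \<in> point_pairs X \<Longrightarrow> count_list (map snd ps) f = r"
  shows "\<exists>p. rainbow_cycle X r p"
  using cycle_flip_arcs[OF assms(1-4)] count_label_flip_arcs[OF assms(2)] assms(5)
  unfolding rainbow_cycle_def by metis

subsection \<open>Angular orders and sweeps\<close>

definition is_angular_order :: "point set \<Rightarrow> point \<Rightarrow> point list \<Rightarrow> bool" where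
  "is_angular_order A a xs \<longleftrightarrow>
     distinct xs \<and> set xs = A \<and> sorted_wrt (\<lambda>k l. orient a k l > 0) xs"

text \<open>The points are sorted by the cotangents of their angles with \<open>b\<close> at \<open>a\<close>.\<close>

lemma ex_angular_order:
  assumes finite: "finite A" and left: "\<And>k. k \<in> A \<Longrightarrow> orient a b k > 0"
    and nonzero: "\<And>k l. k \<in> A \<Longrightarrow> l \<in> A \<Longrightarrow> k \<noteq> l \<Longrightarrow> orient a k l \<noteq> 0"
  shows "\<exists>xs. is_angular_order A a xs"
proof (cases "A = {}")
  case False
  define d where "d = (b$1 - a$1)\<^sup>2 + (b$2 - a$2)\<^sup>2"
  define dot where "dot k = (b$1 - a$1) * (k$1 - a$1) + (b$2 - a$2) * (k$2 - a$2)" for k :: point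
  define minus_cot where "minus_cot k = - (dot k / orient a b k)" for k
  have "a \<noteq> b" using False left by fastforce
  then have d: "d > 0" by (auto simp: d_def vec_eq_iff forall_2 sum_power2_gt_zero_iff)
  have ordered: "orient a k l > 0"
    if kl: "k \<in> A" "l \<in> A" "k \<noteq> l" "minus_cot k \<le> minus_cot l" for k l
  proof -
    have "dot k * orient a b l - dot l * orient a b k = d * orient a k l"
      unfolding dot_def d_def orient_def by algebra
    moreover have "dot l * orient a b k \<le> dot k * orient a b l"
      using kl(4) left[OF kl(1)] left[OF kl(2)] by (simp add: minus_cot_def field_simps)
    ultimately have "d * orient a k l \<ge> 0" by linarith
    then have "orient a k l \<ge> 0" using d by (simp add: zero_le_mult_iff)
    then show ?thesis using nonzero[OF kl(1-3)] by linarith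
  qed
  obtain ys where "set ys = A" "distinct ys" using finite_distinct_list[OF finite] by blast
  moreover define xs where "xs = sort_key minus_cot ys"
  ultimately have xs: "distinct xs" "set xs = A" "sorted (map minus_cot xs)" by simp_all
  then have "sorted_wrt (\<lambda>k l. orient a k l > 0) xs"
    using ordered by (auto simp: sorted_wrt_iff_nth_less nth_eq_iff_index_eq)
  then show ?thesis using xs by (auto simp: is_angular_order_def)
qed (auto simp: is_angular_order_def)

definition left_of :: "point set \<Rightarrow> point \<Rightarrow> point \<Rightarrow> point set" where
  "left_of X a b = {k \<in> X. orient a b k > 0}"

definition angular_list :: "point set \<Rightarrow> point \<Rightarrow> point \<Rightarrow> point list" where
  "angular_list X a b = (SOME xs. is_angular_order (left_of X a b) a xs)"

definition sweep :: "point set \<Rightarrow> point \<Rightarrow> point \<Rightarrow> point list" where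
  "sweep X a b = angular_list X a b @ rev (angular_list X b a)"

definition supporting :: "point set \<Rightarrow> point \<Rightarrow> point \<Rightarrow> bool" where
  "supporting X a b \<longleftrightarrow> left_of X a b = {}"

definition ccw_next :: "point set \<Rightarrow> point \<Rightarrow> point \<Rightarrow> point \<Rightarrow> bool" where
  "ccw_next X a b z \<longleftrightarrow>
     z \<in> left_of X a b \<and> (\<forall>k \<in> left_of X a b. k \<noteq> z \<longrightarrow> orient a z k > 0)"

context points
begin

lemma is_angular_order_angular_list:
  assumes "a \<in> X" "b \<in> X"
  shows "is_angular_order (left_of X a b) a (angular_list X a b)"
proof -
  have "orient a k l \<noteq> 0" if "k \<in> left_of X a b" "l \<in> left_of X a b" "k \<noteq> l" for k l
  proof -
    have "k \<noteq> a" "l \<noteq> a" using that by (auto simp: left_of_def)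
    then show ?thesis using that orient_nonzero[of a k l] assms by (simp add: left_of_def)
  qed
  then have "\<exists>xs. is_angular_order (left_of X a b) a xs"
    using finite_X by (intro ex_angular_order[where b = b]) (auto simp: left_of_def)
  then show ?thesis unfolding angular_list_def by (rule someI_ex)
qed

lemma supporting_unique:
  assumes "supporting X b p" "supporting X b q" "b \<in> X" "p \<in> X" "q \<in> X" "p \<noteq> b" "q \<noteq> b"
  shows "p = q"
proof (rule ccontr)
  assume "p \<noteq> q"
  then have "orient b p q \<noteq> 0" using assms orient_nonzero by auto
  moreover have "orient b p q \<le> 0" "orient b q p \<le> 0"
    using assms by (auto simp: supporting_def left_of_def not_less)
  ultimately show False using orient_swap[of b p q] by linarith
qed

lemma ccw_next_hd_angular_list:
  assumes "a \<in> X" "b \<in> X" "\<not> supporting X a b"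
  shows "ccw_next X a b (hd (angular_list X a b))"
proof -
  have order: "set (angular_list X a b) = left_of X a b"
    "sorted_wrt (\<lambda>k l. orient a k l > 0) (angular_list X a b)"
    using is_angular_order_angular_list[OF assms(1,2)] by (auto simp: is_angular_order_def)
  then obtain z zs where zs: "angular_list X a b = z # zs"
    using assms(3) by (cases "angular_list X a b") (auto simp: supporting_def)
  then show ?thesis using order by (auto simp: ccw_next_def)
qed

lemma ccw_next_distinct:
  assumes "ccw_next X b a y" "ccw_next X b c z" "a \<in> X" "b \<in> X" "c \<in> X" "a \<noteq> b" "c \<noteq> b" "a \<noteq> c"
  shows "y \<noteq> z"
proof
  assume "y = z"
  moreover have "y \<noteq> a" "z \<noteq> c" using assms by (auto simp: ccw_next_def left_of_def)
  moreover have "orient b a c > 0 \<or> orient b c a > 0"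
    using assms orient_nonzero[of b a c] orient_swap[of b a c] by fastforce
  ultimately have "orient b y c > 0 \<or> orient b z a > 0"
    using assms by (auto simp: ccw_next_def left_of_def)
  then show False
    using \<open>y = z\<close> assms(1,2) orient_swap[of b y c] orient_swap[of b z a]
    by (auto simp: ccw_next_def left_of_def)
qed

lemma not_crossing_ccw_next:
  assumes y: "ccw_next X b a y" and z: "ccw_next X b c z"
    and X: "a \<in> X" "b \<in> X" "c \<in> X" "a \<noteq> b" "c \<noteq> b" "a \<noteq> c"
  shows "\<not> crossing {a, y} {c, z}"
proof -
  have separated: "\<not> crossing {a, y} {c, z}"
    if "ccw_next X b a y" "ccw_next X b c z" "c \<in> X" "y \<noteq> c" "orient b a c > 0" for a c y z
  proof (rule not_crossing_if_separated)
    have "orient b y c > 0" using that by (auto simp: ccw_next_def left_of_def)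
    then show "orient b c a \<le> 0" "orient b c y < 0" "orient b c a < 0 \<or> orient b c z > 0"
      using that orient_swap[of b c a] orient_swap[of b c y] by auto
    show "orient b c c \<ge> 0" "orient b c z \<ge> 0"
      using that by (auto simp: ccw_next_def left_of_def)
  qed
  have ne: "y \<in> X" "z \<in> X" "y \<noteq> a" "z \<noteq> c" using y z by (auto simp: ccw_next_def left_of_def)
  consider (y_eq_c) "y = c" | (z_eq_a) "z = a"
    | (a_first) "y \<noteq> c" "orient b a c > 0" | (c_first) "z \<noteq> a" "orient b c a > 0"
    using orient_nonzero[of b a c] orient_swap[of b a c] X by fastforce
  then show ?thesis
  proof cases
    case y_eq_c
    then show ?thesis using not_crossing_if_shared[of c a z] X ne by (simp add: insert_commute)
  next
    case z_eq_a
    then show ?thesis using not_crossing_if_shared[of a y c] X ne by (simp add: insert_commute)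
  next
    case a_first
    then show ?thesis using separated[OF y z] X by simp
  next
    case c_first
    then show ?thesis using separated[OF z y] X crossing_commute by simp
  qed
qed

end

locale point_pair = points +
  fixes a b :: point
  assumes in_X: "a \<in> X" "b \<in> X" and neq: "a \<noteq> b"
begin

lemma swapped: "point_pair X b a"
  using in_X neq by unfold_locales auto

lemma angular_order:
  "distinct (angular_list X a b)" "set (angular_list X a b) = left_of X a b"
  "sorted_wrt (\<lambda>k l. orient a k l > 0) (angular_list X a b)"
  using is_angular_order_angular_list[OF in_X] by (auto simp: is_angular_order_def)

lemma not_crossing_angular_list:
  "sorted_wrt (\<lambda>k l. \<not> crossing {b, k} {a, l}) (angular_list X a b)"
proof (rule sorted_wrt_mono_rel[OF _ angular_order(3)])
  fix k l assume "k \<in> set (angular_list X a b)" "l \<in> set (angular_list X a b)" "orient a k l > 0"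
  then show "\<not> crossing {b, k} {a, l}"
    using angular_order(2) orient_swap[of a l b] orient_swap[of a l k]
    by (intro not_crossing_if_separated[of a l]) (auto simp: left_of_def)
qed

lemma distinct_sweep: "distinct (sweep X a b)"
  using angular_order(1,2) point_pair.angular_order(1,2)[OF swapped] orient_flip[of a b]
  by (auto simp: sweep_def left_of_def)

lemma set_sweep: "set (sweep X a b) = X - {a, b}"
proof -
  have "k \<in> left_of X a b \<union> left_of X b a \<longleftrightarrow> k \<in> X - {a, b}" for k
    using orient_nonzero[of a b k] orient_flip[of b a k] in_X neq by (auto simp: left_of_def)
  then show ?thesis
    using angular_order(2) point_pair.angular_order(2)[OF swapped] by (auto simp: sweep_def)
qed

lemma length_sweep: "length (sweep X a b) = card X - 2"
proof -
  have "card (X - {a, b}) = card X - 2"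
    using in_X neq finite_X by (subst card_Diff_subset) auto
  then show ?thesis using distinct_card[OF distinct_sweep] set_sweep by simp
qed

lemma not_crossing_sweep: "sorted_wrt (\<lambda>k l. \<not> crossing {b, k} {a, l}) (sweep X a b)"
proof -
  have "\<not> crossing {b, k} {a, l}" if "orient a b k > 0" "orient b a l > 0" for k l
    using that orient_flip[of a b] crossing_commute
      not_crossing_if_separated[of a b a l b k] by auto
  then have "\<forall>k\<in>left_of X a b. \<forall>l\<in>left_of X b a. \<not> crossing {b, k} {a, l}"
    by (auto simp: left_of_def)
  then show ?thesis
    using not_crossing_angular_list point_pair.not_crossing_angular_list[OF swapped]
      angular_order(2) point_pair.angular_order(2)[OF swapped]
    by (simp add: sweep_def sorted_wrt_append sorted_wrt_rev crossing_commute)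
qed

lemma left_side_first_sweep:
  "sorted_wrt (\<lambda>k l. l \<in> left_of X a b \<longrightarrow> k \<in> left_of X a b) (sweep X a b)"
proof -
  have sorted: "sorted_wrt (\<lambda>k l. l \<in> left_of X a b \<longrightarrow> k \<in> left_of X a b) xs"
    if "set xs \<subseteq> left_of X a b \<or> set xs \<inter> left_of X a b = {}" for xs
    using that by (induction xs) auto
  have "left_of X a b \<inter> left_of X b a = {}"
    using orient_flip[of a b] by (auto simp: left_of_def)
  then show ?thesis
    using angular_order(2) point_pair.angular_order(2)[OF swapped]
      sorted[of "angular_list X a b"] sorted[of "rev (angular_list X b a)"]
    by (auto simp: sweep_def sorted_wrt_append)
qed

lemma ccw_next_hd_sweep: "\<not> supporting X a b \<Longrightarrow> ccw_next X a b (hd (sweep X a b))"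
  using ccw_next_hd_angular_list[OF in_X] angular_order(2)
  by (cases "angular_list X a b") (auto simp: sweep_def supporting_def)

lemma ccw_next_last_sweep: "\<not> supporting X b a \<Longrightarrow> ccw_next X b a (last (sweep X a b))"
  using ccw_next_hd_angular_list[OF in_X(2,1)] point_pair.angular_order(2)[OF swapped]
  by (cases "angular_list X b a") (auto simp: sweep_def supporting_def)

end

subsection \<open>Stars and trees close to stars\<close>

definition star :: "'a \<Rightarrow> 'a set \<Rightarrow> 'a set set" where
  "star b A = (\<lambda>k. {b, k}) ` A"

definition double_star :: "'a \<Rightarrow> 'a \<Rightarrow> 'a set \<Rightarrow> 'a set \<Rightarrow> 'a set set" where
  "double_star a b A B = insert {a, b} (star a A \<union> star b B)"

definition linked_stars :: "'a \<Rightarrow> 'a \<Rightarrow> 'a \<Rightarrow> 'a set \<Rightarrow> 'a set \<Rightarrow> 'a set set" where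
  "linked_stars a b k A B = star a (insert k A) \<union> star b (insert k B)"

definition near_star :: "'a set \<Rightarrow> 'a \<Rightarrow> 'a \<Rightarrow> 'a \<Rightarrow> 'a set set" where
  "near_star X b a y = insert {a, y} (star b (X - {b, y}))"

definition detour_star :: "'a set \<Rightarrow> 'a \<Rightarrow> 'a \<Rightarrow> 'a \<Rightarrow> 'a \<Rightarrow> 'a \<Rightarrow> 'a set set" where
  "detour_star X b a y c z = insert {a, y} (insert {c, z} (star b (X - {b, y, z})))"

lemma star_empty [simp]: "star b {} = {}"
  and star_insert [simp]: "star b (insert x A) = insert {b, x} (star b A)"
  by (simp_all add: star_def)

lemma edge_in_star [simp]: "{x, y} \<in> star b A \<longleftrightarrow> x = b \<and> y \<in> A \<or> y = b \<and> x \<in> A"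
  by (auto simp: star_def doubleton_eq_iff)

lemma tree_on_Un_star:
  assumes "finite A" "tree_on V T" "b \<in> V" "A \<inter> V = {}"
  shows "tree_on (V \<union> A) (T \<union> star b A)"
  using assms
proof (induction A rule: finite_induct)
  case (insert x A)
  then have "tree_on (insert x (V \<union> A)) (insert {b, x} (T \<union> star b A))"
    by (intro tree_on_insert) auto
  then show ?case by simp
qed simp

lemma tree_on_star: "finite A \<Longrightarrow> b \<notin> A \<Longrightarrow> tree_on (insert b A) (star b A)"
  using tree_on_Un_star[OF _ tree_on_single, of A b] by simp

lemma tree_on_double_star:
  assumes "finite A" "finite B" "A \<inter> B = {}" "a \<notin> A \<union> B" "b \<notin> A \<union> B" "a \<noteq> b"
  shows "tree_on ({a, b} \<union> A \<union> B) (double_star a b A B)"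
proof -
  have "tree_on {b, a} {{a, b}}"
    using assms by (intro tree_on_insert tree_on_single) auto
  then have "tree_on ({b, a} \<union> A) ({{a, b}} \<union> star a A)"
    using assms by (intro tree_on_Un_star) auto
  from tree_on_Un_star[OF assms(2) this, of b]
  have "tree_on ({b, a} \<union> A \<union> B) ({{a, b}} \<union> star a A \<union> star b B)"
    using assms by auto
  then show ?thesis by (simp add: double_star_def insert_commute)
qed

lemma tree_on_linked_stars:
  assumes "finite A" "finite B" "A \<inter> B = {}" "a \<notin> A \<union> B" "b \<notin> A \<union> B" "k \<notin> A \<union> B"
    and "a \<noteq> b" "k \<noteq> a" "k \<noteq> b"
  shows "tree_on ({a, b, k} \<union> A \<union> B) (linked_stars a b k A B)"
proof -
  have "tree_on {b, k, a} {{k, b}, {a, k}}"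
    using assms by (intro tree_on_insert tree_on_single) auto
  then have "tree_on ({b, k, a} \<union> A) ({{k, b}, {a, k}} \<union> star a A)"
    using assms by (intro tree_on_Un_star) auto
  from tree_on_Un_star[OF assms(2) this, of b]
  have "tree_on ({b, k, a} \<union> A \<union> B) ({{k, b}, {a, k}} \<union> star a A \<union> star b B)"
    using assms by auto
  then show ?thesis by (simp add: linked_stars_def insert_commute Un_insert_right)
qed

lemma flipI:
  assumes "T = insert e R" "T' = insert f R" "e \<notin> R" "f \<notin> R" "e \<noteq> f"
  shows "flip T f T'"
  unfolding flip_def using assms by auto

lemma flip_Un_disjoint:
  assumes "flip T f T'" "S \<inter> insert f T = {}"
  shows "flip (S \<union> T) f (S \<union> T')"
proof -
  obtain e where "e \<in> T" "f \<notin> T" "T' = insert f (T - {e})" using assms(1) by (auto simp: flip_def)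
  then show ?thesis
    using assms(2) by (intro flipI[where e = e and R = "S \<union> (T - {e})"]) auto
qed

lemma
  assumes "x \<notin> A \<union> B" "a \<notin> B" "b \<notin> A" "x \<noteq> a" "x \<noteq> b" "a \<noteq> b"
  shows flip_double_star:
    "flip (double_star a b (insert x A) B) {b, x} (double_star a b A (insert x B))"
    and flip_double_star_linked_stars:
      "flip (double_star a b (insert x A) B) {b, x} (linked_stars a b x A B)"
    and flip_linked_stars_double_star:
      "flip (linked_stars a b x A B) {a, b} (double_star a b A (insert x B))"
proof -
  show "flip (double_star a b (insert x A) B) {b, x} (double_star a b A (insert x B))"
    by (rule flipI[where e = "{a, x}" and R = "double_star a b A B"])
      (use assms in \<open>auto simp: double_star_def doubleton_eq_iff\<close>)
  show "flip (double_star a b (insert x A) B) {b, x} (linked_stars a b x A B)"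
    by (rule flipI[where e = "{a, b}" and R = "star a (insert x A) \<union> star b B"])
      (use assms in \<open>auto simp: double_star_def linked_stars_def doubleton_eq_iff\<close>)
  show "flip (linked_stars a b x A B) {a, b} (double_star a b A (insert x B))"
    by (rule flipI[where e = "{a, x}" and R = "star a A \<union> star b (insert x B)"])
      (use assms in \<open>auto simp: double_star_def linked_stars_def doubleton_eq_iff\<close>)
qed

lemma
  assumes "b \<in> X" "y \<in> X" "a \<in> X" "y \<noteq> b" "a \<noteq> b" "a \<noteq> y"
  shows flip_near_star_star: "flip (near_star X b a y) {b, y} (star b (X - {b}))"
    and flip_star_near_star: "flip (star b (X - {b})) {a, y} (near_star X b a y)"
proof -
  have "X - {b} = insert y (X - {b, y})" using assms by auto
  then have star: "star b (X - {b}) = insert {b, y} (star b (X - {b, y}))" by simp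
  show "flip (near_star X b a y) {b, y} (star b (X - {b}))"
    by (rule flipI[where e = "{a, y}", OF near_star_def star])
      (use assms in \<open>auto simp: doubleton_eq_iff\<close>)
  show "flip (star b (X - {b})) {a, y} (near_star X b a y)"
    by (rule flipI[where e = "{b, y}", OF star near_star_def])
      (use assms in \<open>auto simp: doubleton_eq_iff\<close>)
qed

lemma near_star_eq_double_star:
  assumes "a \<in> X" "b \<in> X" "a \<noteq> b" "y \<noteq> a"
  shows "near_star X b a y = double_star a b {y} (X - {a, b, y})"
proof -
  have "X - {b, y} = insert a (X - {a, b, y})" using assms by auto
  then show ?thesis by (simp add: near_star_def double_star_def insert_commute)
qed

lemma double_star_commute: "double_star a b A B = double_star b a B A"
  by (auto simp: double_star_def insert_commute)

subsubsection \<open>Degrees\<close>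

definition nbrs :: "'a set set \<Rightarrow> 'a \<Rightarrow> 'a set" where
  "nbrs T x = {u. {x, u} \<in> T}"

definition spine :: "'a set set \<Rightarrow> 'a set" where
  "spine T = {x. 2 \<le> card (nbrs T x)}"

definition heavy :: "'a set set \<Rightarrow> 'a set" where
  "heavy T = {x. 3 \<le> card (nbrs T x)}"

definition spine_ends :: "'a set set \<Rightarrow> 'a set" where
  "spine_ends T = {x \<in> spine T. \<exists>u \<in> spine T. u \<noteq> x \<and> {x, u} \<notin> T}"

lemma nbrs_simps [simp]:
  "nbrs {} x = {}"
  "nbrs (S \<union> T) x = nbrs S x \<union> nbrs T x"
  "nbrs (insert {u, w} T) x = (if x = u then {w} else {}) \<union> (if x = w then {u} else {}) \<union> nbrs T x"
  "nbrs (star b A) x = (if x = b then A else {}) \<union> (if x \<in> A then {b} else {})"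
  by (auto simp: nbrs_def doubleton_eq_iff)

lemma heavy_subset_spine: "heavy T \<subseteq> spine T"
  by (auto simp: heavy_def spine_def)

lemma spineI:
  assumes "u \<in> nbrs T x" "w \<in> nbrs T x" "u \<noteq> w" "finite (nbrs T x)"
  shows "x \<in> spine T"
  using card_mono[of "nbrs T x" "{u, w}"] assms by (simp add: spine_def)

lemma heavyI:
  assumes "u \<in> nbrs T x" "w \<in> nbrs T x" "z \<in> nbrs T x" "distinct [u, w, z]" "finite (nbrs T x)"
  shows "x \<in> heavy T"
  using card_mono[of "nbrs T x" "{u, w, z}"] assms by (simp add: heavy_def)

lemma not_in_spineI: "nbrs T x \<subseteq> {u} \<Longrightarrow> x \<notin> spine T"
  using card_mono[of "{u}" "nbrs T x"] by (simp add: spine_def)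

lemma spine_star:
  assumes "finite A" "2 \<le> card A" "b \<notin> A"
  shows "spine (star b A) = {b}"
proof -
  have "x \<notin> spine (star b A)" if "x \<noteq> b" for x
    using that by (intro not_in_spineI[of _ _ b]) auto
  moreover have "nbrs (star b A) b = A" using assms(3) by auto
  ultimately show ?thesis using assms(2) by (auto simp: spine_def)
qed

lemma spine_double_star:
  assumes "finite A" "finite B" "A \<noteq> {}" "B \<noteq> {}" "A \<inter> B = {}" "a \<notin> A \<union> B" "b \<notin> A \<union> B" "a \<noteq> b"
  shows "spine (double_star a b A B) = {a, b}"
proof -
  let ?T = "double_star a b A B"
  obtain x y where "x \<in> A" "y \<in> B" using assms by auto
  then have "a \<in> spine ?T" "b \<in> spine ?T"
    using assms by (auto simp: double_star_def intro: spineI[of b _ _ x] spineI[of a _ _ y])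
  moreover have "x \<notin> spine ?T" if "x \<noteq> a" "x \<noteq> b" for x
    using assms that
    by (intro not_in_spineI[of _ _ "if x \<in> A then a else b"]) (auto simp: double_star_def)
  ultimately show ?thesis by blast
qed

lemma
  assumes "finite A" "finite B" "A \<noteq> {}" "B \<noteq> {}" "A \<inter> B = {}" "a \<notin> A \<union> B" "b \<notin> A \<union> B"
    and "a \<noteq> b" "k \<notin> A \<union> B" "k \<noteq> a" "k \<noteq> b"
  shows spine_linked_stars: "spine (linked_stars a b k A B) = {a, b, k}"
    and spine_ends_linked_stars: "spine_ends (linked_stars a b k A B) = {a, b}"
    and ends_linked_stars_heavy_iff: "a \<in> heavy (linked_stars a b k A B) \<longleftrightarrow> 2 \<le> card A"
      "b \<in> heavy (linked_stars a b k A B) \<longleftrightarrow> 2 \<le> card B"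
proof -
  let ?T = "linked_stars a b k A B"
  have nbrs: "nbrs ?T a = insert k A" "nbrs ?T b = insert k B" "nbrs ?T k = {a, b}"
    using assms by (auto simp: linked_stars_def)
  then have card: "card (nbrs ?T a) = Suc (card A)" "card (nbrs ?T b) = Suc (card B)"
    "card (nbrs ?T k) = 2" using assms by auto
  then show "a \<in> heavy ?T \<longleftrightarrow> 2 \<le> card A" "b \<in> heavy ?T \<longleftrightarrow> 2 \<le> card B"
    by (auto simp: heavy_def)
  have "x \<notin> spine ?T" if "x \<notin> {a, b, k}" for x
    using assms that
    by (intro not_in_spineI[of _ _ "if x \<in> A then a else b"]) (auto simp: linked_stars_def)
  moreover have "card A > 0" "card B > 0" using assms by (auto simp: card_gt_0_iff)
  ultimately show spine: "spine ?T = {a, b, k}" using card by (auto simp: spine_def)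
  have "{a, b} \<notin> ?T" "{a, k} \<in> ?T" "{b, k} \<in> ?T"
    using assms by (auto simp: linked_stars_def doubleton_eq_iff)
  then show "spine_ends ?T = {a, b}"
    unfolding spine_ends_def spine using assms by (auto simp: insert_commute)
qed

subsubsection \<open>Detours\<close>

locale detour =
  fixes X :: "'a set" and b a y c z :: 'a
  assumes in_X: "a \<in> X" "b \<in> X" "c \<in> X" "y \<in> X" "z \<in> X"
    and neq: "a \<noteq> b" "b \<noteq> c" "a \<noteq> c" "y \<noteq> a" "y \<noteq> b" "z \<noteq> b" "z \<noteq> c" "y \<noteq> z"
    and not_swapped: "\<not> (y = c \<and> z = a)"
begin

lemma flip_near_star_detour_star: "flip (near_star X b a y) {c, z} (detour_star X b a y c z)"
proof -
  have "X - {b, y} = insert z (X - {b, y, z})" using in_X neq by auto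
  then show ?thesis
    using neq not_swapped unfolding near_star_def detour_star_def
    by (intro flipI[where e = "{b, z}" and R = "insert {a, y} (star b (X - {b, y, z}))"])
      (auto simp: doubleton_eq_iff)
qed

lemma flip_detour_star_near_star: "flip (detour_star X b a y c z) {b, y} (near_star X b c z)"
proof -
  have "X - {b, z} = insert y (X - {b, y, z})" using in_X neq by auto
  then show ?thesis
    using neq not_swapped unfolding near_star_def detour_star_def
    by (intro flipI[where e = "{a, y}" and R = "insert {c, z} (star b (X - {b, y, z}))"])
      (auto simp: doubleton_eq_iff)
qed

lemma tree_on_detour_star:
  assumes "finite X"
  shows "tree_on X (detour_star X b a y c z)"
proof -
  let ?Y = "insert b (X - {b, y, z})" and ?S = "star b (X - {b, y, z})"
  have Y: "tree_on ?Y ?S" using assms by (intro tree_on_star) auto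
  have "tree_on (insert z (insert y ?Y)) (insert {c, z} (insert {a, y} ?S))" if "a \<noteq> z"
    using that in_X neq by (intro tree_on_insert Y) auto
  moreover have "tree_on (insert y (insert z ?Y)) (insert {a, y} (insert {c, z} ?S))" if "a = z"
    using that in_X neq not_swapped by (intro tree_on_insert Y) auto
  moreover have "insert y (insert z ?Y) = X" using in_X by auto
  ultimately show ?thesis
    by (cases "a = z")
      (simp_all add: detour_star_def insert_commute[of y z] insert_commute[of "{a, y}"])
qed

lemma
  assumes "finite X" "card X \<ge> 6"
  shows spine_detour_star: "spine (detour_star X b a y c z) = {a, b, c}"
    and heavy_detour_star: "heavy (detour_star X b a y c z) = {b}"
proof -
  let ?T = "detour_star X b a y c z"
  have nbrs: "nbrs ?T b = X - {b, y, z}" "nbrs ?T a = {y, if z = a then c else b}"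
    "nbrs ?T c = {z, if y = c then a else b}"
    using in_X neq by (auto simp: detour_star_def)
  have "card (X - {b, y, z}) = card X - 3"
    using in_X neq assms(1) by (subst card_Diff_subset) auto
  then have card: "card (nbrs ?T b) \<ge> 3" "card (nbrs ?T a) = 2" "card (nbrs ?T c) = 2"
    using assms(2) neq not_swapped by (auto simp: nbrs)
  have leaf: "x \<notin> spine ?T" if "x \<notin> {a, b, c}" for x
    using that neq
    by (intro not_in_spineI[of _ _ "if x = y then a else if x = z then c else b"])
      (auto simp: detour_star_def)
  then show "spine ?T = {a, b, c}" using card by (auto simp: spine_def)
  have "x \<in> heavy ?T \<longleftrightarrow> x = b" for x
    using leaf[of x] card by (cases "x \<in> {a, b, c}") (auto simp: heavy_def spine_def)
  then show "heavy ?T = {b}" by auto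
qed

end

subsubsection \<open>Plane stars\<close>

context points
begin

lemma cross_free_star: "b \<in> X \<Longrightarrow> A \<union> B \<subseteq> X - {b} \<Longrightarrow> cross_free (star b A) (star b B)"
  unfolding cross_free_def star_def
  by (intro ballI) (auto dest!: subsetD intro: not_crossing_if_shared[THEN notE])

lemma plane_double_star:
  assumes "a \<in> X" "b \<in> X" "a \<noteq> b" "A \<union> B = X - {a, b}" "A \<inter> B = {}"
    and "cross_free (star a A) (star b B)"
  shows "plane_tree X (double_star a b A B)"
proof (rule plane_treeI)
  have "X = {a, b} \<union> A \<union> B" "finite A" "finite B"
    using assms(1,2,4) finite_X by (auto intro: finite_subset[of _ X])
  then show "tree_on X (double_star a b A B)"
    using tree_on_double_star[of A B a b] assms(3-5) by auto
  have eq: "double_star a b A B = star a (insert b A) \<union> star b B"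
    "star a (insert b A) = star b {a} \<union> star a A"
    by (simp_all add: double_star_def insert_commute)
  have "cross_free (star a (insert b A)) (star a (insert b A))"
    "cross_free (star b B) (star b B)" "cross_free (star b {a}) (star b B)"
    using assms(1-4) by (intro cross_free_star; blast)+
  then show "cross_free (double_star a b A B) (double_star a b A B)"
    using assms(6) unfolding eq(1) cross_free_Un_self by (simp only: eq(2) cross_free_simps)
qed

lemma plane_linked_stars:
  assumes "a \<in> X" "b \<in> X" "a \<noteq> b" "k \<in> X" "k \<noteq> a" "k \<noteq> b"
    and "A \<union> B = X - {a, b, k}" "A \<inter> B = {}"
    and "cross_free (star a (insert k A)) (star b (insert k B))"
  shows "plane_tree X (linked_stars a b k A B)"
proof (rule plane_treeI)
  have "X = {a, b, k} \<union> A \<union> B" "finite A" "finite B"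
    using assms(1,2,4,7) finite_X by (auto intro: finite_subset[of _ X])
  then show "tree_on X (linked_stars a b k A B)"
    using tree_on_linked_stars[of A B a b k] assms(3-8) by auto
  have "cross_free (star a (insert k A)) (star a (insert k A))"
    "cross_free (star b (insert k B)) (star b (insert k B))"
    using assms(1-7) by (intro cross_free_star; blast)+
  then show "cross_free (linked_stars a b k A B) (linked_stars a b k A B)"
    using assms(9) by (simp only: linked_stars_def cross_free_Un_self)
qed

lemma plane_star:
  assumes "b \<in> X"
  shows "plane_tree X (star b (X - {b}))"
proof (rule plane_treeI)
  show "tree_on X (star b (X - {b}))"
    using tree_on_star[of "X - {b}" b] finite_X assms by (simp add: insert_absorb)
  show "cross_free (star b (X - {b})) (star b (X - {b}))"
    using assms by (intro cross_free_star) auto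
qed

lemma plane_detour_star:
  assumes "detour X b a y c z" "plane_tree X (near_star X b a y)" "plane_tree X (near_star X b c z)"
    and "\<not> crossing {a, y} {c, z}"
  shows "plane_tree X (detour_star X b a y c z)"
proof (rule plane_treeI)
  interpret detour X b a y c z by fact
  show "tree_on X (detour_star X b a y c z)" by (rule tree_on_detour_star[OF finite_X])
  let ?rest = "star b (X - {b, y, z})"
  have "cross_free ({{a, y}} \<union> ?rest) ({{a, y}} \<union> ?rest)"
  proof (rule cross_free_mono)
    show "cross_free (near_star X b a y) (near_star X b a y)"
      using assms(2) by (simp add: plane_tree_def)
  qed (auto simp: near_star_def star_def)
  moreover have "cross_free ({{c, z}} \<union> ?rest) ({{c, z}} \<union> ?rest)"
  proof (rule cross_free_mono)
    show "cross_free (near_star X b c z) (near_star X b c z)"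
      using assms(3) by (simp add: plane_tree_def)
  qed (auto simp: near_star_def star_def)
  moreover have "cross_free {{a, y}} {{c, z}}" using assms(4) by (simp add: cross_free_def)
  moreover have eq: "detour_star X b a y c z = {{a, y}} \<union> {{c, z}} \<union> ?rest"
    by (auto simp: detour_star_def)
  ultimately show "cross_free (detour_star X b a y c z) (detour_star X b a y c z)"
    unfolding eq cross_free_Un_self by (simp only: cross_free_simps)
qed

end

subsection \<open>Moving from star to star\<close>

definition stage_tree :: "point set \<Rightarrow> point \<Rightarrow> point \<Rightarrow> nat \<Rightarrow> point set set" where
  "stage_tree X a b t = double_star a b (set (drop t (sweep X a b))) (set (take t (sweep X a b)))"

definition stage_flips :: "point set \<Rightarrow> point \<Rightarrow> point \<Rightarrow> nat \<Rightarrow> nat \<Rightarrow> flips" where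
  "stage_flips X a b i j = map (\<lambda>t. (stage_tree X a b t, {b, sweep X a b ! t})) [i..<j]"

lemma source_stage_flips:
  "i \<le> j \<Longrightarrow> source (stage_flips X a b i j) (stage_tree X a b j) = stage_tree X a b i"
  unfolding stage_flips_def by (rule source_map_upt)

lemma stage_flips_append:
  "i \<le> j \<Longrightarrow> j \<le> k \<Longrightarrow> stage_flips X a b i k = stage_flips X a b i j @ stage_flips X a b j k"
  using upt_add_eq_append[of i j "k - j"] by (simp add: stage_flips_def)

context point_pair
begin

abbreviation "sw \<equiv> sweep X a b"

lemma sweep_partition:
  "set (drop t sw) \<union> set (take t sw) = X - {a, b}" "set (drop t sw) \<inter> set (take t sw) = {}"
proof -
  show "set (drop t sw) \<union> set (take t sw) = X - {a, b}"
    using set_sweep append_take_drop_id[of t sw] by (metis set_append sup_commute)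
  show "set (drop t sw) \<inter> set (take t sw) = {}"
    using set_take_disj_set_drop_if_distinct[OF distinct_sweep, of t t] by auto
qed

lemma nth_sweep:
  assumes "t < card X - 2"
  shows "sw ! t \<in> X" "sw ! t \<noteq> a" "sw ! t \<noteq> b"
  using nth_mem[of t sw] assms set_sweep length_sweep by auto

lemma sweep_nth_split:
  assumes "t < card X - 2"
  shows "set (drop t sw) = insert (sw ! t) (set (drop (Suc t) sw))"
    and "set (take (Suc t) sw) = insert (sw ! t) (set (take t sw))"
    and "sw ! t \<notin> set (drop (Suc t) sw)" "sw ! t \<notin> set (take t sw)"
proof -
  have t: "t < length sw" using assms length_sweep by simp
  show drop: "set (drop t sw) = insert (sw ! t) (set (drop (Suc t) sw))"
    using Cons_nth_drop_Suc[OF t] by (metis list.simps(15))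
  show take: "set (take (Suc t) sw) = insert (sw ! t) (set (take t sw))"
    using t by (simp add: take_Suc_conv_app_nth)
  show "sw ! t \<notin> set (drop (Suc t) sw)" "sw ! t \<notin> set (take t sw)"
    using sweep_partition(2)[of "Suc t"] sweep_partition(2)[of t] drop take by auto
qed

lemma cross_free_sweep:
  assumes "s \<le> Suc t"
  shows "cross_free (star a (set (drop t sw))) (star b (set (take s sw)))"
proof -
  have "\<not> crossing {b, sw ! i} {a, sw ! j}"
    if "i < s" "t \<le> j" "i < length sw" "j < length sw" for i j
  proof (cases "i = j")
    case True
    then show ?thesis
      using that nth_sweep[of i] length_sweep in_X not_crossing_if_shared[of "sw ! i" b a]
      by (simp add: insert_commute)
  next
    case False
    then have "i < j" using that assms by linarith
    then show ?thesis using not_crossing_sweep that(4) by (simp add: sorted_wrt_iff_nth_less)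
  qed
  then have "\<not> crossing {b, l} {a, k}" if "l \<in> set (take s sw)" "k \<in> set (drop t sw)" for k l
    using that unfolding in_set_conv_nth by fastforce
  then show ?thesis by (simp add: cross_free_def star_def crossing_commute)
qed

lemma plane_stage_tree: "plane_tree X (stage_tree X a b t)"
  unfolding stage_tree_def
  by (intro plane_double_star in_X neq sweep_partition cross_free_sweep) simp

lemma flip_stage_tree:
  assumes "t < card X - 2"
  shows "flip (stage_tree X a b t) {b, sw ! t} (stage_tree X a b (Suc t))"
  unfolding stage_tree_def sweep_nth_split(1,2)[OF assms]
  using sweep_partition(1)[of t] sweep_partition(1)[of "Suc t"] sweep_nth_split(3,4)[OF assms]
    nth_sweep[OF assms] neq
  by (intro flip_double_star) auto

lemma flip_path_stage_flips:
  "i \<le> j \<Longrightarrow> j \<le> card X - 2 \<Longrightarrow> flip_path X (stage_flips X a b i j) (stage_tree X a b j)"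
  unfolding stage_flips_def using plane_stage_tree flip_stage_tree by (intro flip_path_map_upt) auto

text \<open>The stage \<open>t\<close> is left by removing the edge from \<open>a\<close> to the \<open>t\<close>-th point of the sweep.\<close>

lemma removed_edge_stage_tree_iff:
  assumes "t < card X - 2"
  shows "{a, sw ! t} \<in> stage_tree X a b s \<longleftrightarrow> s \<le> t"
proof -
  have t: "t < length sw" using assms length_sweep by simp
  have "sw ! t \<in> set (drop s sw) \<longleftrightarrow> s \<le> t"
  proof
    assume "sw ! t \<in> set (drop s sw)"
    then obtain i where "i < length sw - s" "sw ! (s + i) = sw ! t" by (auto simp: in_set_conv_nth)
    then have "s + i = t" using t distinct_sweep by (simp add: nth_eq_iff_index_eq)
    then show "s \<le> t" by simp
  next
    assume "s \<le> t"
    then show "sw ! t \<in> set (drop s sw)"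
      using t by (auto simp: in_set_conv_nth intro!: exI[of _ "t - s"])
  qed
  then show ?thesis
    using nth_sweep[OF assms] sweep_partition(1)[of s] neq
    by (auto simp: stage_tree_def double_star_def doubleton_eq_iff)
qed

lemma inj_on_stage_tree: "inj_on (stage_tree X a b) {..card X - 2}"
proof (rule linorder_inj_onI)
  fix s t assume "s < t" "s \<in> {..card X - 2}" "t \<in> {..card X - 2}"
  then show "stage_tree X a b s \<noteq> stage_tree X a b t"
    using removed_edge_stage_tree_iff[of s s] removed_edge_stage_tree_iff[of s t] by auto
qed auto

lemma labels_stage_flips: "map snd (stage_flips X a b 0 (card X - 2)) = map (\<lambda>k. {b, k}) sw"
  using length_sweep by (intro nth_equalityI) (auto simp: stage_flips_def)

lemma count_labels_stage_flips:
  "count_list (map snd (stage_flips X a b 0 (card X - 2))) f = of_bool (f \<in> star b (X - {a, b}))"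
proof -
  have "distinct (map (\<lambda>k. {b, k}) sw)"
    using distinct_sweep set_sweep by (auto simp: distinct_map inj_on_def doubleton_eq_iff)
  then show ?thesis
    using set_sweep by (simp add: labels_stage_flips count_list_distinct star_def)
qed

lemma stage_tree_0: "stage_tree X a b 0 = star a (X - {a})"
proof -
  have "X - {a} = insert b (X - {a, b})" using in_X neq by auto
  then show ?thesis using set_sweep by (simp add: stage_tree_def double_star_def)
qed

lemma stage_tree_all: "stage_tree X a b (card X - 2) = insert {a, b} (star b (X - {a, b}))"
  using length_sweep set_sweep by (simp add: stage_tree_def double_star_def)

lemma hd_last_sweep:
  assumes "card X \<ge> 3"
  shows "hd sw = sw ! 0" "last sw = sw ! (card X - 3)"
proof -
  have "sw \<noteq> []" "length sw - 1 = card X - 3" using assms length_sweep by auto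
  then show "hd sw = sw ! 0" "last sw = sw ! (card X - 3)" by (auto simp: hd_conv_nth last_conv_nth)
qed

lemma stage_tree_first:
  assumes "card X \<ge> 3"
  shows "stage_tree X a b 1 = near_star X a b (hd sw)"
proof -
  have "set (take 1 sw) = {sw ! 0}"
    using sweep_nth_split(2)[of 0] assms by simp
  moreover from this have "set (drop 1 sw) = X - {b, a, sw ! 0}"
    using sweep_partition[of 1] by auto
  ultimately show ?thesis
    using near_star_eq_double_star[of b X a "sw ! 0"] nth_sweep[of 0] in_X neq assms
    by (simp add: stage_tree_def hd_last_sweep double_star_commute[of b])
qed

lemma stage_tree_last:
  assumes "card X \<ge> 3"
  shows "stage_tree X a b (card X - 3) = near_star X b a (last sw)"
proof -
  have t: "card X - 3 < card X - 2" "Suc (card X - 3) = length sw" using assms length_sweep by auto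
  have "set (drop (card X - 3) sw) = {sw ! (card X - 3)}"
    using sweep_nth_split(1)[OF t(1)] t(2) by simp
  moreover from this have "set (take (card X - 3) sw) = X - {a, b, sw ! (card X - 3)}"
    using sweep_partition[of "card X - 3"] by auto
  ultimately show ?thesis
    using near_star_eq_double_star[of a X b "sw ! (card X - 3)"] nth_sweep[OF t(1)] in_X neq assms
    by (simp add: stage_tree_def hd_last_sweep)
qed

lemma spine_stage_tree:
  assumes "1 \<le> t" "t \<le> card X - 3"
  shows "spine (stage_tree X a b t) = {a, b}"
proof -
  have "set (drop t sw) \<noteq> {}" "set (take t sw) \<noteq> {}" using assms length_sweep by auto
  then show ?thesis
    unfolding stage_tree_def using sweep_partition[of t] neq by (intro spine_double_star) auto
qed

end

text \<open>Removing the edge \<open>ab\<close> and putting it back lets this edge enter as well. The moment is chosen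
  so that \<open>a\<close> or \<open>b\<close>, depending on the side of the linking vertex, is heavy meanwhile; this
  tells the tree without \<open>ab\<close> from the trees on the detours around a star.\<close>

definition link_pos :: "point set \<Rightarrow> point \<Rightarrow> point \<Rightarrow> nat" where
  "link_pos X a b = (if sweep X a b ! 1 \<in> left_of X a b then 2 else card X - 3)"

definition link_vertex :: "point set \<Rightarrow> point \<Rightarrow> point \<Rightarrow> point" where
  "link_vertex X a b = sweep X a b ! (link_pos X a b - 1)"

definition link_tree :: "point set \<Rightarrow> point \<Rightarrow> point \<Rightarrow> point set set" where
  "link_tree X a b = linked_stars a b (link_vertex X a b)
     (set (drop (link_pos X a b) (sweep X a b))) (set (take (link_pos X a b - 1) (sweep X a b)))"

definition move_flips :: "bool \<Rightarrow> point set \<Rightarrow> point \<Rightarrow> point \<Rightarrow> flips" where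
  "move_flips linked X a b =
     stage_flips X a b 1 (link_pos X a b) @
     (if linked then [(link_tree X a b, {a, b})] else []) @
     stage_flips X a b (link_pos X a b) (card X - 3)"

definition move_trees :: "point set \<Rightarrow> point \<Rightarrow> point \<Rightarrow> point set set set" where
  "move_trees X a b = insert (link_tree X a b) (stage_tree X a b ` {1..card X - 3})"

locale move = point_pair +
  assumes six_points: "card X \<ge> 6"
begin

abbreviation "pos \<equiv> link_pos X a b"

lemma link_pos_bounds: "2 \<le> pos" "pos \<le> card X - 3" "pos - 1 < card X - 2" "Suc (pos - 1) = pos"
  using six_points by (auto simp: link_pos_def)

lemma link_vertex: "link_vertex X a b \<in> X" "link_vertex X a b \<noteq> a" "link_vertex X a b \<noteq> b"
  unfolding link_vertex_def using nth_sweep[OF link_pos_bounds(3)] .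

lemma link_vertex_split:
  "set (drop (pos - 1) sw) = insert (link_vertex X a b) (set (drop pos sw))"
  "set (take pos sw) = insert (link_vertex X a b) (set (take (pos - 1) sw))"
  "link_vertex X a b \<notin> set (drop pos sw)" "link_vertex X a b \<notin> set (take (pos - 1) sw)"
  using sweep_nth_split[OF link_pos_bounds(3)] link_pos_bounds(4) by (simp_all add: link_vertex_def)

lemma link_partition:
  "set (drop pos sw) \<union> set (take (pos - 1) sw) = X - {a, b, link_vertex X a b}"
  "set (drop pos sw) \<inter> set (take (pos - 1) sw) = {}"
  using sweep_partition[of pos] link_vertex_split by auto

lemma plane_link_tree: "plane_tree X (link_tree X a b)"
  unfolding link_tree_def
proof (rule plane_linked_stars)
  show "cross_free (star a (insert (link_vertex X a b) (set (drop pos sw))))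
      (star b (insert (link_vertex X a b) (set (take (pos - 1) sw))))"
    unfolding link_vertex_split(1,2)[symmetric] using link_pos_bounds
    by (intro cross_free_sweep) simp
qed (use in_X neq link_vertex link_partition in auto)

lemma
  shows flip_stage_tree_link_tree:
    "flip (stage_tree X a b (pos - 1)) {b, sw ! (pos - 1)} (link_tree X a b)"
    and flip_link_tree_stage_tree: "flip (link_tree X a b) {a, b} (stage_tree X a b pos)"
  unfolding stage_tree_def link_tree_def link_vertex_split(1,2) link_vertex_def[symmetric]
  using link_vertex_split(3,4) link_partition(1) link_vertex neq
  by (intro flip_double_star_linked_stars flip_linked_stars_double_star; blast)+

lemma
  shows spine_link_tree: "spine (link_tree X a b) = {a, b, link_vertex X a b}"
    and spine_ends_link_tree: "spine_ends (link_tree X a b) = {a, b}"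
    and link_tree_left_heavy: "link_vertex X a b \<in> left_of X a b \<Longrightarrow> a \<in> heavy (link_tree X a b)"
    and link_tree_right_heavy: "link_vertex X a b \<notin> left_of X a b \<Longrightarrow> b \<in> heavy (link_tree X a b)"
proof -
  have nonempty: "set (drop pos sw) \<noteq> {}" "set (take (pos - 1) sw) \<noteq> {}"
    using link_pos_bounds length_sweep by auto
  have sets: "a \<notin> set (drop pos sw) \<union> set (take (pos - 1) sw)"
    "b \<notin> set (drop pos sw) \<union> set (take (pos - 1) sw)"
    "link_vertex X a b \<notin> set (drop pos sw) \<union> set (take (pos - 1) sw)"
    unfolding link_partition(1) by auto
  note hyps = finite_set finite_set nonempty link_partition(2) sets(1,2) neq sets(3)
    link_vertex(2,3)
  show "spine (link_tree X a b) = {a, b, link_vertex X a b}"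
    "spine_ends (link_tree X a b) = {a, b}"
    unfolding link_tree_def
    by (rule spine_linked_stars[OF hyps] spine_ends_linked_stars[OF hyps])+
  note heavy_iff = ends_linked_stars_heavy_iff[OF hyps, folded link_tree_def]
  have card: "card (set (drop pos sw)) = card X - 2 - pos"
    "card (set (take (pos - 1) sw)) = pos - 1"
    using distinct_sweep length_sweep link_pos_bounds by (auto simp: distinct_card)
  show "a \<in> heavy (link_tree X a b)" if left: "link_vertex X a b \<in> left_of X a b"
  proof -
    have "pos = 2"
    proof (rule ccontr)
      assume "pos \<noteq> 2"
      then have pos: "pos = card X - 3" "sw ! 1 \<notin> left_of X a b"
        by (auto simp: link_pos_def split: if_splits)
      then have "1 < pos - 1" "pos - 1 < length sw" using six_points length_sweep by auto
      then show False
        using left_side_first_sweep left pos(2)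
        by (auto simp: sorted_wrt_iff_nth_less link_vertex_def)
    qed
    then show ?thesis using heavy_iff(1) card(1) six_points by simp
  qed
  show "b \<in> heavy (link_tree X a b)" if "link_vertex X a b \<notin> left_of X a b"
  proof -
    have "pos = card X - 3" using that by (auto simp: link_pos_def link_vertex_def split: if_splits)
    then show ?thesis using heavy_iff(2) card(2) six_points by simp
  qed
qed

lemma card_spine_link_tree: "card (spine (link_tree X a b)) = 3"
  using link_vertex neq by (simp add: spine_link_tree)

lemma stage_flips_split:
  "stage_flips X a b 1 (card X - 2) = stage_flips X a b 1 pos @ stage_flips X a b pos (card X - 3) @
    [(stage_tree X a b (card X - 3), {b, last sw})]"
  "stage_flips X a b 1 pos =
    stage_flips X a b 1 (pos - 1) @ [(stage_tree X a b (pos - 1), {b, sw ! (pos - 1)})]"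
proof -
  have single: "stage_flips X a b t (Suc t) = [(stage_tree X a b t, {b, sw ! t})]" for t
    by (simp add: stage_flips_def)
  have "card X - 2 = Suc (card X - 3)" using six_points by simp
  then show "stage_flips X a b 1 (card X - 2) = stage_flips X a b 1 pos @
      stage_flips X a b pos (card X - 3) @
      [(stage_tree X a b (card X - 3), {b, last sw})]"
    using stage_flips_append[of 1 pos "card X - 2" X a b]
      stage_flips_append[of pos "card X - 3" "card X - 2" X a b] link_pos_bounds
        single[of "card X - 3"]
    by (simp add: hd_last_sweep)
  show "stage_flips X a b 1 pos =
      stage_flips X a b 1 (pos - 1) @ [(stage_tree X a b (pos - 1), {b, sw ! (pos - 1)})]"
    using stage_flips_append[of 1 "pos - 1" pos X a b] link_pos_bounds single[of "pos - 1"] by simp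
qed

lemma flip_path_move_flips: "flip_path X (move_flips linked X a b) (stage_tree X a b (card X - 3))"
proof -
  have stages: "flip_path X (stage_flips X a b i j) (stage_tree X a b j)"
    if "i \<le> j" "j \<le> card X - 3" for i j
    using that by (intro flip_path_stage_flips) auto
  have "flip_path X (stage_flips X a b 1 pos) (link_tree X a b)"
    using stages[of 1 "pos - 1"] link_pos_bounds plane_stage_tree flip_stage_tree_link_tree
    unfolding stage_flips_split(2) by (simp add: flip_path_append)
  then show ?thesis
    using stages[of 1 pos] stages[of pos "card X - 3"] link_pos_bounds plane_link_tree
      flip_link_tree_stage_tree
    by (simp add: move_flips_def flip_path_append source_stage_flips)
qed

lemma source_move_flips: "source (move_flips linked X a b) T = stage_tree X a b 1"
  using link_pos_bounds by (simp add: move_flips_def stage_flips_def upt_conv_Cons)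

lemma set_move_flips: "set (map fst (move_flips linked X a b)) \<subseteq> move_trees X a b"
  using link_pos_bounds by (auto simp: move_flips_def stage_flips_def move_trees_def)

lemma link_tree_neq_stage_tree:
  assumes "1 \<le> t" "t \<le> card X - 3"
  shows "link_tree X a b \<noteq> stage_tree X a b t"
proof
  assume "link_tree X a b = stage_tree X a b t"
  then have "card {a, b} = 3" using spine_stage_tree[OF assms] card_spine_link_tree by simp
  then show False using neq by simp
qed

lemma distinct_move_flips:
  "distinct (map fst (move_flips linked X a b) @ [stage_tree X a b (card X - 3)])"
proof -
  have stages: "map fst (stage_flips X a b i j) = map (stage_tree X a b) [i..<j]" for i j
    by (simp add: stage_flips_def comp_def)
  have distinct: "distinct (map fst (stage_flips X a b 1 (card X - 2)))"
    unfolding stages distinct_map using inj_on_stage_tree by (auto intro: inj_on_subset)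
  have "link_tree X a b \<noteq> stage_tree X a b t" if "t \<in> set [1..<card X - 2]" for t
    using that by (intro link_tree_neq_stage_tree) auto
  then have fresh: "link_tree X a b \<notin> set (map fst (stage_flips X a b 1 (card X - 2)))"
    unfolding stages set_map by blast
  show ?thesis
    using distinct[unfolded stage_flips_split(1)] fresh[unfolded stage_flips_split(1)]
    by (cases linked) (simp_all add: move_flips_def)
qed

lemma count_labels_move_flips:
  assumes f: "f \<in> point_pairs X"
  shows "count_list (map snd (move_flips linked X a b)) f +
      of_bool (f = {b, hd sw}) + of_bool (f = {b, last sw}) =
    of_bool (b \<in> f \<and> (linked \<or> f \<noteq> {a, b}))"
proof -
  let ?count = "\<lambda>i j. count_list (map snd (stage_flips X a b i j)) f"
  have "stage_flips X a b 0 (card X - 2) =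
      (stage_tree X a b 0, {b, hd sw}) # stage_flips X a b 1 (card X - 2)"
    using six_points by (simp add: stage_flips_def hd_last_sweep upt_conv_Cons)
  then have "?count 0 (card X - 2) =
      of_bool (f = {b, hd sw}) + ?count 1 pos + ?count pos (card X - 3) +
      of_bool (f = {b, last sw})"
    unfolding stage_flips_split(1) by simp
  moreover have "f \<in> star b (X - {a, b}) \<longleftrightarrow> b \<in> f \<and> f \<noteq> {a, b}"
    using f in_X by (auto simp: point_pairs_def card_2_iff star_def image_iff doubleton_eq_iff)
  then have "?count 0 (card X - 2) = of_bool (b \<in> f \<and> f \<noteq> {a, b})"
    by (simp only: count_labels_stage_flips)
  moreover have "count_list (map snd (move_flips linked X a b)) f =
      ?count 1 pos + ?count pos (card X - 3) + of_bool (linked \<and> f = {a, b})"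
    by (simp add: move_flips_def)
  moreover have "of_bool (b \<in> f \<and> (linked \<or> f \<noteq> {a, b})) =
      of_bool (b \<in> f \<and> f \<noteq> {a, b}) + (of_bool (linked \<and> f = {a, b}) :: nat)"
    by auto
  ultimately show ?thesis by linarith
qed

end

lemma move_trees_disjoint:
  assumes "move X a b" "move X c d" "{a, b} \<noteq> {c, d}"
  shows "move_trees X a b \<inter> move_trees X c d = {}"
proof (rule ccontr)
  interpret ab: move X a b by fact
  interpret cd: move X c d by fact
  assume "\<not> ?thesis"
  then obtain T where T: "T \<in> move_trees X a b" "T \<in> move_trees X c d" by blast
  have card: "card {a, b} = 2" "card {c, d} = 2" using ab.neq cd.neq by auto
  from T(1) have "T = link_tree X a b \<or> spine T = {a, b}"
    using ab.spine_stage_tree by (auto simp: move_trees_def)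
  moreover from T(2) have "T = link_tree X c d \<or> spine T = {c, d}"
    using cd.spine_stage_tree by (auto simp: move_trees_def)
  ultimately consider "{a, b} = {c, d}" | "card {a, b} = 3" | "card {c, d} = 3"
    using ab.card_spine_link_tree cd.card_spine_link_tree
      ab.spine_ends_link_tree cd.spine_ends_link_tree by metis
  then show False using assms(3) card by cases simp_all
qed

subsection \<open>The 1-rainbow cycle\<close>

definition hull_order :: "point set \<Rightarrow> point list \<Rightarrow> bool" where
  "hull_order X v \<longleftrightarrow>
     distinct v \<and> set v = X \<and> sorted_wrt (\<lambda>k l. orient (hd v) k l > 0) (tl v)"

text \<open>The point farthest from the origin is a vertex of the convex hull.\<close>

lemma ex_point_all_left:
  assumes "finite X" "X \<noteq> {}"
  shows "\<exists>a\<in>X. \<exists>b. \<forall>k\<in>X - {a}. orient a b k > 0"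
proof -
  define q where "q k = (k$1)\<^sup>2 + (k$2)\<^sup>2" for k :: point
  have "Max (q ` X) \<in> q ` X" using assms by (intro Max_in) auto
  then obtain a where a: "a \<in> X" "q a = Max (q ` X)" by auto
  have "orient a (vector [a$1 - a$2, a$2 + a$1]) k > 0" if k: "k \<in> X - {a}" for k
  proof -
    have "q k \<le> q a" using a k assms(1) by simp
    moreover have "(k$1 - a$1)\<^sup>2 + (k$2 - a$2)\<^sup>2 > 0"
      using k by (auto simp: sum_power2_gt_zero_iff vec_eq_iff forall_2)
    ultimately have "2 * orient a (vector [a$1 - a$2, a$2 + a$1]) k > 0"
      by (simp add: orient_def q_def power2_eq_square algebra_simps)
    then show ?thesis by simp
  qed
  then show ?thesis using a(1) by blast
qed

lemma (in points) ex_hull_order: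
  assumes "X \<noteq> {}"
  shows "\<exists>v. hull_order X v"
proof -
  obtain a b where a: "a \<in> X" and left: "\<And>k. k \<in> X - {a} \<Longrightarrow> orient a b k > 0"
    using ex_point_all_left[OF finite_X assms] by blast
  have "orient a k l \<noteq> 0" if "k \<in> X - {a}" "l \<in> X - {a}" "k \<noteq> l" for k l
    using orient_nonzero[of a k l] a that by auto
  then obtain xs where xs: "is_angular_order (X - {a}) a xs"
    using ex_angular_order[of "X - {a}" a b] left finite_X by blast
  then have "hull_order X (a # xs)"
    using a by (auto simp: hull_order_def is_angular_order_def)
  then show ?thesis by blast
qed

locale hull_points = points +
  fixes v :: "point list"
  assumes hull_order: "hull_order X v" and three_points: "card X \<ge> 3"

lemma (in points) ex_hull_points:
  assumes "card X \<ge> 3"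
  shows "\<exists>v. hull_points X v"
proof -
  have "X \<noteq> {}" using assms by auto
  then obtain v where "hull_order X v" using ex_hull_order by blast
  then have "hull_points X v" using assms by unfold_locales
  then show ?thesis by blast
qed

context hull_points
begin

abbreviation "n \<equiv> card X"

lemma v_enumerates: "distinct v" "set v = X" "length v = n"
  using hull_order distinct_card[of v] by (auto simp: hull_order_def)

lemma v_in [simp]: "i < n \<Longrightarrow> v ! i \<in> X"
  using v_enumerates by auto

lemma v_eq_iff [simp]: "i < n \<Longrightarrow> j < n \<Longrightarrow> v ! i = v ! j \<longleftrightarrow> i = j"
  using v_enumerates by (simp add: nth_eq_iff_index_eq)

lemma v_cases: assumes "x \<in> X" obtains i where "i < n" "x = v ! i"
  using assms v_enumerates by (metis in_set_conv_nth)

lemma orient_v_pos: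
  assumes "1 \<le> i" "i < j" "j < n"
  shows "orient (v ! 0) (v ! i) (v ! j) > 0"
proof -
  have "hd v = v ! 0" using assms v_enumerates(3) by (intro hd_conv_nth) auto
  then have sorted: "sorted_wrt (\<lambda>k l. orient (v ! 0) k l > 0) (tl v)"
    using hull_order by (simp add: hull_order_def)
  show ?thesis
    using sorted_wrt_nth_less[OF sorted, of "i - 1" "j - 1"] assms v_enumerates(3) by (simp add: nth_tl)
qed

lemma orient_v_neg: "1 \<le> i \<Longrightarrow> i < j \<Longrightarrow> j < n \<Longrightarrow> orient (v ! 0) (v ! j) (v ! i) < 0"
  using orient_v_pos[of i j] orient_swap[of "v ! 0" "v ! j" "v ! i"] by simp

lemma not_crossing_apart:
  assumes "i < j" "j \<le> k" "k < l" "l < n"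
  shows "\<not> crossing {v ! i, v ! j} {v ! k, v ! l}"
proof (cases "j = k")
  case True
  then show ?thesis
    using assms not_crossing_if_shared[of "v ! k" "v ! i" "v ! l"] by (simp add: insert_commute)
next
  case False
  have "orient (v ! 0) (v ! j) (v ! i) \<le> 0"
    using orient_v_neg[of i j] assms by (cases "i = 0") auto
  then have "\<not> crossing {v ! k, v ! l} {v ! i, v ! j}"
    using assms False orient_v_pos[of j k] orient_v_pos[of j l]
    by (intro not_crossing_if_separated[of "v ! j" "v ! 0"]) (auto simp: orient_flip[of "v ! j"])
  then show ?thesis by (simp add: crossing_commute)
qed

lemma not_crossing_nested_root:
  assumes "1 \<le> j" "j < k" "k \<le> l" "l < n"
  shows "\<not> crossing {v ! 0, v ! l} {v ! j, v ! k}"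
proof (cases "k = l")
  case True
  then show ?thesis
    using assms not_crossing_if_shared[of "v ! l" "v ! 0" "v ! j"] by (simp add: insert_commute)
next
  case False
  then have "\<not> crossing {v ! j, v ! k} {v ! 0, v ! l}"
    using assms orient_v_neg[of j l] orient_v_neg[of k l]
    by (intro not_crossing_if_separated[of "v ! 0" "v ! l"]) auto
  then show ?thesis by (simp add: crossing_commute)
qed

subsubsection \<open>Trees with an initial or final part of the path\<close>

definition prefix :: "nat \<Rightarrow> point set" where
  "prefix k = (!) v ` {..k}"

definition suffix :: "nat \<Rightarrow> point set" where
  "suffix k = (!) v ` {k..<n}"

definition hull_path :: "nat \<Rightarrow> nat \<Rightarrow> point set set" where
  "hull_path i j = (\<lambda>k. {v ! k, v ! Suc k}) ` {i..<j}"

lemma atLeastLessThan_eq_insert: "i < j \<Longrightarrow> {i..<j} = insert i {Suc i..<j}"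
  by auto

lemma hull_path_empty [simp]: "j \<le> i \<Longrightarrow> hull_path i j = {}"
  by (simp add: hull_path_def)

lemma hull_path_Suc: "i \<le> j \<Longrightarrow> hull_path i (Suc j) = insert {v ! j, v ! Suc j} (hull_path i j)"
  by (simp add: hull_path_def atLeastLessThanSuc)

lemma hull_path_Suc_left: "i < j \<Longrightarrow> hull_path i j = insert {v ! i, v ! Suc i} (hull_path (Suc i) j)"
  by (simp add: hull_path_def atLeastLessThan_eq_insert)

lemma prefix_Suc: "prefix (Suc k) = insert (v ! Suc k) (prefix k)"
  by (simp add: prefix_def atMost_Suc)

lemma prefix_last: "prefix (n - 1) = X"
  using three_points by (auto simp: prefix_def elim: v_cases)

lemma suffix_0: "suffix 0 = X"
  by (auto simp: suffix_def elim: v_cases)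

lemma suffix_Suc: "k < n \<Longrightarrow> suffix k = insert (v ! k) (suffix (Suc k))"
  by (simp add: suffix_def atLeastLessThan_eq_insert)

lemma suffix_subset: "suffix k \<subseteq> X"
  by (auto simp: suffix_def)

lemma v_in_suffix_iff: "i < n \<Longrightarrow> v ! i \<in> suffix k \<longleftrightarrow> k \<le> i"
  by (auto simp: suffix_def)

lemma v_in_prefix_iff: "i < n \<Longrightarrow> k < n \<Longrightarrow> v ! i \<in> prefix k \<longleftrightarrow> i \<le> k"
  by (auto simp: prefix_def)

lemma card_suffix: "card (suffix k) = n - k"
  unfolding suffix_def by (subst card_image) (auto simp: inj_on_def)

lemma edge_eq_iff:
  "i < j \<Longrightarrow> j < n \<Longrightarrow> k < l \<Longrightarrow> l < n \<Longrightarrow> {v ! i, v ! j} = {v ! k, v ! l} \<longleftrightarrow> i = k \<and> j = l"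
  by (auto simp: doubleton_eq_iff)

lemma edge_in_hull_path_iff:
  "i < j \<Longrightarrow> j < n \<Longrightarrow> b < n \<Longrightarrow> {v ! i, v ! j} \<in> hull_path a b \<longleftrightarrow> j = Suc i \<and> a \<le> i \<and> i < b"
  by (auto simp: hull_path_def edge_eq_iff)

lemma edge_casesE:
  assumes "e \<in> point_pairs X"
  obtains i j where "i < j" "j < n" "e = {v ! i, v ! j}"
proof -
  obtain x y where "e = {x, y}" "x \<noteq> y" "x \<in> X" "y \<in> X"
    using assms by (auto simp: point_pairs_def card_2_iff)
  moreover from this obtain i j where "i < n" "x = v ! i" "j < n" "y = v ! j" by (metis v_cases)
  ultimately show ?thesis using that[of i j] that[of j i]
    by (cases i j rule: linorder_cases) (auto simp: insert_commute)
qed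

lemma plane_tree_prepend_path:
  assumes "plane_tree (suffix j) T" "j < n"
  shows "plane_tree X (hull_path 0 j \<union> T)"
  using assms
proof (induction j arbitrary: T)
  case (Suc j)
  have pairs: "T \<subseteq> point_pairs (suffix (Suc j))"
    using Suc.prems by (simp add: plane_tree_def tree_on_subset_point_pairs)
  have "\<not> crossing {v ! Suc j, v ! j} e" if "e \<in> T" for e
  proof -
    have e: "e \<in> point_pairs (suffix (Suc j))" using that pairs by blast
    then have "e \<in> point_pairs X" using point_pairs_mono[OF suffix_subset] by blast
    then obtain k l where kl: "k < l" "l < n" "e = {v ! k, v ! l}" by (rule edge_casesE)
    then have "Suc j \<le> k" using e v_in_suffix_iff[of k "Suc j"] by (auto simp: point_pairs_def)
    then show ?thesis using not_crossing_apart[of j "Suc j" k l] kl by (simp add: insert_commute)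
  qed
  then have "cross_free (insert {v ! Suc j, v ! j} T) (insert {v ! Suc j, v ! j} T)"
    using Suc.prems crossing_commute by (auto simp: plane_tree_def cross_free_def)
  moreover have "tree_on (suffix j) (insert {v ! Suc j, v ! j} T)"
    unfolding suffix_Suc[of j, OF Suc_lessD[OF Suc.prems(2)]]
    using Suc.prems by (intro tree_on_insert) (auto simp: plane_tree_def v_in_suffix_iff)
  ultimately have "plane_tree X (hull_path 0 j \<union> insert {v ! Suc j, v ! j} T)"
    using Suc.prems(2) by (intro Suc.IH plane_treeI) auto
  then show ?case by (simp add: hull_path_Suc insert_commute)
qed (simp add: suffix_0)

lemma plane_tree_append_path:
  assumes "plane_tree (prefix k) T" "k \<le> m" "m < n"
  shows "plane_tree (prefix m) (T \<union> hull_path k m)"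
  using assms(2,3)
proof (induction m rule: dec_induct)
  case (step m)
  let ?T = "T \<union> hull_path k m"
  have tree: "plane_tree (prefix m) ?T" using step by simp
  have "\<not> crossing {v ! m, v ! Suc m} e" if "e \<in> ?T" for e
  proof -
    have e: "e \<in> point_pairs (prefix m)"
      using that tree tree_on_subset_point_pairs by (auto simp: plane_tree_def)
    moreover have "prefix m \<subseteq> X" using step.prems by (auto simp: prefix_def)
    ultimately have "e \<in> point_pairs X" using point_pairs_mono by blast
    then obtain i j where ij: "i < j" "j < n" "e = {v ! i, v ! j}" by (rule edge_casesE)
    then have "j \<le> m" using e v_in_prefix_iff[of j m] step.prems by (auto simp: point_pairs_def)
    then show ?thesis
      using not_crossing_apart[of i j m "Suc m"] ij step.prems by (simp add: crossing_commute)
  qed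
  then have "cross_free (insert {v ! m, v ! Suc m} ?T) (insert {v ! m, v ! Suc m} ?T)"
    using tree crossing_commute by (auto simp: plane_tree_def cross_free_def)
  moreover have "tree_on (prefix (Suc m)) (insert {v ! m, v ! Suc m} ?T)"
    unfolding prefix_Suc using tree step.prems
    by (intro tree_on_insert) (auto simp: plane_tree_def v_in_prefix_iff)
  ultimately have "plane_tree (prefix (Suc m)) (insert {v ! m, v ! Suc m} ?T)"
    by (rule plane_treeI[rotated])
  then show ?case using step.hyps by (simp add: hull_path_Suc)
qed (simp add: assms(1))

definition path_stage_tree :: "nat \<Rightarrow> nat \<Rightarrow> point set set" where
  "path_stage_tree j t = hull_path 0 j \<union> stage_tree (suffix j) (v ! j) (v ! Suc j) t"

definition broom :: "point \<Rightarrow> nat \<Rightarrow> point set set" where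
  "broom b k = star b (prefix k - {b}) \<union> hull_path k (n - 1)"

lemma suffix_point_pair: "Suc j < n \<Longrightarrow> point_pair (suffix j) (v ! j) (v ! Suc j)"
  using points_subset[OF suffix_subset[of j]]
  by (simp add: point_pair_def point_pair_axioms_def v_in_suffix_iff)

lemma plane_path_stage_tree: "Suc j < n \<Longrightarrow> plane_tree X (path_stage_tree j t)"
  unfolding path_stage_tree_def
  by (intro plane_tree_prepend_path point_pair.plane_stage_tree suffix_point_pair) auto

lemma plane_broom:
  assumes "b \<in> prefix k" "k < n"
  shows "plane_tree X (broom b k)"
proof -
  have "prefix k \<subseteq> X" using assms by (auto simp: prefix_def)
  then have "plane_tree (prefix k) (star b (prefix k - {b}))"
    using assms(1) by (intro points.plane_star points_subset)
  then have "plane_tree (prefix (n - 1)) (broom b k)"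
    unfolding broom_def using assms by (intro plane_tree_append_path) auto
  then show ?thesis by (simp only: prefix_last)
qed

lemma hull_path_disjoint_suffix: "j < n \<Longrightarrow> hull_path 0 j \<inter> point_pairs (suffix j) = {}"
  by (auto simp: hull_path_def point_pairs_def v_in_suffix_iff)

lemma stage_tree_subset_suffix:
  assumes "Suc j < n"
  shows "stage_tree (suffix j) (v ! j) (v ! Suc j) t \<subseteq> point_pairs (suffix j)"
  using point_pair.plane_stage_tree[OF suffix_point_pair[OF assms]]
  by (auto simp: plane_tree_def dest: tree_on_subset_point_pairs)

abbreviation "path_sweep j \<equiv> sweep (suffix j) (v ! j) (v ! Suc j)"

lemma nth_path_sweep:
  assumes "j < n - 2" "t < n - 2 - j"
  obtains i where "j + 2 \<le> i" "i < n" "path_sweep j ! t = v ! i"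
proof -
  have "path_sweep j ! t \<in> suffix j - {v ! j, v ! Suc j}"
    using assms point_pair.nth_sweep[OF suffix_point_pair, of j t] by (simp add: card_suffix)
  then obtain i where "j \<le> i" "i < n" "path_sweep j ! t = v ! i" "i \<noteq> j" "i \<noteq> Suc j"
    by (auto simp: suffix_def)
  then show ?thesis using that[of i] by simp
qed

lemma flip_path_stage_tree:
  assumes "j < n - 2" "t < n - 2 - j"
  shows "flip (path_stage_tree j t) {v ! Suc j, path_sweep j ! t} (path_stage_tree j (Suc t))"
  unfolding path_stage_tree_def
proof (rule flip_Un_disjoint)
  have j: "Suc j < n" using assms by simp
  then show flip: "flip (stage_tree (suffix j) (v ! j) (v ! Suc j) t) {v ! Suc j, path_sweep j ! t}
      (stage_tree (suffix j) (v ! j) (v ! Suc j) (Suc t))"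
    using assms by (intro point_pair.flip_stage_tree suffix_point_pair) (simp_all add: card_suffix)
  then have "{v ! Suc j, path_sweep j ! t} \<in> stage_tree (suffix j) (v ! j) (v ! Suc j) (Suc t)"
    by (auto simp: flip_def)
  then have "insert {v ! Suc j, path_sweep j ! t} (stage_tree (suffix j) (v ! j) (v ! Suc j) t)
      \<subseteq> point_pairs (suffix j)"
    using stage_tree_subset_suffix[OF j, of t] stage_tree_subset_suffix[OF j, of "Suc t"] by blast
  then show "hull_path 0 j \<inter> insert {v ! Suc j, path_sweep j ! t}
      (stage_tree (suffix j) (v ! j) (v ! Suc j) t) = {}"
    using hull_path_disjoint_suffix[OF Suc_lessD[OF j]] by blast
qed

lemma path_stage_tree_0: "path_stage_tree 0 0 = star (v ! 0) (X - {v ! 0})"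
  using point_pair.stage_tree_0[OF suffix_point_pair[of 0]] three_points
  by (simp add: path_stage_tree_def suffix_0)

lemma path_stage_tree_all:
  assumes "j < n - 2"
  shows "path_stage_tree j (n - 2 - j) = path_stage_tree (Suc j) 0"
proof -
  have "suffix j - {v ! j, v ! Suc j} = suffix (Suc j) - {v ! Suc j}"
    using assms suffix_Suc[of j] v_in_suffix_iff[of j "Suc j"] by auto
  then have "stage_tree (suffix j) (v ! j) (v ! Suc j) (n - 2 - j) =
      insert {v ! j, v ! Suc j} (stage_tree (suffix (Suc j)) (v ! Suc j) (v ! Suc (Suc j)) 0)"
    using assms point_pair.stage_tree_all[OF suffix_point_pair, of j]
      point_pair.stage_tree_0[OF suffix_point_pair, of "Suc j"]
    by (simp add: card_suffix diff_commute)
  then show ?thesis by (simp add: path_stage_tree_def hull_path_Suc)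
qed

lemma path_stage_tree_path: "path_stage_tree (n - 2) 0 = hull_path 0 (n - 1)"
proof -
  obtain m where m: "n = Suc (Suc m)" using three_points that[of "n - 2"] by simp
  have "suffix m = {v ! m, v ! Suc m}" by (auto simp: suffix_def m atLeastLessThanSuc)
  moreover have "v ! m \<noteq> v ! Suc m" using m by simp
  ultimately have "suffix m - {v ! m} = {v ! Suc m}" by auto
  then have "stage_tree (suffix m) (v ! m) (v ! Suc m) 0 = {{v ! m, v ! Suc m}}"
    using point_pair.stage_tree_0[OF suffix_point_pair, of m] m by simp
  then have "path_stage_tree m 0 = hull_path 0 (Suc m)"
    by (simp add: path_stage_tree_def hull_path_Suc)
  then show ?thesis by (simp add: m)
qed

lemma prefix_small: "prefix (Suc 0) = {v ! 0, v ! 1}" "prefix 2 = {v ! 0, v ! 1, v ! 2}"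
  by (auto simp: prefix_def numeral_2_eq_2 atMost_Suc)

lemma broom_1: "broom (v ! 0) 1 = hull_path 0 (n - 1)"
proof -
  have "prefix 1 - {v ! 0} = {v ! 1}" using three_points by (simp add: prefix_small insert_Diff_if)
  then show ?thesis using three_points by (simp add: broom_def hull_path_Suc_left[of 0])
qed

lemma broom_all: "broom (v ! 0) (n - 1) = star (v ! 0) (X - {v ! 0})"
  unfolding broom_def prefix_last by simp

text \<open>The stars at the three vertices of the triangle \<open>v\<^sub>0 v\<^sub>1 v\<^sub>2\<close> are visited in turn.\<close>

lemma flip_path_to_broom_2: "flip (broom (v ! 0) 1) {v ! 0, v ! 2} (broom (v ! 2) 2)"
  and flip_broom_2: "flip (broom (v ! 2) 2) {v ! 0, v ! 1} (broom (v ! 0) 2)"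
proof -
  have ne: "v ! 0 \<noteq> v ! 1" "v ! 0 \<noteq> v ! 2" "v ! 1 \<noteq> v ! 2" using three_points by simp_all
  have notin: "{v ! i, v ! j} \<notin> hull_path 2 (n - 1)" if "i < j" "j \<le> 2" for i j
    using that edge_in_hull_path_iff[of i j "n - 1" 2] three_points by auto
  have "prefix 1 - {v ! 0} = {v ! 1}" "prefix 2 - {v ! 0} = {v ! 1, v ! 2}"
    "prefix 2 - {v ! 2} = {v ! 0, v ! 1}"
    using ne by (simp_all add: prefix_small insert_Diff_if)
  moreover have "hull_path 1 (n - 1) = insert {v ! 1, v ! 2} (hull_path 2 (n - 1))"
    using hull_path_Suc_left[of 1 "n - 1"] three_points by (simp add: numeral_2_eq_2)
  ultimately have broom:
    "broom (v ! 0) 1 = insert {v ! 0, v ! 1} (insert {v ! 1, v ! 2} (hull_path 2 (n - 1)))"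
    "broom (v ! 2) 2 = insert {v ! 0, v ! 2} (insert {v ! 1, v ! 2} (hull_path 2 (n - 1)))"
    "broom (v ! 2) 2 = insert {v ! 1, v ! 2} (insert {v ! 0, v ! 2} (hull_path 2 (n - 1)))"
    "broom (v ! 0) 2 = insert {v ! 0, v ! 1} (insert {v ! 0, v ! 2} (hull_path 2 (n - 1)))"
    by (simp_all add: broom_def insert_commute)
  show "flip (broom (v ! 0) 1) {v ! 0, v ! 2} (broom (v ! 2) 2)"
    by (rule flipI[OF broom(1,2)]) (use ne notin in \<open>simp_all add: doubleton_eq_iff\<close>)
  show "flip (broom (v ! 2) 2) {v ! 0, v ! 1} (broom (v ! 0) 2)"
    by (rule flipI[OF broom(3,4)]) (use ne notin in \<open>simp_all add: doubleton_eq_iff\<close>)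
qed

lemma edge_in_broom_iff:
  assumes "i < j" "j < n" "k < n"
  shows "{v ! i, v ! j} \<in> broom (v ! 0) k \<longleftrightarrow> i = 0 \<and> j \<le> k \<or> j = Suc i \<and> k \<le> i"
  using assms v_in_prefix_iff[of i k] v_in_prefix_iff[of j k]
    edge_in_hull_path_iff[of i j "n - 1" k]
  by (auto simp: broom_def)

lemma flip_broom_Suc:
  assumes "1 \<le> k" "k < n - 1"
  shows "flip (broom (v ! 0) k) {v ! 0, v ! Suc k} (broom (v ! 0) (Suc k))"
proof (rule flipI)
  let ?R = "star (v ! 0) (prefix k - {v ! 0}) \<union> hull_path (Suc k) (n - 1)"
  show "broom (v ! 0) k = insert {v ! k, v ! Suc k} ?R"
    using assms by (simp add: broom_def hull_path_Suc_left)
  show "broom (v ! 0) (Suc k) = insert {v ! 0, v ! Suc k} ?R"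
    using assms by (simp add: broom_def prefix_Suc insert_Diff_if)
  show "{v ! k, v ! Suc k} \<notin> ?R" "{v ! 0, v ! Suc k} \<notin> ?R"
    using assms v_in_prefix_iff[of "Suc k" k] edge_in_hull_path_iff[of k "Suc k" "n - 1" "Suc k"]
      edge_in_hull_path_iff[of 0 "Suc k" "n - 1" "Suc k"] by simp_all
  show "{v ! k, v ! Suc k} \<noteq> {v ! 0, v ! Suc k}"
    using assms by (simp add: edge_eq_iff)
qed

definition path_stage_flips :: "nat \<Rightarrow> flips" where
  "path_stage_flips j =
      map (\<lambda>t. (path_stage_tree j t, {v ! Suc j, path_sweep j ! t})) [0..<n - 2 - j]"

definition hull_flips :: "nat \<Rightarrow> flips" where
  "hull_flips m = concat (map path_stage_flips [0..<n - 2]) @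
     [(broom (v ! 0) 1, {v ! 0, v ! 2}), (broom (v ! 2) 2, {v ! 0, v ! 1})] @
     map (\<lambda>k. (broom (v ! 0) k, {v ! 0, v ! Suc k})) [2..<m]"

lemma source_path_stage_flips: "j < n - 2 \<Longrightarrow> source (path_stage_flips j) T = path_stage_tree j 0"
  by (simp add: path_stage_flips_def upt_conv_Cons)

lemma flip_path_path_stage_flips:
  "j < n - 2 \<Longrightarrow> flip_path X (path_stage_flips j) (path_stage_tree (Suc j) 0)"
  unfolding path_stage_flips_def path_stage_tree_all[symmetric]
  by (intro flip_path_map_upt plane_path_stage_tree flip_path_stage_tree) auto

lemma source_hull_flips: "source (hull_flips m) T = star (v ! 0) (X - {v ! 0})"
  using three_points
  by (simp add: hull_flips_def upt_conv_Cons source_path_stage_flips path_stage_tree_0)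

lemma flip_path_hull_flips:
  assumes "2 \<le> m" "m \<le> n - 1"
  shows "flip_path X (hull_flips m) (broom (v ! 0) m)"
proof -
  have "flip_path X (concat (map path_stage_flips [0..<n - 2])) (path_stage_tree (n - 2) 0)"
  proof (rule flip_path_concat_map)
    show "source (path_stage_flips j) T = path_stage_tree j 0" if "j \<in> set [0..<n - 2]" for j T
      using that by (simp add: source_path_stage_flips)
    show "successively (\<lambda>i j. flip_path X (path_stage_flips i) (path_stage_tree j 0)) [0..<n - 2]"
      by (simp add: successively_conv_nth flip_path_path_stage_flips)
    show "flip_path X (path_stage_flips (last [0..<n - 2])) (path_stage_tree (n - 2) 0)"
    proof -
      have "Suc (n - 3) = n - 2" "last [0..<n - 2] = n - 3"
        using three_points by (auto simp: last_upt)
      then show ?thesis using flip_path_path_stage_flips[of "n - 3"] by simp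
    qed
  qed
  then have "flip_path X (concat (map path_stage_flips [0..<n - 2])) (broom (v ! 0) 1)"
    by (simp only: path_stage_tree_path broom_1)
  moreover have
    "flip_path X (map (\<lambda>k. (broom (v ! 0) k, {v ! 0, v ! Suc k})) [2..<m]) (broom (v ! 0) m)"
    using assms by (intro flip_path_map_upt plane_broom flip_broom_Suc) (auto simp: prefix_def)
  moreover have "plane_tree X (broom (v ! 0) 1)" "plane_tree X (broom (v ! 2) 2)"
    using three_points by (auto intro!: plane_broom simp: prefix_small)
  ultimately show ?thesis
    using assms flip_path_to_broom_2 flip_broom_2
      source_map_upt[OF assms(1), of "broom (v ! 0)" "\<lambda>k. {v ! 0, v ! Suc k}"]
    by (simp add: hull_flips_def flip_path_append)
qed

lemma hull_flips_cases:
  assumes "T \<in> set (map fst (hull_flips (n - 1)))"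
  obtains (star) "T = star (v ! 0) (X - {v ! 0})"
  | (first_stage) t where "1 \<le> t" "t < n - 2" "T = path_stage_tree 0 t"
  | (stage) j t where "1 \<le> j" "j < n - 2" "t < n - 2 - j" "T = path_stage_tree j t"
  | (broom) k where "1 \<le> k" "k < n - 1" "T = broom (v ! 0) k"
  | (turn) "T = broom (v ! 2) 2"
proof -
  from assms consider (path_stage) j t where "j < n - 2" "t < n - 2 - j" "T = path_stage_tree j t"
    | (path) "T = broom (v ! 0) 1" | (triangle) "T = broom (v ! 2) 2"
    | (later_broom) k where "2 \<le> k" "k < n - 1" "T = broom (v ! 0) k"
    by (auto simp: hull_flips_def path_stage_flips_def)
  then show thesis
  proof cases
    case (path_stage j t)
    then show ?thesis
      using star first_stage[of t] stage[of j t] path_stage_tree_0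
      by (cases "j = 0"; cases "t = 0") auto
  next
    case path
    then show ?thesis using broom[of 1] three_points by simp
  next
    case triangle
    then show ?thesis by (rule turn)
  next
    case (later_broom k)
    then show ?thesis using broom[of k] by simp
  qed
qed

lemma early_edge_in_path_stage_tree_iff:
  assumes "k < j" "k < l" "l < n" "Suc j < n"
  shows "{v ! k, v ! l} \<in> path_stage_tree j t \<longleftrightarrow> l = Suc k"
proof -
  have "{v ! k, v ! l} \<notin> stage_tree (suffix j) (v ! j) (v ! Suc j) t"
    using stage_tree_subset_suffix[OF assms(4), of t] v_in_suffix_iff[of k j] assms
    by (auto simp: point_pairs_def)
  then show ?thesis
    using edge_in_hull_path_iff[of k l j 0] assms by (simp add: path_stage_tree_def)
qed

lemma root_edge_in_path_stage_tree: "Suc j < n \<Longrightarrow> {v ! 0, v ! 1} \<in> path_stage_tree j t"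
  using early_edge_in_path_stage_tree_iff[of 0 j 1 t]
  by (cases "j = 0") (simp_all add: path_stage_tree_def stage_tree_def double_star_def)

lemma removed_edge_path_stage_tree_iff:
  assumes "j < n - 2" "t < n - 2 - j"
  shows "{v ! j, path_sweep j ! t} \<in> path_stage_tree j s \<longleftrightarrow> s \<le> t"
proof -
  obtain i where "j + 2 \<le> i" "i < n" "path_sweep j ! t = v ! i" by (rule nth_path_sweep[OF assms])
  then have "{v ! j, path_sweep j ! t} \<notin> hull_path 0 j"
    using edge_in_hull_path_iff[of j i j 0] by simp
  then show ?thesis
    using point_pair.removed_edge_stage_tree_iff[OF suffix_point_pair, of j t s] assms
    by (simp add: path_stage_tree_def card_suffix)
qed

lemma path_stage_tree_inj:
  assumes "path_stage_tree i s = path_stage_tree j t"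
    and "i < n - 2" "s < n - 2 - i" "j < n - 2 \<and> t < n - 2 - j \<or> j = n - 2 \<and> t = 0"
  shows "i = j \<and> s = t"
proof -
  have removed: "{v ! i, path_sweep i ! s} \<in> path_stage_tree i s"
    "{v ! i, path_sweep i ! s} \<notin> path_stage_tree j t"
    if pos: "i < n - 2" "s < n - 2 - i" "i < j \<or> i = j \<and> s < t" "j \<le> n - 2" for i s j t
  proof -
    show "{v ! i, path_sweep i ! s} \<in> path_stage_tree i s"
      using removed_edge_path_stage_tree_iff[of i s s] pos by simp
    obtain k where "i + 2 \<le> k" "k < n" "path_sweep i ! s = v ! k"
      by (rule nth_path_sweep[OF pos(1,2)])
    moreover have "Suc j < n" using pos(4) three_points by simp
    ultimately show "{v ! i, path_sweep i ! s} \<notin> path_stage_tree j t"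
      using removed_edge_path_stage_tree_iff[of i s t]
        early_edge_in_path_stage_tree_iff[of i j k t] pos
      by auto
  qed
  consider (earlier) "i < j \<or> i = j \<and> s < t" | (later) "j < i \<or> i = j \<and> t < s"
    | (same) "i = j \<and> s = t" by linarith
  then show ?thesis
  proof cases
    case earlier
    then show ?thesis using removed[of i s j t] assms by auto
  next
    case later
    then show ?thesis using removed[of j t i s] assms by auto
  qed auto
qed

lemma broom_inj:
  assumes "broom (v ! 0) k = broom (v ! 0) l" "1 \<le> k" "1 \<le> l" "k < n" "l < n"
  shows "k = l"
proof -
  have "{v ! k, v ! Suc k} \<in> broom (v ! 0) k" "{v ! k, v ! Suc k} \<notin> broom (v ! 0) l"
    if "1 \<le> k" "k < l" "l < n" for k l
    using that edge_in_broom_iff[of k "Suc k" k] edge_in_broom_iff[of k "Suc k" l] by auto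
  then show ?thesis using assms by (cases k l rule: linorder_cases) metis+
qed

lemma broom_neq_path_stage_tree:
  assumes "1 \<le> k" "k < n - 1" "j < n - 2" "t < n - 2 - j"
  shows "broom (v ! 0) k \<noteq> path_stage_tree j t"
proof -
  consider (path) "k = 1" | (first_stage) "2 \<le> k" "j = 0" | (later_stage) "2 \<le> k" "1 \<le> j"
    using assms by linarith
  then show ?thesis
  proof cases
    case path
    then show ?thesis
      using path_stage_tree_inj[of j t "n - 2" 0] assms path_stage_tree_path broom_1 by auto
  next
    case first_stage
    have "v ! Suc (n - 2) \<noteq> v ! 0" "v ! (n - 2) \<noteq> v ! 0" "v ! Suc (n - 2) \<noteq> v ! 1"
      "v ! (n - 2) \<noteq> v ! 1"
      using assms first_stage by (simp_all add: Suc_diff_le)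
    then have "{v ! (n - 2), v ! Suc (n - 2)} \<notin> path_stage_tree 0 t"
      by (simp add: path_stage_tree_def stage_tree_def double_star_def doubleton_eq_iff)
    moreover have "{v ! (n - 2), v ! Suc (n - 2)} \<in> broom (v ! 0) k"
      using edge_in_broom_iff[of "n - 2" "Suc (n - 2)" k] assms by simp
    ultimately show ?thesis using first_stage by auto
  next
    case later_stage
    then have "{v ! 0, v ! 2} \<notin> path_stage_tree j t"
      using early_edge_in_path_stage_tree_iff[of 0 j 2 t] assms by auto
    moreover have "{v ! 0, v ! 2} \<in> broom (v ! 0) k"
      using edge_in_broom_iff[of 0 2 k] later_stage assms by simp
    ultimately show ?thesis by auto
  qed
qed

lemma broom_turn_fresh:
  "{v ! 0, v ! 1} \<notin> broom (v ! 2) 2" "1 \<le> k \<Longrightarrow> k < n \<Longrightarrow> {v ! 0, v ! 1} \<in> broom (v ! 0) k"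
  using edge_in_hull_path_iff[of 0 1 "n - 1" 2] edge_in_broom_iff[of 0 1 k] three_points
  by (simp_all add: broom_def)

lemma distinct_path_stage_trees:
  "distinct (concat (map (\<lambda>j. map (path_stage_tree j) [0..<n - 2 - j]) [0..<n - 2]))"
proof (rule distinct_concat_map)
  fix j assume j: "j \<in> set [0..<n - 2]"
  have "inj_on (path_stage_tree j) {0..<n - 2 - j}"
  proof (rule inj_onI)
    fix s t assume "s \<in> {0..<n - 2 - j}" "t \<in> {0..<n - 2 - j}"
      "path_stage_tree j s = path_stage_tree j t"
    then show "s = t" using path_stage_tree_inj[of j s j t] j by simp
  qed
  then show "distinct (map (path_stage_tree j) [0..<n - 2 - j])" by (simp add: distinct_map)
next
  fix i j assume ij: "i \<in> set [0..<n - 2]" "j \<in> set [0..<n - 2]" "i \<noteq> j"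
  have "path_stage_tree i s \<noteq> path_stage_tree j t" if "s < n - 2 - i" "t < n - 2 - j" for s t
    using path_stage_tree_inj[of i s j t] that ij by auto
  then show "set (map (path_stage_tree i) [0..<n - 2 - i]) \<inter>
      set (map (path_stage_tree j) [0..<n - 2 - j]) = {}"
    by (auto simp only: set_map set_upt atLeastLessThan_iff disjoint_iff)
qed simp

lemma distinct_hull_flips:
  assumes "2 \<le> m" "m \<le> n - 1"
  shows "distinct (map fst (hull_flips m))"
proof -
  define stages
    where "stages = concat (map (\<lambda>j. map (path_stage_tree j) [0..<n - 2 - j]) [0..<n - 2])"
  define brooms where "brooms = map (broom (v ! 0)) [1..<m]"
  have stage: "\<exists>j t. j < n - 2 \<and> t < n - 2 - j \<and> T = path_stage_tree j t" if "T \<in> set stages" for T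
    using that unfolding stages_def by fastforce
  have broom: "\<exists>k. 1 \<le> k \<and> k < n - 1 \<and> T = broom (v ! 0) k" if "T \<in> set brooms" for T
    using that assms by (auto simp: brooms_def)
  have "inj_on (broom (v ! 0)) {1..<m}" using assms by (auto intro!: inj_onI broom_inj)
  then have "distinct brooms" by (simp add: brooms_def distinct_map)
  moreover have "distinct stages" unfolding stages_def by (rule distinct_path_stage_trees)
  moreover have "broom (v ! 2) 2 \<notin> set stages \<union> set brooms"
  proof -
    have "{v ! 0, v ! 1} \<in> T" if "T \<in> set stages" for T
      using stage[OF that] root_edge_in_path_stage_tree by auto
    moreover have "{v ! 0, v ! 1} \<in> T" if "T \<in> set brooms" for T
      using broom[OF that] broom_turn_fresh(2) by auto
    ultimately show ?thesis using broom_turn_fresh(1) by blast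
  qed
  moreover have "set stages \<inter> set brooms = {}"
  proof -
    have "T \<notin> set brooms" if "T \<in> set stages" for T
    proof
      assume "T \<in> set brooms"
      then obtain k where "1 \<le> k" "k < n - 1" "T = broom (v ! 0) k" using broom by blast
      moreover obtain j t where "j < n - 2" "t < n - 2 - j" "T = path_stage_tree j t"
        using stage[OF \<open>T \<in> set stages\<close>] by blast
      ultimately show False using broom_neq_path_stage_tree[of k j t] by simp
    qed
    then show ?thesis by blast
  qed
  moreover have "brooms = broom (v ! 0) 1 # map (broom (v ! 0)) [2..<m]"
    using assms by (simp add: brooms_def upt_conv_Cons numeral_2_eq_2)
  moreover have "map fst (hull_flips m) =
      stages @ [broom (v ! 0) 1, broom (v ! 2) 2] @ map (broom (v ! 0)) [2..<m]"
    by (simp add: hull_flips_def path_stage_flips_def stages_def map_concat comp_def)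
  ultimately show ?thesis by auto
qed

lemma count_labels_path_stage_flips:
  assumes "j < n - 2" "p < q" "q < n"
  shows "count_list (map snd (path_stage_flips j)) {v ! p, v ! q} = of_bool (p = Suc j)"
proof -
  have "map snd (path_stage_flips j) =
      map snd (stage_flips (suffix j) (v ! j) (v ! Suc j) 0 (card (suffix j) - 2))"
    by (simp add: path_stage_flips_def stage_flips_def card_suffix diff_commute)
  moreover have "{v ! p, v ! q} \<in> star (v ! Suc j) (suffix j - {v ! j, v ! Suc j}) \<longleftrightarrow> p = Suc j"
    using assms v_in_suffix_iff[of p j] v_in_suffix_iff[of q j] by auto
  ultimately show ?thesis
    using assms point_pair.count_labels_stage_flips[OF suffix_point_pair, of j] by simp
qed

lemma count_labels_hull_flips:
  assumes "f \<in> point_pairs X"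
  shows "count_list (map snd (hull_flips (n - 1))) f = 1"
proof -
  obtain p q where pq: "p < q" "q < n" "f = {v ! p, v ! q}" using assms by (rule edge_casesE)
  have "count_list (map snd (concat (map path_stage_flips [0..<n - 2]))) f =
      (\<Sum>j\<leftarrow>[0..<n - 2]. of_bool (p = Suc j))"
    unfolding count_list_concat_map using pq
    by (intro arg_cong[where f = sum_list] map_cong) (auto simp: count_labels_path_stage_flips)
  also have "\<dots> = (\<Sum>j<n - 2. of_bool (p = Suc j))"
    by (simp add: sum_list_sum_nth atLeast0LessThan)
  also have "\<dots> = of_bool (p \<noteq> 0)"
    using pq by (cases p) (auto simp: of_bool_def sum.delta)
  finally have stages:
    "count_list (map snd (concat (map path_stage_flips [0..<n - 2]))) f = of_bool (p \<noteq> 0)" .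
  let ?spokes = "[2, 1] @ map Suc [2..<n - 1]"
  have "{2, 1} \<union> Suc ` {2..<n - 1} = {1..<n}"
    using three_points by (auto simp: image_iff Suc_le_eq)
  then have spokes: "distinct ?spokes" "set ?spokes = {1..<n}" by (auto simp: distinct_map)
  have "inj_on (\<lambda>i. {v ! 0, v ! i}) {1..<n}" by (rule inj_onI) (auto simp: doubleton_eq_iff)
  then have "distinct (map (\<lambda>i. {v ! 0, v ! i}) ?spokes)"
    using spokes by (metis distinct_map)
  moreover have "f \<in> set (map (\<lambda>i. {v ! 0, v ! i}) ?spokes) \<longleftrightarrow> p = 0"
    unfolding set_map spokes(2) using pq by (auto simp: edge_eq_iff)
  ultimately have "count_list (map (\<lambda>i. {v ! 0, v ! i}) ?spokes) f = of_bool (p = 0)"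
    by (simp only: count_list_distinct)
  moreover have "map snd (hull_flips (n - 1)) =
      map snd (concat (map path_stage_flips [0..<n - 2])) @ map (\<lambda>i. {v ! 0, v ! i}) ?spokes"
    by (simp add: hull_flips_def comp_def)
  ultimately show ?thesis using stages by auto
qed

lemma ex_rainbow_cycle_1: "\<exists>p. rainbow_cycle X 1 p"
proof (rule rainbow_cycleI)
  show "hull_flips (n - 1) \<noteq> []" by (simp add: hull_flips_def)
  show "flip_path X (hull_flips (n - 1)) (star (v ! 0) (X - {v ! 0}))"
    unfolding broom_all[symmetric] using three_points by (intro flip_path_hull_flips) auto
  show "distinct (map fst (hull_flips (n - 1)))"
    using three_points by (intro distinct_hull_flips) auto
qed (rule source_hull_flips count_labels_hull_flips; assumption?)+

end

subsection \<open>Passages through a star\<close>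

definition through_star :: "point set \<Rightarrow> point \<Rightarrow> point \<Rightarrow> point \<Rightarrow> bool" where
  "through_star X a b c \<longleftrightarrow> supporting X b a \<or> supporting X b c"

definition exit_label :: "point set \<Rightarrow> point \<Rightarrow> point \<Rightarrow> point \<Rightarrow> point set" where
  "exit_label X a b c =
     (if through_star X a b c then {b, last (sweep X a b)} else {c, hd (sweep X b c)})"

definition passage_label :: "point set \<Rightarrow> point \<Rightarrow> point \<Rightarrow> point \<Rightarrow> point set" where
  "passage_label X a b c =
     (if through_star X a b c then {c, hd (sweep X b c)} else {b, last (sweep X a b)})"

definition passage_tree :: "point set \<Rightarrow> point \<Rightarrow> point \<Rightarrow> point \<Rightarrow> point set set" where
  "passage_tree X a b c =
     (if through_star X a b c then star b (X - {b})
      else detour_star X b a (last (sweep X a b)) c (hd (sweep X b c)))"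

locale turn = ab: move X a b + bc: move X b c for X a b c +
  assumes no_return: "a \<noteq> c"
begin

abbreviation "y \<equiv> last (sweep X a b)"
abbreviation "z \<equiv> hd (sweep X b c)"

lemma last_point: "y \<in> X" "y \<noteq> a" "y \<noteq> b"
  and first_point: "z \<in> X" "z \<noteq> b" "z \<noteq> c"
  using ab.nth_sweep[of "card X - 3"] bc.nth_sweep[of 0] ab.six_points
  by (simp_all add: ab.hd_last_sweep bc.hd_last_sweep)

lemma stage_trees_at_star:
  "stage_tree X a b (card X - 3) = near_star X b a y" "stage_tree X b c 1 = near_star X b c z"
  using ab.stage_tree_last bc.stage_tree_first ab.six_points by simp_all

lemma plane_near_stars: "plane_tree X (near_star X b a y)" "plane_tree X (near_star X b c z)"
  using ab.plane_stage_tree[of "card X - 3"] bc.plane_stage_tree[of 1]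
  by (simp_all only: stage_trees_at_star)

lemma ccw_next_detour:
  assumes "\<not> through_star X a b c"
  shows "ccw_next X b a y" "ccw_next X b c z"
  using assms ab.ccw_next_last_sweep bc.ccw_next_hd_sweep by (auto simp: through_star_def)

lemma detour:
  assumes "\<not> through_star X a b c"
  shows "detour X b a y c z"
proof
  note ccw = ccw_next_detour[OF assms]
  show "y \<noteq> z" using ab.ccw_next_distinct[OF ccw] ab.in_X bc.in_X ab.neq bc.neq no_return by simp
  show "\<not> (y = c \<and> z = a)"
    using ccw orient_swap[of b a c] by (auto simp: ccw_next_def left_of_def)
qed (use ab.in_X bc.in_X ab.neq bc.neq no_return last_point first_point in auto)

lemma plane_detour:
  assumes "\<not> through_star X a b c"
  shows "plane_tree X (detour_star X b a y c z)"
proof (rule ab.plane_detour_star[OF detour[OF assms] plane_near_stars])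
  show "\<not> crossing {a, y} {c, z}"
    using ab.not_crossing_ccw_next[OF ccw_next_detour[OF assms]] ab.in_X bc.in_X ab.neq bc.neq
      no_return
    by simp
qed

lemma flip_path_passage:
  "flip_path X [(stage_tree X a b (card X - 3), exit_label X a b c),
     (passage_tree X a b c, passage_label X a b c)] (stage_tree X b c 1)"
proof (cases "through_star X a b c")
  case True
  have "flip (near_star X b a y) {b, y} (star b (X - {b}))"
    "flip (star b (X - {b})) {c, z} (near_star X b c z)"
    using ab.in_X bc.in_X ab.neq bc.neq last_point first_point
    by (auto intro!: flip_near_star_star flip_star_near_star)
  then show ?thesis
    unfolding stage_trees_at_star exit_label_def passage_label_def passage_tree_def
    using True plane_near_stars(1) ab.plane_star[OF bc.in_X(1)] by simp
next
  case False
  then show ?thesis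
    unfolding stage_trees_at_star exit_label_def passage_label_def passage_tree_def
    using plane_near_stars(1) plane_detour[OF False] detour.flip_near_star_detour_star[OF detour]
      detour.flip_detour_star_near_star[OF detour] by simp
qed

lemma count_passage_labels:
  "count_list [exit_label X a b c, passage_label X a b c] f =
     of_bool (f = {b, y}) + of_bool (f = {c, z})"
  by (auto simp: exit_label_def passage_label_def)

lemma spine_passage_tree:
  "spine (passage_tree X a b c) = (if through_star X a b c then {b} else {a, b, c})"
  using spine_star[of "X - {b}" b] detour.spine_detour_star[OF detour] ab.finite_X ab.six_points
    bc.in_X
  by (simp add: passage_tree_def)

lemma heavy_passage_tree: "\<not> through_star X a b c \<Longrightarrow> heavy (passage_tree X a b c) = {b}"
  using detour.heavy_detour_star[OF detour] ab.finite_X ab.six_points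
  by (simp add: passage_tree_def)

lemma card_spine_passage_tree:
  "card (spine (passage_tree X a b c)) = (if through_star X a b c then 1 else 3)"
  using ab.neq bc.neq no_return by (simp add: spine_passage_tree)

lemma passage_tree_neq_link_tree:
  assumes "move X d e" "(d, e) \<noteq> (b, a)" "(d, e) \<noteq> (c, b)"
  shows "passage_tree X a b c \<noteq> link_tree X d e"
proof
  interpret de: move X d e by fact
  let ?k = "link_vertex X d e"
  assume eq: "passage_tree X a b c = link_tree X d e"
  then have detour: "\<not> through_star X a b c"
    using card_spine_passage_tree de.card_spine_link_tree by (auto split: if_splits)
  note ccw = ccw_next_detour[OF detour]
  have spine: "{d, e, ?k} = {a, b, c}"
    using spine_passage_tree detour eq de.spine_link_tree by simp
  have heavy: "heavy (link_tree X d e) = {b}" using heavy_passage_tree[OF detour] eq by simp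
  have "d \<in> {a, b, c}" "e \<in> {a, b, c}" "?k \<in> {a, b, c}" using spine by blast+
  note spine = this de.neq de.link_vertex(2,3)
  have no_edge: "{d, e} \<notin> passage_tree X a b c"
    unfolding eq link_tree_def linked_stars_def using de.link_vertex de.link_partition(1) de.neq
    by auto
  show False
  proof (cases "?k \<in> left_of X d e")
    case True
    then have d: "d = b" using de.link_tree_left_heavy heavy by auto
    then have e: "e = c" "?k = a" using spine assms(2) by auto
    then have "{b, c} \<notin> star b (X - {b, y, z})"
      using no_edge d detour by (simp add: passage_tree_def detour_star_def)
    then have "y = c" using first_point bc.neq bc.in_X by simp
    moreover have "a \<in> left_of X b c" using True e d by simp
    ultimately show False
      using ccw(1) orient_swap[of b a c] by (simp add: ccw_next_def left_of_def)
  next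
    case False
    then have e: "e = b" using de.link_tree_right_heavy heavy by auto
    then have d: "d = a" "?k = c" using spine assms(3) by auto
    then have "{b, a} \<notin> star b (X - {b, y, z})"
      using no_edge e detour by (simp add: passage_tree_def detour_star_def insert_commute)
    then have "z = a" using last_point ab.neq ab.in_X by simp
    moreover have "c \<notin> left_of X a b" using False e d by simp
    ultimately show False
      using ccw(2) orient_rotate[of b c a] bc.in_X by (simp add: ccw_next_def left_of_def)
  qed
qed

lemma passage_tree_not_move_tree:
  assumes "move X d e" "(d, e) \<noteq> (b, a)" "(d, e) \<noteq> (c, b)"
  shows "passage_tree X a b c \<notin> move_trees X d e"
proof -
  interpret de: move X d e by fact
  have "passage_tree X a b c \<noteq> stage_tree X d e t" if "1 \<le> t" "t \<le> card X - 3" for t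
  proof
    assume "passage_tree X a b c = stage_tree X d e t"
    then have "card (spine (passage_tree X a b c)) = 2"
      using de.spine_stage_tree[OF that] de.neq by simp
    then show False using card_spine_passage_tree by (simp split: if_splits)
  qed
  then have "passage_tree X a b c \<notin> stage_tree X d e ` {1..card X - 3}"
    by (meson atLeastAtMost_iff imageE)
  then show ?thesis using passage_tree_neq_link_tree[OF assms] by (simp add: move_trees_def)
qed

end

lemma passage_tree_neq:
  assumes "turn X a b c" "turn X a' b' c'" "b = b' \<Longrightarrow> {a, c} \<inter> {a', c'} = {}"
  shows "passage_tree X a b c \<noteq> passage_tree X a' b' c'"
proof
  interpret abc: turn X a b c by fact
  interpret abc': turn X a' b' c' by fact
  assume eq: "passage_tree X a b c = passage_tree X a' b' c'"
  then have "card (spine (passage_tree X a b c)) = card (spine (passage_tree X a' b' c'))" by simp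
  then have through: "through_star X a b c \<longleftrightarrow> through_star X a' b' c'"
    by (simp add: abc.card_spine_passage_tree abc'.card_spine_passage_tree split: if_splits)
  show False
  proof (cases "through_star X a b c")
    case True
    then have "b = b'" using eq through abc.spine_passage_tree abc'.spine_passage_tree by simp
    moreover obtain p where p: "p \<in> {a, c}" "supporting X b p" using True
      by (auto simp: through_star_def)
    moreover obtain q where q: "q \<in> {a', c'}" "supporting X b' q"
      using True through by (auto simp: through_star_def)
    moreover have "p \<in> X" "p \<noteq> b" using p(1) abc.ab.in_X abc.bc.in_X abc.ab.neq abc.bc.neq by auto
    moreover have "q \<in> X" "q \<noteq> b'"
      using q(1) abc'.ab.in_X abc'.bc.in_X abc'.ab.neq abc'.bc.neq by auto
    ultimately have "p = q" using abc.ab.supporting_unique[of b p q] abc.bc.in_X(1) by simp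
    then show False using assms(3) \<open>b = b'\<close> p(1) q(1) by blast
  next
    case False
    then have b: "b = b'" using eq through abc.heavy_passage_tree abc'.heavy_passage_tree by simp
    moreover have "{a, b, c} = {a', b', c'}"
      using False eq through abc.spine_passage_tree abc'.spine_passage_tree by simp
    ultimately have "a \<in> {a', c'}" using abc.ab.neq by auto
    then show False using assms(3)[OF b] by blast
  qed
qed

subsection \<open>Tours of stars\<close>

lemma successively_if_map_eq_rotate1:
  assumes "map g xs = rotate1 (map f xs)"
  shows "successively (\<lambda>x y. g x = f y) xs" "xs \<noteq> [] \<Longrightarrow> g (last xs) = f (hd xs)"
proof -
  have step: "g (xs ! i) = f (xs ! (Suc i mod length xs))" if "i < length xs" for i
  proof -
    have "Suc i mod length xs < length xs" using that by (intro mod_less_divisor) auto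
    then show ?thesis
      using arg_cong[OF assms, of "\<lambda>ys. ys ! i"] that by (simp add: nth_rotate1)
  qed
  show "successively (\<lambda>x y. g x = f y) xs"
    unfolding successively_conv_nth using step by (metis Suc_lessD mod_less)
  show "g (last xs) = f (hd xs)" if "xs \<noteq> []"
    using step[of "length xs - 1"] that by (simp add: last_conv_nth hd_conv_nth)
qed

locale tour = points +
  fixes es :: "(point \<times> point) list" and linked :: bool
  assumes six_points: "card X \<ge> 6" and nonempty: "es \<noteq> []" and distinct_es: "distinct es"
    and arcs_in_X: "\<And>a b. (a, b) \<in> set es \<Longrightarrow> a \<in> X \<and> b \<in> X \<and> a \<noteq> b"
    and asym: "\<And>a b. (a, b) \<in> set es \<Longrightarrow> (b, a) \<notin> set es"
    and closed: "map snd es = rotate1 (map fst es)"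
begin

definition turns :: "(point \<times> point \<times> point) list" where
  "turns = map (\<lambda>(e, e'). (fst e, snd e, snd e')) (zip es (rotate1 es))"

definition arc_in :: "point \<times> point \<times> point \<Rightarrow> point \<times> point" where
  "arc_in = (\<lambda>(a, b, c). (a, b))"

definition arc_out :: "point \<times> point \<times> point \<Rightarrow> point \<times> point" where
  "arc_out = (\<lambda>(a, b, c). (b, c))"

lemma map_arc_in_turns: "map arc_in turns = es"
proof -
  have "map arc_in turns = map fst (zip es (rotate1 es))"
    unfolding turns_def map_map by (intro map_cong) (auto simp: arc_in_def)
  then show ?thesis by simp
qed

lemma map_arc_out_turns: "map arc_out turns = rotate1 es"
proof -
  have "map snd es = map fst (rotate1 es)" using closed by (simp add: rotate1_map)
  then have meet: "snd e = fst e'" if "(e, e') \<in> set (zip es (rotate1 es))" for e e'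
    using that by (auto simp: in_set_zip list_eq_iff_nth_eq)
  have "map arc_out turns = map snd (zip es (rotate1 es))"
    unfolding turns_def map_map
    by (intro map_cong) (auto simp: arc_out_def dest!: meet)
  then show ?thesis by simp
qed

lemma turn_arcs:
  assumes "(a, b, c) \<in> set turns"
  shows "(a, b) \<in> set es" "(b, c) \<in> set es"
proof -
  have "arc_in (a, b, c) \<in> set (map arc_in turns)" "arc_out (a, b, c) \<in> set (map arc_out turns)"
    using assms by (force simp only: set_map)+
  then show "(a, b) \<in> set es" "(b, c) \<in> set es"
    unfolding map_arc_in_turns map_arc_out_turns by (simp_all add: arc_in_def arc_out_def)
qed

lemma inj_on_arcs: "inj_on arc_in (set turns)" "inj_on arc_out (set turns)"
  and distinct_turns: "distinct turns"
  using map_arc_in_turns map_arc_out_turns distinct_es by (metis distinct_map distinct1_rotate)+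

lemma turns_disjoint:
  assumes "(a, b, c) \<in> set turns" "(a', b, c') \<in> set turns" "(a, b, c) \<noteq> (a', b, c')"
  shows "{a, c} \<inter> {a', c'} = {}"
proof -
  have "a \<noteq> a'" using inj_onD[OF inj_on_arcs(1) _ assms(1,2)] assms(3) by (auto simp: arc_in_def)
  moreover have "c \<noteq> c'"
    using inj_onD[OF inj_on_arcs(2) _ assms(1,2)] assms(3) by (auto simp: arc_out_def)
  moreover have "a \<noteq> c'" using asym turn_arcs(1)[OF assms(1)] turn_arcs(2)[OF assms(2)] by blast
  moreover have "c \<noteq> a'" using asym turn_arcs(2)[OF assms(1)] turn_arcs(1)[OF assms(2)] by blast
  ultimately show ?thesis by blast
qed

lemma move: "(a, b) \<in> set es \<Longrightarrow> move X a b"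
  using arcs_in_X[of a b] six_points by unfold_locales auto

lemma turn: "(a, b, c) \<in> set turns \<Longrightarrow> turn X a b c"
  using turn_arcs[of a b c] asym move unfolding turn_def turn_axioms_def by metis

lemma
  fixes g :: "point \<times> point \<Rightarrow> nat"
  shows sum_list_arc_in: "(\<Sum>t\<leftarrow>turns. g (arc_in t)) = sum g (set es)"
    and sum_list_arc_out: "(\<Sum>t\<leftarrow>turns. g (arc_out t)) = sum g (set es)"
proof -
  have "sum_list (map g (map arc_in turns)) = sum g (set es)"
    "sum_list (map g (map arc_out turns)) = sum g (set es)"
    using distinct_es by (simp_all only: map_arc_in_turns map_arc_out_turns distinct1_rotate
        sum_list_distinct_conv_sum_set set_rotate1)
  then show "(\<Sum>t\<leftarrow>turns. g (arc_in t)) = sum g (set es)"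
    "(\<Sum>t\<leftarrow>turns. g (arc_out t)) = sum g (set es)" by (simp_all add: comp_def)
qed

lemma turns_nonempty: "turns \<noteq> []"
  using map_arc_in_turns nonempty by auto

lemma move_trees_disjoint_arcs:
  assumes "(a, b) \<in> set es" "(c, d) \<in> set es" "(a, b) \<noteq> (c, d)"
  shows "move_trees X a b \<inter> move_trees X c d = {}"
proof (rule move_trees_disjoint)
  show "{a, b} \<noteq> {c, d}" using assms asym by (auto simp: doubleton_eq_iff)
qed (use assms move in auto)

end

locale connected_tour = tour +
  fixes leave :: "point \<Rightarrow> point \<Rightarrow> point \<Rightarrow> point set"
    and via :: "point \<Rightarrow> point \<Rightarrow> point \<Rightarrow> flips"
    and surplus :: "point \<Rightarrow> point \<Rightarrow> point \<Rightarrow> nat"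
  assumes flip_path_via: "\<And>a b c. (a, b, c) \<in> set turns \<Longrightarrow>
      flip_path X ((stage_tree X a b (card X - 3), leave a b c) # via a b c) (stage_tree X b c 1)"
    and distinct_via: "\<And>a b c. (a, b, c) \<in> set turns \<Longrightarrow> distinct (map fst (via a b c))"
    and via_not_move: "\<And>a b c d e. (a, b, c) \<in> set turns \<Longrightarrow> (d, e) \<in> set es \<Longrightarrow>
      set (map fst (via a b c)) \<inter> move_trees X d e = {}"
    and via_disjoint: "\<And>a b c a' b' c'. (a, b, c) \<in> set turns \<Longrightarrow> (a', b', c') \<in> set turns \<Longrightarrow>
      (a, b, c) \<noteq> (a', b', c') \<Longrightarrow> set (map fst (via a b c)) \<inter> set (map fst (via a' b' c')) = {}"
    and count_via: "\<And>a b c f. (a, b, c) \<in> set turns \<Longrightarrow> f \<in> point_pairs X \<Longrightarrow>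
      count_list (leave a b c # map snd (via a b c)) f =
        of_bool (f = {b, last (sweep X a b)}) + of_bool (f = {c, hd (sweep X b c)}) + surplus a b c"
begin

definition block :: "point \<times> point \<times> point \<Rightarrow> flips" where
  "block = (\<lambda>(a, b, c). move_flips linked X a b @
     (stage_tree X a b (card X - 3), leave a b c) # via a b c)"

definition start :: "point \<times> point \<Rightarrow> point set set" where
  "start = (\<lambda>(a, b). stage_tree X a b 1)"

lemma source_block:
  assumes "t \<in> set turns"
  shows "source (block t) T = start (arc_in t)"
proof -
  obtain a b c where t: "t = (a, b, c)" by (cases t)
  then have "move X a b" using assms turn_arcs(1) move by blast
  then show ?thesis by (simp add: t block_def start_def arc_in_def move.source_move_flips)
qed

lemma flip_path_block:
  assumes "t \<in> set turns"
  shows "flip_path X (block t) (start (arc_out t))"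
proof -
  obtain a b c where t: "t = (a, b, c)" by (cases t)
  then have "move X a b" using assms turn_arcs(1) move by blast
  then show ?thesis
    using flip_path_via assms
    by (simp add: t block_def start_def arc_out_def flip_path_append move.flip_path_move_flips)
qed

lemma flip_path_blocks: "flip_path X (concat (map block turns)) (start (arc_in (hd turns)))"
proof (rule flip_path_concat_map)
  have closed_turns: "map arc_out turns = rotate1 (map arc_in turns)"
    by (simp only: map_arc_in_turns map_arc_out_turns)
  note linked_up = successively_if_map_eq_rotate1[OF closed_turns]
  show "successively (\<lambda>t u. flip_path X (block t) (start (arc_in u))) turns"
    using linked_up(1) by (rule successively_mono) (metis flip_path_block)
  show "flip_path X (block (last turns)) (start (arc_in (hd turns)))"
    using linked_up(2) flip_path_block[of "last turns"] turns_nonempty by simp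
qed (rule source_block)

lemma block_trees:
  "map fst (block (a, b, c)) =
    (map fst (move_flips linked X a b) @ [stage_tree X a b (card X - 3)]) @ map fst (via a b c)"
  by (simp add: block_def)

lemma set_block_trees:
  assumes "(a, b, c) \<in> set turns"
  shows "set (map fst (move_flips linked X a b) @ [stage_tree X a b (card X - 3)]) \<subseteq>
      move_trees X a b"
proof -
  have "move X a b" using assms turn_arcs(1) move by blast
  moreover have "1 \<le> card X - 3" using six_points by simp
  ultimately show ?thesis using move.set_move_flips[of X a b linked] by (auto simp: move_trees_def)
qed

lemma distinct_block:
  assumes "t \<in> set turns"
  shows "distinct (map fst (block t))"
proof -
  obtain a b c where t: "t = (a, b, c)" by (cases t)
  then have ab: "(a, b) \<in> set es" using assms turn_arcs(1) by blast
  have "set (map fst (move_flips linked X a b) @ [stage_tree X a b (card X - 3)]) \<inter>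
      set (map fst (via a b c)) = {}"
    using set_block_trees[of a b c] via_not_move[of a b c a b] ab assms t by blast
  then show ?thesis
    unfolding t block_trees
    using move.distinct_move_flips[OF move[OF ab]] distinct_via[of a b c] assms
    by (subst distinct_append) (simp only: t simp_thms)
qed

lemma blocks_disjoint:
  assumes "t \<in> set turns" "u \<in> set turns" "t \<noteq> u"
  shows "set (map fst (block t)) \<inter> set (map fst (block u)) = {}"
proof -
  obtain a b c where t: "t = (a, b, c)" by (cases t)
  obtain a' b' c' where u: "u = (a', b', c')" by (cases u)
  have arcs: "(a, b) \<in> set es" "(a', b') \<in> set es" using assms t u turn_arcs(1) by blast+
  have "(a, b) \<noteq> (a', b')"
    using inj_onD[OF inj_on_arcs(1) _ assms(1,2)] assms(3) by (auto simp: t u arc_in_def)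
  then have "move_trees X a b \<inter> move_trees X a' b' = {}"
    using move_trees_disjoint_arcs arcs by blast
  then show ?thesis
    using set_block_trees[of a b c] set_block_trees[of a' b' c'] via_not_move[of a b c a' b']
      via_not_move[of a' b' c' a b] via_disjoint[of a b c a' b' c'] assms arcs
    unfolding t u block_trees set_append by blast
qed

lemma count_labels_block:
  assumes "(a, b, c) \<in> set turns" "f \<in> point_pairs X"
  shows "count_list (map snd (block (a, b, c))) f + of_bool (f = {b, hd (sweep X a b)}) =
    of_bool (b \<in> f \<and> (linked \<or> f \<noteq> {a, b})) + of_bool (f = {c, hd (sweep X b c)}) + surplus a b c"
proof -
  have "move X a b" using assms turn_arcs(1) move by blast
  then show ?thesis
    using move.count_labels_move_flips[of X a b f linked] count_via[OF assms] assms(2)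
    by (simp add: block_def)
qed

lemma count_labels_blocks:
  assumes f: "f \<in> point_pairs X"
  shows "count_list (map snd (concat (map block turns))) f =
    card {(a, b) \<in> set es. b \<in> f \<and> (linked \<or> f \<noteq> {a, b})} + (\<Sum>(a, b, c)\<leftarrow>turns. surplus a b c)"
proof -
  define first :: "point \<times> point \<Rightarrow> nat"
    where "first e = of_bool (f = {snd e, hd (sweep X (fst e) (snd e))})" for e
  define weight :: "point \<times> point \<Rightarrow> nat"
    where "weight e = of_bool (snd e \<in> f \<and> (linked \<or> f \<noteq> {fst e, snd e}))" for e
  have "(\<Sum>t\<leftarrow>turns. count_list (map snd (block t)) f + first (arc_in t)) =
      (\<Sum>t\<leftarrow>turns. weight (arc_in t) + first (arc_out t) + (case t of (a, b, c) \<Rightarrow> surplus a b c))"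
  proof (intro arg_cong[where f = sum_list] map_cong refl)
    fix t assume turn: "t \<in> set turns"
    obtain a b c where t: "t = (a, b, c)" by (cases t)
    show "count_list (map snd (block t)) f + first (arc_in t) =
        weight (arc_in t) + first (arc_out t) + (case t of (a, b, c) \<Rightarrow> surplus a b c)"
      unfolding t first_def weight_def arc_in_def arc_out_def prod.case fst_conv snd_conv
      by (rule count_labels_block[OF turn[unfolded t] f])
  qed
  moreover have "sum weight (set es) = card {(a, b) \<in> set es. b \<in> f \<and> (linked \<or> f \<noteq> {a, b})}"
  proof -
    have "sum weight (set es) = card (set es \<inter> {e. snd e \<in> f \<and> (linked \<or> f \<noteq> {fst e, snd e})})"
      by (simp add: weight_def sum.If_cases of_bool_def)
    also have "set es \<inter> {e. snd e \<in> f \<and> (linked \<or> f \<noteq> {fst e, snd e})} =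
        {(a, b) \<in> set es. b \<in> f \<and> (linked \<or> f \<noteq> {a, b})}" by auto
    finally show ?thesis .
  qed
  ultimately show ?thesis
    by (simp add: count_list_concat_map sum_list_addf sum_list_arc_in sum_list_arc_out)
qed

lemma ex_rainbow_cycle:
  assumes "\<And>f. f \<in> point_pairs X \<Longrightarrow>
    card {(a, b) \<in> set es. b \<in> f \<and> (linked \<or> f \<noteq> {a, b})} + (\<Sum>(a, b, c)\<leftarrow>turns. surplus a b c) = r"
  shows "\<exists>p. rainbow_cycle X r p"
proof (rule rainbow_cycleI)
  show "flip_path X (concat (map block turns)) (start (arc_in (hd turns)))"
    by (rule flip_path_blocks)
  show "source (concat (map block turns)) (start (arc_in (hd turns))) = start (arc_in (hd turns))"
    by (rule source_concat_map[OF source_block turns_nonempty])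
  show "concat (map block turns) \<noteq> []"
    using turns_nonempty by (cases turns) (auto simp: block_def)
  have "distinct (concat (map (\<lambda>t. map fst (block t)) turns))"
    by (intro distinct_concat_map distinct_turns distinct_block blocks_disjoint)
  then show "distinct (map fst (concat (map block turns)))" by (simp add: map_concat comp_def)
qed (simp add: count_labels_blocks assms)

end

lemma (in tour) ex_rainbow_cycle:
  assumes "\<And>f. f \<in> point_pairs X \<Longrightarrow> card {(a, b) \<in> set es. b \<in> f \<and> (linked \<or> f \<noteq> {a, b})} = r"
  shows "\<exists>p. rainbow_cycle X r p"
proof -
  interpret connected_tour X es linked "exit_label X"
    "\<lambda>a b c. [(passage_tree X a b c, passage_label X a b c)]" "\<lambda>a b c. 0"
  proof
    fix a b c assume t: "(a, b, c) \<in> set turns"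
    then interpret turn X a b c by (rule turn)
    show "flip_path X [(stage_tree X a b (card X - 3), exit_label X a b c),
        (passage_tree X a b c, passage_label X a b c)] (stage_tree X b c 1)"
      by (rule flip_path_passage)
    show "count_list
          (exit_label X a b c # map snd [(passage_tree X a b c, passage_label X a b c)]) f =
        of_bool (f = {b, last (sweep X a b)}) + of_bool (f = {c, hd (sweep X b c)}) + 0" for f
      using count_passage_labels[of f] by simp
    fix d e assume de: "(d, e) \<in> set es"
    then have "(d, e) \<noteq> (b, a)" "(d, e) \<noteq> (c, b)" using turn_arcs[OF t] asym by blast+
    then show "set (map fst [(passage_tree X a b c, passage_label X a b c)]) \<inter>
        move_trees X d e = {}"
      using passage_tree_not_move_tree[OF move[OF de]] by simp
  next
    fix a b c a' b' c'
    assume turns: "(a, b, c) \<in> set turns" "(a', b', c') \<in> set turns" "(a, b, c) \<noteq> (a', b', c')"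
    then have "passage_tree X a b c \<noteq> passage_tree X a' b' c'"
      using turns_disjoint by (intro passage_tree_neq turn) blast+
    then show "set (map fst [(passage_tree X a b c, passage_label X a b c)]) \<inter>
        set (map fst [(passage_tree X a' b' c', passage_label X a' b' c')]) = {}" by simp
  qed simp
  show ?thesis using assms by (intro ex_rainbow_cycle) (simp add: case_prod_beta)
qed

subsection \<open>Circulant digraphs and their Euler tours\<close>

definition circulant :: "nat \<Rightarrow> nat \<Rightarrow> (nat \<times> nat) set" where
  "circulant n d = {(i, j). i < n \<and> j < n \<and> (i < j \<and> j \<le> i + d \<or> j < i \<and> j + n \<le> i + d)}"

definition circulant_digraph :: "nat \<Rightarrow> nat \<Rightarrow> (nat, nat \<times> nat) pre_digraph" where
  "circulant_digraph n d = \<lparr>verts = {..<n}, arcs = circulant n d, tail = fst, head = snd\<rparr>"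

lemma finite_circulant: "finite (circulant n d)"
  by (rule finite_subset[of _ "{..<n} \<times> {..<n}"]) (auto simp: circulant_def)

lemma circulant_asym: "2 * d < n \<Longrightarrow> (i, j) \<in> circulant n d \<Longrightarrow> (j, i) \<notin> circulant n d"
  by (auto simp: circulant_def)

lemma circulant_tournament:
  "i < 2 * d + 1 \<Longrightarrow> j < 2 * d + 1 \<Longrightarrow> i \<noteq> j \<Longrightarrow>
    (i, j) \<in> circulant (2 * d + 1) d \<or> (j, i) \<in> circulant (2 * d + 1) d"
  by (auto simp: circulant_def)

lemma card_circulant_into:
  assumes "j < n" "2 * d < n"
  shows "card {i. (i, j) \<in> circulant n d} = d"
proof -
  have "{i. (i, j) \<in> circulant n d} = {j - d..<j} \<union> {j + n - d..<n}"
    using assms by (auto simp: circulant_def)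
  moreover have "card ({j - d..<j} \<union> {j + n - d..<n}) = card {j - d..<j} + card {j + n - d..<n}"
    using assms by (intro card_Un_disjoint) auto
  ultimately show ?thesis using assms by auto
qed

lemma card_circulant_from:
  assumes "i < n" "2 * d < n"
  shows "card {j. (i, j) \<in> circulant n d} = d"
proof -
  have "{j. (i, j) \<in> circulant n d} = {Suc i..<min (Suc (i + d)) n} \<union> {0..<Suc (i + d) - n}"
    using assms by (auto simp: circulant_def)
  moreover have "card ({Suc i..<min (Suc (i + d)) n} \<union> {0..<Suc (i + d) - n})
      = card {Suc i..<min (Suc (i + d)) n} + card {0..<Suc (i + d) - n}"
    using assms by (intro card_Un_disjoint) auto
  ultimately show ?thesis using assms by auto
qed

lemma card_circulant_into_pair:
  assumes "i < n" "j < n" "i \<noteq> j" "2 * d < n"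
  shows "card {(k, l) \<in> circulant n d. l \<in> {i, j}} = 2 * d"
proof -
  define into where "into l = (\<lambda>k. (k, l)) ` {k. (k, l) \<in> circulant n d}" for l
  have "finite (into l)" for l
    by (rule finite_subset[OF _ finite_circulant[of n d]]) (auto simp: into_def)
  then have "card (into i \<union> into j) = card (into i) + card (into j)"
    using assms(3) by (intro card_Un_disjoint) (auto simp: into_def)
  moreover have "card (into l) = d" if "l < n" for l
    using card_circulant_into[OF that assms(4)] by (simp add: into_def card_image inj_on_def)
  moreover have "{(k, l) \<in> circulant n d. l \<in> {i, j}} = into i \<union> into j" by (auto simp: into_def)
  ultimately show ?thesis using assms by simp
qed

lemma card_tournament_into_pair:
  assumes "i < 2 * d + 1" "j < 2 * d + 1" "i \<noteq> j"
  shows "card {(k, l) \<in> circulant (2 * d + 1) d. l \<in> {i, j} \<and> {i, j} \<noteq> {k, l}} = 2 * d - 1"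
proof -
  let ?S = "{(k, l) \<in> circulant (2 * d + 1) d. l \<in> {i, j}}"
  obtain e where e: "e \<in> circulant (2 * d + 1) d" "e = (i, j) \<or> e = (j, i)"
    using circulant_tournament[OF assms] by blast
  then have "{(k, l) \<in> circulant (2 * d + 1) d. l \<in> {i, j} \<and> {i, j} \<noteq> {k, l}} = ?S - {e}"
    using circulant_asym[of d "2 * d + 1"] by (auto simp: doubleton_eq_iff)
  moreover have "e \<in> ?S" using e by auto
  moreover have "card ?S = 2 * d" using assms by (intro card_circulant_into_pair) auto
  ultimately show ?thesis by (simp add: card_Diff_singleton)
qed

lemma fin_digraph_circulant: "fin_digraph (circulant_digraph n d)"
  by unfold_locales (auto simp: circulant_digraph_def finite_circulant, auto simp: circulant_def)

lemma connected_circulant: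
  assumes "1 \<le> d" "0 < n"
  shows "Digraph_Component.connected (circulant_digraph n d)" (is "Digraph_Component.connected ?G")
proof (rule connected_if_reachable_from)
  show "0 \<in> verts ?G" using assms by (simp add: circulant_digraph_def)
  have ends: "arcs_ends ?G = circulant n d" "verts ?G = {..<n}"
    by (auto simp: arcs_ends_def arc_to_ends_def circulant_digraph_def)
  fix k assume "k \<in> verts ?G"
  then have "k < n" by (simp add: ends)
  then show "(0, k) \<in> rtrancl_on (verts ?G) (symcl (arcs_ends ?G))"
    unfolding ends
  proof (induction k)
    case (Suc k)
    have "(k, Suc k) \<in> symcl (circulant n d)"
      using Suc.prems assms by (auto simp: symcl_def circulant_def)
    then show ?case using Suc by (auto intro: rtrancl_on_into_rtrancl_on)
  qed auto
qed

lemma degree_circulant: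
  assumes "u < n" "2 * d < n"
  shows "in_degree (circulant_digraph n d) u = d" "out_degree (circulant_digraph n d) u = d"
proof -
  have "in_arcs (circulant_digraph n d) u = (\<lambda>i. (i, u)) ` {i. (i, u) \<in> circulant n d}"
    "out_arcs (circulant_digraph n d) u = (\<lambda>j. (u, j)) ` {j. (u, j) \<in> circulant n d}"
    by (auto simp: in_arcs_def out_arcs_def circulant_digraph_def)
  then show "in_degree (circulant_digraph n d) u = d" "out_degree (circulant_digraph n d) u = d"
    using card_circulant_into[OF assms] card_circulant_from[OF assms]
    by (simp_all add: in_degree_def out_degree_def card_image inj_on_def)
qed

lemma ex_circulant_tour:
  assumes "1 \<le> d" "2 * d < n"
  shows "\<exists>p. distinct p \<and> set p = circulant n d \<and> map snd p = rotate1 (map fst p)"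
proof -
  interpret G: fin_digraph "circulant_digraph n d" by (rule fin_digraph_circulant)
  have "in_degree (circulant_digraph n d) u = out_degree (circulant_digraph n d) u"
    if "u \<in> verts (circulant_digraph n d)" for u
    using that degree_circulant assms by (simp add: circulant_digraph_def)
  then obtain u p where "G.euler_trail u p u"
    using G.closed_euler1 connected_circulant[of d n] assms by auto
  then have "G.cas u p u" "distinct p" "set p = arcs (circulant_digraph n d)"
    by (auto simp: G.euler_trail_def G.trail_def G.awalk_def)
  then have "distinct p \<and> set p = circulant n d \<and> map snd p = rotate1 (map fst p)"
    using G.closed_cas_heads by (simp add: circulant_digraph_def)
  then show ?thesis by blast
qed

locale labelled_points = points +
  fixes w :: "nat \<Rightarrow> point" and d :: nat
  assumes bij_w: "bij_betw w {..<card X} X" and six_points: "card X \<ge> 6"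
    and degree: "1 \<le> d" "2 * d < card X"
begin

definition circulant_arcs :: "(point \<times> point) set" where
  "circulant_arcs = map_prod w w ` circulant (card X) d"

lemma w_eq_iff: "i < card X \<Longrightarrow> j < card X \<Longrightarrow> w i = w j \<longleftrightarrow> i = j"
  using bij_w by (auto simp: bij_betw_def inj_on_def)

lemma w_in: "i < card X \<Longrightarrow> w i \<in> X"
  using bij_w by (auto simp: bij_betw_def)

lemma arc_iff:
  "i < card X \<Longrightarrow> j < card X \<Longrightarrow> (w i, w j) \<in> circulant_arcs \<longleftrightarrow> (i, j) \<in> circulant (card X) d"
  by (auto simp: circulant_arcs_def circulant_def w_eq_iff)

lemma inj_on_arcs: "S \<subseteq> circulant (card X) d \<Longrightarrow> inj_on (map_prod w w) S"
  by (rule inj_onI) (auto simp: circulant_def w_eq_iff subset_iff)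

lemma ex_tour: "\<exists>es. tour X es \<and> set es = circulant_arcs"
proof -
  obtain p where p: "distinct p" "set p = circulant (card X) d" "map snd p = rotate1 (map fst p)"
    using ex_circulant_tour degree by blast
  let ?es = "map (map_prod w w) p"
  have arcs: "set ?es = circulant_arcs" using p by (simp add: circulant_arcs_def)
  have "tour X ?es"
  proof
    have "(0, 1) \<in> set p" using p(2) degree by (auto simp: circulant_def)
    then show "?es \<noteq> []" by auto
    show "distinct ?es" using p inj_on_arcs by (simp add: distinct_map)
    show "map snd ?es = rotate1 (map fst ?es)"
      using arg_cong[OF p(3), of "map w"] by (simp add: comp_def rotate1_map)
    fix a b assume "(a, b) \<in> set ?es"
    then obtain i j where "(i, j) \<in> circulant (card X) d" "a = w i" "b = w j" using p by auto
    moreover from this have "i < card X" "j < card X" by (auto simp: circulant_def)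
    ultimately show "a \<in> X \<and> b \<in> X \<and> a \<noteq> b" "(b, a) \<notin> set ?es"
      using circulant_asym[OF degree(2)]
      by (auto simp: arcs w_in w_eq_iff arc_iff simp del: set_map)
  qed (rule six_points)
  then show ?thesis using arcs by blast
qed

lemma pair_casesE:
  assumes "f \<in> point_pairs X"
  obtains i j where "i < card X" "j < card X" "i \<noteq> j" "f = {w i, w j}"
proof -
  obtain x y where "f = {x, y}" "x \<noteq> y" "x \<in> X" "y \<in> X"
    using assms by (auto simp: point_pairs_def card_2_iff)
  moreover from this obtain i j where "i < card X" "j < card X" "x = w i" "y = w j"
    using bij_betw_imp_surj_on[OF bij_w] by (metis imageE lessThan_iff)
  ultimately show ?thesis using that[of i j] by auto
qed

lemma card_arcs_into:
  assumes "f \<in> point_pairs X"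
  shows "card {(a, b) \<in> circulant_arcs. b \<in> f} = 2 * d"
proof -
  obtain i j where ij: "i < card X" "j < card X" "i \<noteq> j" "f = {w i, w j}"
    using assms by (rule pair_casesE)
  let ?S = "{(k, l) \<in> circulant (card X) d. l \<in> {i, j}}"
  have "{(a, b) \<in> circulant_arcs. b \<in> f} = map_prod w w ` ?S"
    using ij by (auto simp: circulant_arcs_def circulant_def w_eq_iff)
  moreover have "inj_on (map_prod w w) ?S" by (rule inj_on_arcs) auto
  ultimately show ?thesis using card_circulant_into_pair[OF ij(1-3) degree(2)]
    by (simp add: card_image)
qed

lemma card_arcs_into_tournament:
  assumes "f \<in> point_pairs X" "card X = 2 * d + 1"
  shows "card {(a, b) \<in> circulant_arcs. b \<in> f \<and> f \<noteq> {a, b}} = 2 * d - 1"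
proof -
  obtain i j where ij: "i < card X" "j < card X" "i \<noteq> j" "f = {w i, w j}"
    using assms(1) by (rule pair_casesE)
  let ?S = "{(k, l) \<in> circulant (card X) d. l \<in> {i, j} \<and> {i, j} \<noteq> {k, l}}"
  have "{(a, b) \<in> circulant_arcs. b \<in> f \<and> f \<noteq> {a, b}} = map_prod w w ` ?S"
    using ij by (auto simp: circulant_arcs_def circulant_def w_eq_iff doubleton_eq_iff)
  moreover have "inj_on (map_prod w w) ?S" by (rule inj_on_arcs) auto
  ultimately show ?thesis using card_tournament_into_pair[of i d j] ij assms(2)
    by (simp add: card_image)
qed

lemma ex_rainbow_cycle_even: "\<exists>p. rainbow_cycle X (2 * d) p"
proof -
  obtain es where es: "tour X es" "set es = circulant_arcs" using ex_tour by blast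
  then interpret tour X es True by simp
  show ?thesis using card_arcs_into es(2) by (intro ex_rainbow_cycle) simp
qed

lemma ex_rainbow_cycle_tournament:
  assumes "card X = 2 * d + 1"
  shows "\<exists>p. rainbow_cycle X (2 * d - 1) p"
proof -
  obtain es where es: "tour X es" "set es = circulant_arcs" using ex_tour by blast
  then interpret tour X es False by simp
  show ?thesis using card_arcs_into_tournament[OF _ assms] es(2) by (intro ex_rainbow_cycle) simp
qed

end

subsection \<open>Inserting the 1-rainbow cycle into a tour\<close>

context tour
begin

definition adjacent :: "point \<Rightarrow> point \<Rightarrow> bool" where
  "adjacent x y \<longleftrightarrow> (x, y) \<in> set es \<or> (y, x) \<in> set es"

inductive off_tour :: "point set set \<Rightarrow> bool" where
  single: "spine T = {x} \<Longrightarrow> \<forall>p. adjacent x p \<longrightarrow> \<not> supporting X x p \<Longrightarrow> off_tour T"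
| pair: "spine T = {x, y} \<Longrightarrow> x \<noteq> y \<Longrightarrow> \<not> adjacent x y \<Longrightarrow> off_tour T"
| path: "spine T = {x, y, z} \<Longrightarrow> distinct [x, y, z] \<Longrightarrow> {x, z} \<notin> T \<Longrightarrow> \<not> adjacent x z \<Longrightarrow>
    x \<in> heavy T \<or> \<not> adjacent x y \<Longrightarrow> off_tour T"
| many: "4 \<le> card (spine T) \<Longrightarrow> off_tour T"

lemma off_tour_spine_neq:
  assumes "off_tour T" "adjacent a b" "a \<noteq> b"
  shows "spine T \<noteq> {a, b}"
proof
  assume spine: "spine T = {a, b}"
  then have card: "card (spine T) = 2" using assms(3) by simp
  from assms(1) show False
  proof cases
    case (pair x y)
    then show False using spine assms(2) by (auto simp: doubleton_eq_iff adjacent_def)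
  qed (use card in auto)
qed

lemma off_tour_neq_link_tree:
  assumes "off_tour T" "(a, b) \<in> set es"
  shows "T \<noteq> link_tree X a b"
proof
  assume eq: "T = link_tree X a b"
  interpret move X a b by (rule move[OF assms(2)])
  from assms(1) show False
  proof cases
    case (path x y z)
    then have "x \<in> spine_ends T" "z \<in> spine_ends T"
      by (auto simp: spine_ends_def insert_commute)
    then have "{x, z} = {a, b}" using path(2) eq spine_ends_link_tree by auto
    then show False using path(4) assms(2) by (auto simp: doubleton_eq_iff adjacent_def)
  next
    case (pair x y)
    then show False using card_spine_link_tree eq by simp
  qed (use card_spine_link_tree eq in auto)
qed

lemma off_tour_not_move_tree:
  assumes "off_tour T" "(a, b) \<in> set es"
  shows "T \<notin> move_trees X a b"
proof -
  interpret move X a b by (rule move[OF assms(2)])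
  have "spine T \<noteq> {a, b}" using assms neq by (intro off_tour_spine_neq) (auto simp: adjacent_def)
  then show ?thesis
    using off_tour_neq_link_tree[OF assms] spine_stage_tree by (auto simp: move_trees_def)
qed

lemma off_tour_neq_passage_tree:
  assumes "off_tour T" "(a, b, c) \<in> set turns"
  shows "T \<noteq> passage_tree X a b c"
proof
  assume eq: "T = passage_tree X a b c"
  interpret turn X a b c by (rule turn[OF assms(2)])
  have adj: "adjacent b a" "adjacent a b" "adjacent b c" "adjacent c b"
    using turn_arcs[OF assms(2)] by (auto simp: adjacent_def)
  note card = card_spine_passage_tree[folded eq]
  from assms(1) show False
  proof cases
    case (single x)
    then have "through_star X a b c" using card by (auto split: if_splits)
    moreover from this have "x = b" using single(1) eq spine_passage_tree by simp
    ultimately show False using single(2) adj by (auto simp: through_star_def)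
  next
    case (path x y z)
    then have "\<not> through_star X a b c" using card by auto
    then have "spine T = {a, b, c}" "heavy T = {b}"
      using eq spine_passage_tree heavy_passage_tree by simp_all
    then have xyz: "{x, y, z} = {a, b, c}" "x = b \<or> \<not> adjacent x y" using path(1,5) by auto
    have "z \<in> {a, b, c}" "x \<in> {a, b, c}" using xyz(1) by blast+
    then have "x \<noteq> b" using path(2,4) adj by auto
    moreover from this have "b = y \<or> b = z" using xyz(1) by auto
    ultimately show False using \<open>x \<in> {a, b, c}\<close> xyz(2) path(4) adj by auto
  qed (use card in \<open>auto split: if_splits\<close>)
qed

end

lemma nbrs_subset: "plane_tree X T \<Longrightarrow> nbrs T x \<subseteq> X"
  using tree_on_subset_point_pairs[of X T] by (auto simp: plane_tree_def nbrs_def point_pairs_def)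

lemma spine_subset:
  assumes "plane_tree X T"
  shows "spine T \<subseteq> X"
proof
  fix x assume "x \<in> spine T"
  then obtain u where "u \<in> nbrs T x" by (cases "nbrs T x = {}") (auto simp: spine_def)
  then have "x \<in> nbrs T u" by (simp add: nbrs_def insert_commute)
  then show "x \<in> X" using nbrs_subset[OF assms] by blast
qed

context hull_points
begin

lemma supporting_first_hull_edge: "supporting X (v ! 1) (v ! 0)"
proof -
  have "\<not> orient (v ! 1) (v ! 0) (v ! i) > 0" if "i < n" for i
    using that orient_v_pos[of 1 i] orient_flip[of "v ! 1" "v ! 0" "v ! i"] three_points
    by (cases "i = 0 \<or> i = 1") (auto simp: orient_self)
  then show ?thesis by (auto simp: supporting_def left_of_def elim: v_cases)
qed

lemma supporting_last_hull_edge: "supporting X (v ! 0) (v ! (n - 1))"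
proof -
  have "\<not> orient (v ! 0) (v ! (n - 1)) (v ! i) > 0" if "i < n" for i
  proof -
    have "i = 0 \<or> i = n - 1 \<or> 1 \<le> i \<and> i < n - 1" using that by linarith
    then show ?thesis using orient_v_neg[of i "n - 1"] by (auto simp: orient_self)
  qed
  then show ?thesis by (auto simp: supporting_def left_of_def elim: v_cases)
qed

lemma nbrs_hull_path:
  assumes "i < n" "b < n"
  shows "nbrs (hull_path a b) (v ! i) =
    (if a < i \<and> i \<le> b then {v ! (i - 1)} else {}) \<union> (if a \<le> i \<and> i < b then {v ! Suc i} else {})"
proof (intro set_eqI)
  fix u
  have "u \<in> nbrs (hull_path a b) (v ! i) \<longleftrightarrow>
      (\<exists>k. a \<le> k \<and> k < b \<and> (v ! i = v ! k \<and> u = v ! Suc k \<or> v ! i = v ! Suc k \<and> u = v ! k))"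
    by (auto simp: nbrs_def hull_path_def doubleton_eq_iff)
  also have "\<dots> \<longleftrightarrow> (\<exists>k. a \<le> k \<and> k < b \<and> (i = k \<and> u = v ! Suc k \<or> i = Suc k \<and> u = v ! k))"
    using assms by (intro ex_cong) auto
  also have "\<dots> \<longleftrightarrow> u \<in> (if a < i \<and> i \<le> b then {v ! (i - 1)} else {}) \<union>
      (if a \<le> i \<and> i < b then {v ! Suc i} else {})"
    by (cases i) (auto simp: conj_disj_distribL ex_disj_distrib)
  finally show "u \<in> nbrs (hull_path a b) (v ! i) \<longleftrightarrow>
    u \<in> (if a < i \<and> i \<le> b then {v ! (i - 1)} else {}) \<union>
      (if a \<le> i \<and> i < b then {v ! Suc i} else {})" .
qed

lemma spine_eqI:
  assumes "plane_tree X T" "\<And>i. i < n \<Longrightarrow> v ! i \<in> spine T \<longleftrightarrow> i \<in> I" "I \<subseteq> {..<n}"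
  shows "spine T = (!) v ` I"
  using spine_subset[OF assms(1)] assms(2,3) by (auto elim!: v_cases)

lemma spine_first_stage:
  assumes "1 \<le> t" "t < n - 2"
  shows "spine (path_stage_tree 0 t) = {v ! 0, v ! 1}"
proof -
  have "path_stage_tree 0 t = stage_tree X (v ! 0) (v ! 1) t"
    by (simp add: path_stage_tree_def suffix_0)
  then show ?thesis
    using point_pair.spine_stage_tree[OF suffix_point_pair[of 0], of t] assms
    by (simp add: suffix_0)
qed

lemma nbrs_path_stage_tree:
  "nbrs (path_stage_tree j t) x = nbrs (hull_path 0 j) x \<union>
     (if x = v ! j then insert (v ! Suc j) (set (drop t (path_sweep j))) else {}) \<union>
     (if x = v ! Suc j then insert (v ! j) (set (take t (path_sweep j))) else {}) \<union>
     (if x \<in> set (drop t (path_sweep j)) then {v ! j} else {}) \<union>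
     (if x \<in> set (take t (path_sweep j)) then {v ! Suc j} else {})"
  by (auto simp: path_stage_tree_def stage_tree_def double_star_def)

lemma spine_path_stage_tree:
  assumes "1 \<le> j" "j < n - 2" "t < n - 2 - j"
  shows "spine (path_stage_tree j t) = (!) v ` {1..(if t = 0 then j else Suc j)}"
proof (rule spine_eqI)
  show "plane_tree X (path_stage_tree j t)" using assms by (intro plane_path_stage_tree) simp
  let ?A = "set (drop t (path_sweep j))" and ?B = "set (take t (path_sweep j))"
  have j: "Suc j < n" using assms by simp
  interpret p: point_pair "suffix j" "v ! j" "v ! Suc j" by (rule suffix_point_pair[OF j])
  have part: "?A \<union> ?B = suffix j - {v ! j, v ! Suc j}" "?A \<inter> ?B = {}" by (rule p.sweep_partition)+
  have B: "?B = {} \<longleftrightarrow> t = 0" using p.length_sweep assms by (auto simp: card_suffix)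
  note nbrs = nbrs_path_stage_tree[of j t]
  fix i assume i: "i < n"
  have suffix: "v ! i \<in> ?A \<union> ?B \<longleftrightarrow> j + 2 \<le> i"
    unfolding part(1) using v_in_suffix_iff[OF i, of j] i j by auto
  have finite: "finite (nbrs (path_stage_tree j t) (v ! i))"
    unfolding nbrs using nbrs_hull_path[OF i Suc_lessD[OF j], of 0] by simp
  consider (root) "i = 0" | (path) "1 \<le> i" "i \<le> j" | (next_centre) "i = Suc j" | (leaf) "j + 2 \<le> i"
    by linarith
  then show "v ! i \<in> spine (path_stage_tree j t) \<longleftrightarrow> i \<in> {1..(if t = 0 then j else Suc j)}"
  proof cases
    case root
    then show ?thesis
      using nbrs_hull_path[OF i Suc_lessD[OF j], of 0] suffix assms i j
      by (simp add: not_in_spineI[of _ _ "v ! 1"] nbrs)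
  next
    case path
    then show ?thesis
      using nbrs_hull_path[OF i Suc_lessD[OF j], of 0] assms i j
      by (simp add: spineI[OF _ _ _ finite, of "v ! (i - 1)" "v ! Suc i"] nbrs)
  next
    case next_centre
    have "nbrs (path_stage_tree j t) (v ! i) = insert (v ! j) ?B"
      using next_centre nbrs_hull_path[OF i Suc_lessD[OF j], of 0] suffix i j by (simp add: nbrs)
    moreover have "v ! j \<notin> ?B" using part(1) by blast
    moreover have "1 \<le> card ?B \<longleftrightarrow> t \<noteq> 0" using B by (simp add: Suc_le_eq card_gt_0_iff)
    ultimately show ?thesis using next_centre assms(1) unfolding spine_def by simp
  next
    case leaf
    then have "nbrs (path_stage_tree j t) (v ! i) \<subseteq> {if v ! i \<in> ?A then v ! j else v ! Suc j}"
      unfolding nbrs using nbrs_hull_path[OF i Suc_lessD[OF j], of 0] part(2) i j by auto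
    then show ?thesis using leaf by (auto dest: not_in_spineI)
  qed
qed (use assms in auto)

lemma nbrs_broom:
  assumes "i < n" "k < n"
  shows "nbrs (broom (v ! 0) k) (v ! i) = (if i = 0 then prefix k - {v ! 0} else {}) \<union>
    (if 1 \<le> i \<and> i \<le> k then {v ! 0} else {}) \<union> (if k < i then {v ! (i - 1)} else {}) \<union>
    (if k \<le> i \<and> i < n - 1 then {v ! Suc i} else {})"
  using assms nbrs_hull_path[of i "n - 1" k] v_in_prefix_iff[of i k] by (auto simp: broom_def)

lemma v_in_spine_broom:
  assumes "1 \<le> k" "k < n - 1" "i < n"
  shows "v ! i \<in> spine (broom (v ! 0) k) \<longleftrightarrow> i = 0 \<and> 2 \<le> k \<or> k \<le> i \<and> i \<le> n - 2"
proof -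
  have "k < n" using assms(2) by simp
  note nbrs = nbrs_broom[OF assms(3) this]
  have finite: "finite (nbrs (broom (v ! 0) k) (v ! i))" unfolding nbrs by (simp add: prefix_def)
  consider (path_start) "i = 0" "k = 1" | (centre) "i = 0" "2 \<le> k" | (leaf) "1 \<le> i" "i < k"
    | (handle_start) "i = k" | (handle) "k < i" "i < n - 1" | (handle_end) "i = n - 1"
    using assms by linarith
  then show ?thesis
  proof cases
    case path_start
    then have "nbrs (broom (v ! 0) k) (v ! i) = {v ! 1}"
      unfolding nbrs using assms by (simp add: prefix_small insert_Diff_if)
    then show ?thesis using path_start by (simp add: spine_def)
  next
    case centre
    then have "v ! 1 \<in> nbrs (broom (v ! 0) k) (v ! i)" "v ! 2 \<in> nbrs (broom (v ! 0) k) (v ! i)"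
      unfolding nbrs using assms by (simp_all add: v_in_prefix_iff)
    then show ?thesis using centre assms spineI[OF _ _ _ finite, of "v ! 1" "v ! 2"] by simp
  next
    case leaf
    then have "nbrs (broom (v ! 0) k) (v ! i) = {v ! 0}" unfolding nbrs by simp
    then show ?thesis using leaf by (simp add: spine_def)
  next
    case handle_start
    then have "nbrs (broom (v ! 0) k) (v ! i) = {v ! Suc i, v ! 0}" unfolding nbrs using assms
      by simp
    then show ?thesis using handle_start assms by (simp add: spine_def)
  next
    case handle
    then have "nbrs (broom (v ! 0) k) (v ! i) = {v ! Suc i, v ! (i - 1)}" unfolding nbrs by simp
    then show ?thesis using handle assms by (simp add: spine_def)
  next
    case handle_end
    then have "nbrs (broom (v ! 0) k) (v ! i) = {v ! (i - 1)}" unfolding nbrs using assms by auto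
    then have "v ! i \<notin> spine (broom (v ! 0) k)" by (simp add: spine_def)
    moreover have "i \<noteq> 0" "\<not> i \<le> n - 2" using handle_end assms by linarith+
    ultimately show ?thesis by simp
  qed
qed

lemma broom_turn: "broom (v ! 2) 2 = star (v ! 2) {v ! 0, v ! 1} \<union> hull_path 2 (n - 1)"
  using three_points by (simp add: broom_def prefix_small insert_Diff_if)

lemma
  assumes "4 \<le> n" "i < n"
  shows v_in_spine_turn: "v ! i \<in> spine (broom (v ! 2) 2) \<longleftrightarrow> 2 \<le> i \<and> i \<le> n - 2"
    and heavy_turn: "v ! 2 \<in> heavy (broom (v ! 2) 2)"
proof -
  have nbrs: "nbrs (broom (v ! 2) 2) (v ! i) = (if i = 2 then {v ! 0, v ! 1} else {}) \<union>
      (if i = 0 \<or> i = 1 then {v ! 2} else {}) \<union> (if 2 < i then {v ! (i - 1)} else {}) \<union>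
      (if 2 \<le> i \<and> i < n - 1 then {v ! Suc i} else {})" if "i < n" for i
    using that assms(1) nbrs_hull_path[of i "n - 1" 2] by (auto simp: broom_turn)
  have "nbrs (broom (v ! 2) 2) (v ! 2) = {v ! 0, v ! 1, v ! 3}"
    using nbrs[of 2] assms(1) by (auto simp: numeral_3_eq_3)
  then show "v ! 2 \<in> heavy (broom (v ! 2) 2)"
    using assms(1) by (intro heavyI[of "v ! 0" _ _ "v ! 1" "v ! 3"]) auto
  then have centre: "v ! 2 \<in> spine (broom (v ! 2) 2)" by (rule subsetD[OF heavy_subset_spine])
  consider (leaf) "i < 2" | (centre) "i = 2"
    | (handle) "2 < i" "i < n - 1" | (handle_end) "i = n - 1"
    using assms(2) by linarith
  then show "v ! i \<in> spine (broom (v ! 2) 2) \<longleftrightarrow> 2 \<le> i \<and> i \<le> n - 2"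
  proof cases
    case leaf
    then have "nbrs (broom (v ! 2) 2) (v ! i) \<subseteq> {v ! 2}" by (simp add: nbrs[OF assms(2)])
    then show ?thesis using leaf by (auto dest: not_in_spineI)
  next
    case handle
    then have "nbrs (broom (v ! 2) 2) (v ! i) = {v ! Suc i, v ! (i - 1)}"
      by (simp add: nbrs[OF assms(2)])
    then show ?thesis using handle by (simp add: spine_def)
  next
    case handle_end
    then have "nbrs (broom (v ! 2) 2) (v ! i) = {v ! (i - 1)}"
      unfolding nbrs[OF assms(2)] using assms(1) by auto
    then have "v ! i \<notin> spine (broom (v ! 2) 2)" by (simp add: spine_def)
    moreover have "\<not> i \<le> n - 2" using handle_end assms(1) by linarith
    ultimately show ?thesis by simp
  qed (use assms centre in auto)
qed

end

text \<open>The pairs that must not be adjacent occur in the spines of the trees on the 1-rainbow cycle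
  and on its connection to the tour, or are edges of the convex hull at \<open>v\<^sub>0\<close>.\<close>

locale merge = tour X es True + hull_points X v for X es v +
  assumes inserted_at: "(v ! 0, v ! 2) \<in> set es"
    and nonadjacent: "\<not> adjacent (v ! 0) (v ! 1)" "\<not> adjacent (v ! 1) (v ! 2)"
      "\<not> adjacent (v ! 1) (v ! 3)" "\<not> adjacent (v ! 0) (v ! (card X - 2))"
      "\<not> adjacent (v ! 2) (v ! (card X - 2))" "\<not> adjacent (v ! 0) (v ! (card X - 1))"
begin

lemma adjacent_commute: "adjacent x y \<longleftrightarrow> adjacent y x"
  by (auto simp: adjacent_def)

lemma not_supporting_adjacent:
  assumes "supporting X x q" "x \<in> X" "q \<in> X" "q \<noteq> x" "\<not> adjacent x q"
  shows "\<forall>p. adjacent x p \<longrightarrow> \<not> supporting X x p"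
proof (intro allI impI notI)
  fix p assume p: "adjacent x p" "supporting X x p"
  then have "p \<in> X" "p \<noteq> x" using arcs_in_X by (auto simp: adjacent_def)
  then have "p = q" using p assms by (intro supporting_unique[of x]) auto
  then show False using p(1) assms(5) by simp
qed

lemma not_supporting_root: "\<forall>p. adjacent (v ! 0) p \<longrightarrow> \<not> supporting X (v ! 0) p"
  using six_points supporting_last_hull_edge nonadjacent(6)
  by (intro not_supporting_adjacent[of _ "v ! (n - 1)"]) auto

lemma not_supporting_first: "\<forall>p. adjacent (v ! 1) p \<longrightarrow> \<not> supporting X (v ! 1) p"
  using six_points supporting_first_hull_edge nonadjacent(1)
  by (intro not_supporting_adjacent[of _ "v ! 0"]) (auto simp: adjacent_commute)

lemma off_tour_star: "off_tour (star (v ! 0) (X - {v ! 0}))"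
proof (rule single[OF _ not_supporting_root])
  show "spine (star (v ! 0) (X - {v ! 0})) = {v ! 0}"
    using finite_X six_points by (intro spine_star) auto
qed

lemma off_tour_first_stage:
  assumes "1 \<le> t" "t < n - 2"
  shows "off_tour (path_stage_tree 0 t)"
  using spine_first_stage[OF assms] six_points nonadjacent(1) by (intro pair) auto

lemma off_tour_path_stage_tree:
  assumes "1 \<le> j" "j < n - 2" "t < n - 2 - j"
  shows "off_tour (path_stage_tree j t)"
proof -
  define m where "m = (if t = 0 then j else Suc j)"
  have spine: "spine (path_stage_tree j t) = (!) v ` {1..m}"
    using spine_path_stage_tree[OF assms] by (simp add: m_def)
  have m: "1 \<le> m" "m < n" using assms by (auto simp: m_def)
  consider (one) "m = 1" | (two) "m = 2" | (three) "m = 3" | (four_or_more) "4 \<le> m"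
    using m by linarith
  then show ?thesis
  proof cases
    case one
    then have "spine (path_stage_tree j t) = {v ! 1}" using spine by simp
    then show ?thesis using not_supporting_first by (rule single)
  next
    case two
    then have "{1..m} = {1, 2}" by auto
    then have "spine (path_stage_tree j t) = {v ! 1, v ! 2}" using spine by simp
    then show ?thesis using six_points nonadjacent(2) by (intro pair) auto
  next
    case three
    then have "{1..m} = {1, 2, 3}" by auto
    then have path_spine: "spine (path_stage_tree j t) = {v ! 1, v ! 2, v ! 3}" using spine by simp
    have "{v ! 1, v ! 3} \<notin> path_stage_tree j t"
      using early_edge_in_path_stage_tree_iff[of 1 j 3 t] three assms
      by (auto simp: m_def split: if_splits)
    then show ?thesis using path[OF path_spine] six_points nonadjacent(2,3) by simp
  next
    case four_or_more
    have "inj_on ((!) v) {1..m}" using m by (auto intro!: inj_onI)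
    then show ?thesis using four_or_more by (intro many) (simp add: spine card_image)
  qed
qed

lemma card_spine_broom:
  assumes "1 \<le> k" "k \<le> n - 4"
  shows "4 \<le> card (spine (broom (v ! 0) k))"
proof -
  let ?I = "if k = 1 then {1..4} else insert 0 {n - 4..n - 2}"
  have "plane_tree X (broom (v ! 0) k)"
    using assms six_points by (intro plane_broom) (auto simp: prefix_def)
  then have "finite (spine (broom (v ! 0) k))"
    using finite_subset[OF spine_subset finite_X] by blast
  moreover have "(!) v ` ?I \<subseteq> spine (broom (v ! 0) k)"
    using assms six_points by (auto simp: v_in_spine_broom split: if_splits)
  ultimately have "card ((!) v ` ?I) \<le> card (spine (broom (v ! 0) k))" by (rule card_mono)
  moreover have "inj_on ((!) v) ?I" using six_points by (auto intro!: inj_onI split: if_splits)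
  then have "card ((!) v ` ?I) = 4" using six_points by (simp add: card_image)
  ultimately show ?thesis by simp
qed

lemma off_tour_broom:
  assumes "1 \<le> k" "k < n - 1"
  shows "off_tour (broom (v ! 0) k)"
proof -
  have plane: "plane_tree X (broom (v ! 0) k)"
    using assms by (intro plane_broom) (auto simp: prefix_def)
  consider (two) "k = n - 2" | (three) "k = n - 3" | (four_or_more) "k \<le> n - 4"
    using assms six_points by linarith
  then show ?thesis
  proof cases
    case two
    have "spine (broom (v ! 0) k) = (!) v ` {0, n - 2}"
      using two assms six_points by (intro spine_eqI plane) (auto simp: v_in_spine_broom)
    then show ?thesis using six_points nonadjacent(4) by (intro pair) auto
  next
    case three
    have "spine (broom (v ! 0) k) = (!) v ` {0, n - 3, n - 2}"
      using three assms six_points by (intro spine_eqI plane) (auto simp: v_in_spine_broom)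
    moreover have "v ! 0 \<in> heavy (broom (v ! 0) k)"
    proof (rule heavyI)
      show "finite (nbrs (broom (v ! 0) k) (v ! 0))"
        using nbrs_subset[OF plane] finite_X by (rule finite_subset)
      show "v ! 1 \<in> nbrs (broom (v ! 0) k) (v ! 0)" "v ! 2 \<in> nbrs (broom (v ! 0) k) (v ! 0)"
        "v ! 3 \<in> nbrs (broom (v ! 0) k) (v ! 0)"
        unfolding nbrs_def using three six_points by (simp_all add: edge_in_broom_iff)
    qed (use six_points in auto)
    moreover have "{v ! 0, v ! (n - 2)} \<notin> broom (v ! 0) k"
      using three six_points by (simp add: edge_in_broom_iff)
    ultimately show ?thesis using six_points nonadjacent(4) by (intro path) auto
  next
    case four_or_more
    then show ?thesis using card_spine_broom assms(1) by (intro many) auto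
  qed
qed

lemma off_tour_turn: "off_tour (broom (v ! 2) 2)"
proof -
  have "plane_tree X (broom (v ! 2) 2)"
    using six_points by (intro plane_broom) (auto simp: prefix_def)
  then have spine: "spine (broom (v ! 2) 2) = (!) v ` {2..n - 2}"
    using six_points by (intro spine_eqI) (auto simp: v_in_spine_turn)
  show ?thesis
  proof (cases "n = 6")
    case True
    then have "{2..n - 2} = {2, 3, n - 2}" by auto
    then have "spine (broom (v ! 2) 2) = {v ! 2, v ! 3, v ! (n - 2)}" using spine by simp
    moreover have "{v ! 2, v ! (n - 2)} \<notin> broom (v ! 2) 2"
      using True edge_in_hull_path_iff[of 2 "n - 2" "n - 1" 2]
      by (simp add: broom_turn doubleton_eq_iff)
    moreover have "v ! 2 \<in> heavy (broom (v ! 2) 2)" using True by (intro heavy_turn[of 0]) auto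
    ultimately show ?thesis using True nonadjacent(5) by (intro path) auto
  next
    case False
    have "inj_on ((!) v) {2..n - 2}" using six_points by (auto intro!: inj_onI)
    then show ?thesis using False six_points by (intro many) (simp add: spine card_image)
  qed
qed

lemma off_tour_hull_flips: "T \<in> set (map fst (hull_flips (n - 1))) \<Longrightarrow> off_tour T"
  by (elim hull_flips_cases)
    (simp_all only: off_tour_star off_tour_first_stage off_tour_path_stage_tree off_tour_broom
        off_tour_turn)

definition bridge :: "point set set" where
  "bridge = detour_star X (v ! 0) (v ! (n - 2)) (v ! (n - 1)) (v ! 2) (v ! 3)"

lemma detour_bridge: "detour X (v ! 0) (v ! (n - 2)) (v ! (n - 1)) (v ! 2) (v ! 3)"
  using six_points by unfold_locales auto

lemma spine_bridge: "spine bridge = {v ! (n - 2), v ! 0, v ! 2}"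
  unfolding bridge_def by (rule detour.spine_detour_star[OF detour_bridge finite_X six_points])

lemma off_tour_bridge: "off_tour bridge"
proof (rule path[OF spine_bridge])
  have "{v ! 2, v ! (n - 2)} \<notin> star (v ! 0) (X - {v ! 0, v ! (n - 1), v ! 3})"
    using six_points by simp
  then show "{v ! (n - 2), v ! 2} \<notin> bridge"
    using six_points by (simp add: bridge_def detour_star_def doubleton_eq_iff, presburger)
qed (use six_points nonadjacent(4,5) adjacent_commute in auto)

lemma bridge_fresh: "bridge \<notin> set (map fst (hull_flips (n - 1)))"
proof
  assume "bridge \<in> set (map fst (hull_flips (n - 1)))"
  moreover have in_spine: "v ! 0 \<in> spine bridge" "v ! 2 \<in> spine bridge" "v ! 3 \<notin> spine bridge"
    using six_points by (simp_all add: spine_bridge)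
  ultimately show False
  proof (cases rule: hull_flips_cases)
    case star
    then have "spine bridge = {v ! 0}" using finite_X six_points by (simp add: spine_star)
    then show False using in_spine(2) six_points by simp
  next
    case (first_stage t)
    then have "spine bridge = {v ! 0, v ! 1}" using spine_first_stage by simp
    then show False using in_spine(2) six_points by simp
  next
    case (stage j t)
    then have "spine bridge = (!) v ` {1..(if t = 0 then j else Suc j)}"
      using spine_path_stage_tree by simp
    then show False using in_spine(1) stage(2) by (auto split: if_splits)
  next
    case (broom k)
    then have "k \<le> 2" using in_spine(2) v_in_spine_broom[of k 2] six_points by simp
    then show False using broom in_spine(3) v_in_spine_broom[of k 3] six_points by simp
  next
    case turn
    then show False using in_spine(1) v_in_spine_turn[of 0] six_points by simp
  qed
qed

lemma near_star_eq_broom: "near_star X (v ! 0) (v ! (n - 2)) (v ! (n - 1)) = broom (v ! 0) (n - 2)"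
proof -
  have m: "n - 1 = Suc (n - 2)" using six_points by simp
  have "X = insert (v ! (n - 1)) (prefix (n - 2))"
    using prefix_last prefix_Suc[of "n - 2"] by (simp only: m)
  moreover have "v ! (n - 1) \<notin> prefix (n - 2)" using six_points by (simp add: v_in_prefix_iff)
  ultimately have "X - {v ! 0, v ! (n - 1)} = prefix (n - 2) - {v ! 0}" by blast
  moreover have "hull_path (n - 2) (n - 1) = {{v ! (n - 2), v ! (n - 1)}}"
    unfolding m hull_path_Suc[OF order_refl] by simp
  ultimately show ?thesis by (simp add: near_star_def broom_def)
qed

lemma hd_sweep_inserted: "hd (sweep X (v ! 0) (v ! 2)) = v ! 3"
proof -
  interpret move X "v ! 0" "v ! 2" by (rule move[OF inserted_at])
  have left: "v ! 3 \<in> left_of X (v ! 0) (v ! 2)"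
    using six_points orient_v_pos[of 2 3] by (simp add: left_of_def)
  then have ccw: "ccw_next X (v ! 0) (v ! 2) (hd sw)"
    by (intro ccw_next_hd_sweep) (auto simp: supporting_def)
  then have hd: "hd sw \<in> X" "orient (v ! 0) (v ! 2) (hd sw) > 0"
    by (auto simp: ccw_next_def left_of_def)
  then obtain i where i: "i < n" "hd sw = v ! i" by (auto elim: v_cases)
  have "\<not> i \<le> 2"
  proof
    assume "i \<le> 2"
    then consider "i = 0" | "i = 1" | "i = 2" by linarith
    then show False
      using hd(2) i(2) orient_v_neg[of 1 2] six_points by cases (simp_all add: orient_self)
  qed
  moreover have "\<not> 3 < i"
  proof
    assume "3 < i"
    then have "orient (v ! 0) (v ! 3) (v ! i) > 0" using i(1) by (intro orient_v_pos) auto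
    moreover have "orient (v ! 0) (v ! i) (v ! 3) > 0"
      using ccw left i \<open>3 < i\<close> by (auto simp: ccw_next_def)
    ultimately show False using orient_swap[of "v ! 0" "v ! 3" "v ! i"] by simp
  qed
  ultimately have "i = 3" by simp
  then show ?thesis using i(2) by simp
qed

lemma stage_tree_inserted: "stage_tree X (v ! 0) (v ! 2) 1 = near_star X (v ! 0) (v ! 2) (v ! 3)"
proof -
  interpret move X "v ! 0" "v ! 2" by (rule move[OF inserted_at])
  show ?thesis using stage_tree_first six_points by (simp add: hd_sweep_inserted)
qed

lemma plane_bridge: "plane_tree X bridge"
  unfolding bridge_def
proof (rule plane_detour_star[OF detour_bridge])
  show "plane_tree X (near_star X (v ! 0) (v ! (n - 2)) (v ! (n - 1)))"
    unfolding near_star_eq_broom using six_points by (intro plane_broom) (auto simp: prefix_def)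
  interpret move X "v ! 0" "v ! 2" by (rule move[OF inserted_at])
  show "plane_tree X (near_star X (v ! 0) (v ! 2) (v ! 3))"
    using plane_stage_tree[of 1] by (simp only: stage_tree_inserted)
  show "\<not> crossing {v ! (n - 2), v ! (n - 1)} {v ! 2, v ! 3}"
    using not_crossing_apart[of 2 3 "n - 2" "n - 1"] six_points by (simp add: crossing_commute)
qed

definition inserted_flips :: flips where
  "inserted_flips =
     hull_flips (n - 2) @ [(broom (v ! 0) (n - 2), {v ! 2, v ! 3}), (bridge, {v ! 0, v ! (n - 1)})]"

lemma hull_flips_last:
  "hull_flips (n - 1) = hull_flips (n - 2) @ [(broom (v ! 0) (n - 2), {v ! 0, v ! (n - 1)})]"
proof -
  have "n - 1 = Suc (n - 2)" "2 \<le> n - 2" using six_points by auto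
  then show ?thesis by (simp add: hull_flips_def)
qed

lemma inserted_trees: "map fst inserted_flips = map fst (hull_flips (n - 1)) @ [bridge]"
  unfolding inserted_flips_def hull_flips_last by simp

lemma count_inserted_labels:
  "f \<in> point_pairs X \<Longrightarrow> count_list (map snd inserted_flips) f = 1 + of_bool (f = {v ! 2, v ! 3})"
  using count_labels_hull_flips[of f] unfolding inserted_flips_def hull_flips_last by simp

lemma distinct_inserted: "distinct (map fst inserted_flips)"
  unfolding inserted_trees using distinct_hull_flips[of "n - 1"] bridge_fresh six_points by simp

lemma off_tour_inserted: "T \<in> set (map fst inserted_flips) \<Longrightarrow> off_tour T"
  unfolding inserted_trees using off_tour_hull_flips off_tour_bridge by auto

lemma flip_path_inserted:
  "source inserted_flips T = star (v ! 0) (X - {v ! 0})"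
  "flip_path X inserted_flips (stage_tree X (v ! 0) (v ! 2) 1)"
proof -
  show "source inserted_flips T = star (v ! 0) (X - {v ! 0})"
    by (simp add: inserted_flips_def source_hull_flips)
  have "flip (broom (v ! 0) (n - 2)) {v ! 2, v ! 3} bridge"
    "flip bridge {v ! 0, v ! (n - 1)} (stage_tree X (v ! 0) (v ! 2) 1)"
    unfolding stage_tree_inserted near_star_eq_broom[symmetric] bridge_def
    by (rule detour.flip_near_star_detour_star[OF detour_bridge]
        detour.flip_detour_star_near_star[OF detour_bridge])+
  moreover have "flip_path X (hull_flips (n - 2)) (broom (v ! 0) (n - 2))"
    using six_points by (intro flip_path_hull_flips) auto
  moreover have "plane_tree X (broom (v ! 0) (n - 2))"
    using six_points by (intro plane_broom) (auto simp: prefix_def)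
  ultimately show "flip_path X inserted_flips (stage_tree X (v ! 0) (v ! 2) 1)"
    using plane_bridge by (simp add: inserted_flips_def flip_path_append)
qed

definition inserted_before :: "point \<Rightarrow> point \<Rightarrow> bool" where
  "inserted_before b c \<longleftrightarrow> b = v ! 0 \<and> c = v ! 2"

definition merge_label :: "point \<Rightarrow> point \<Rightarrow> point \<Rightarrow> point set" where
  "merge_label a b c =
     (if inserted_before b c then {b, last (sweep X a b)} else exit_label X a b c)"

definition merge_via :: "point \<Rightarrow> point \<Rightarrow> point \<Rightarrow> flips" where
  "merge_via a b c =
     (if inserted_before b c then inserted_flips
      else [(passage_tree X a b c, passage_label X a b c)])"

lemma flip_path_merge_via:
  assumes "(a, b, c) \<in> set turns"
  shows "flip_path X ((stage_tree X a b (n - 3), merge_label a b c) # merge_via a b c)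
    (stage_tree X b c 1)"
proof -
  interpret turn X a b c by (rule turn[OF assms])
  show ?thesis
  proof (cases "inserted_before b c")
    case True
    have "flip (near_star X b a y) {b, y} (star b (X - {b}))"
      using ab.in_X ab.neq last_point by (intro flip_near_star_star) auto
    then show ?thesis
      using True flip_path_inserted ab.plane_stage_tree[of "n - 3"] stage_trees_at_star(1)
      by (simp add: merge_label_def merge_via_def inserted_before_def)
  next
    case False
    then show ?thesis using flip_path_passage by (simp add: merge_label_def merge_via_def)
  qed
qed

lemma merge_via_cases:
  assumes "T \<in> set (map fst (merge_via a b c))"
  obtains "inserted_before b c" "off_tour T" | "\<not> inserted_before b c" "T = passage_tree X a b c"
  using assms off_tour_inserted[of T] by (auto simp: merge_via_def split: if_splits)

lemma merge_via_not_move: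
  assumes "(a, b, c) \<in> set turns" "(d, e) \<in> set es"
  shows "set (map fst (merge_via a b c)) \<inter> move_trees X d e = {}"
proof -
  interpret turn X a b c by (rule turn[OF assms(1)])
  have "(d, e) \<noteq> (b, a)" "(d, e) \<noteq> (c, b)" using turn_arcs[OF assms(1)] asym assms(2) by blast+
  then have "passage_tree X a b c \<notin> move_trees X d e"
    by (rule passage_tree_not_move_tree[OF move[OF assms(2)]])
  then have "T \<notin> move_trees X d e" if "T \<in> set (map fst (merge_via a b c))" for T
    using that off_tour_not_move_tree[OF _ assms(2), of T] by (elim merge_via_cases) auto
  then show ?thesis by blast
qed

lemma merge_via_disjoint:
  assumes "(a, b, c) \<in> set turns" "(a', b', c') \<in> set turns" "(a, b, c) \<noteq> (a', b', c')"
  shows "set (map fst (merge_via a b c)) \<inter> set (map fst (merge_via a' b' c')) = {}"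
proof -
  have "passage_tree X a b c \<noteq> passage_tree X a' b' c'"
    using assms turns_disjoint by (intro passage_tree_neq turn) blast+
  moreover have "\<not> (inserted_before b c \<and> inserted_before b' c')"
    using inj_onD[OF inj_on_arcs(2) _ assms(1,2)] assms(3)
    by (auto simp: arc_out_def inserted_before_def)
  ultimately have False
    if "T \<in> set (map fst (merge_via a b c))" "T \<in> set (map fst (merge_via a' b' c'))" for T
    using that off_tour_neq_passage_tree[OF _ assms(1), of T]
      off_tour_neq_passage_tree[OF _ assms(2), of T]
    by (elim merge_via_cases) auto
  then show ?thesis by blast
qed

lemma ex_merged_rainbow_cycle:
  assumes "\<And>f. f \<in> point_pairs X \<Longrightarrow> card {(a, b) \<in> set es. b \<in> f} = r"
  shows "\<exists>p. rainbow_cycle X (Suc r) p"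
proof -
  interpret connected_tour X es True merge_label merge_via "\<lambda>a b c. of_bool (inserted_before b c)"
  proof
    fix a b c assume passage: "(a, b, c) \<in> set turns"
    show "distinct (map fst (merge_via a b c))"
      using distinct_inserted by (simp add: merge_via_def)
    interpret turn X a b c by (rule turn[OF passage])
    fix f assume f: "f \<in> point_pairs X"
    show "count_list (merge_label a b c # map snd (merge_via a b c)) f =
        of_bool (f = {b, y}) + of_bool (f = {c, z}) + of_bool (inserted_before b c)"
    proof (cases "inserted_before b c")
      case True
      then have "{c, z} = {v ! 2, v ! 3}" using hd_sweep_inserted by (simp add: inserted_before_def)
      then show ?thesis
        using True count_inserted_labels[OF f] by (simp add: merge_label_def merge_via_def)
    next
      case False
      then show ?thesis using count_passage_labels[of f]
        by (simp add: merge_label_def merge_via_def)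
    qed
  qed (rule flip_path_merge_via merge_via_not_move merge_via_disjoint; assumption)+
  have "(\<Sum>(a, b, c)\<leftarrow>turns. of_bool (inserted_before b c)) =
      (\<Sum>t\<leftarrow>turns. of_bool (arc_out t = (v ! 0, v ! 2)) :: nat)"
    by (intro arg_cong[where f = sum_list] map_cong) (auto simp: arc_out_def inserted_before_def)
  also have "\<dots> = (\<Sum>e\<in>set es. of_bool (e = (v ! 0, v ! 2)))" by (rule sum_list_arc_out)
  also have "\<dots> = 1" using inserted_at by (simp add: of_bool_def)
  finally have "(\<Sum>(a, b, c)\<leftarrow>turns. of_bool (inserted_before b c)) = (1 :: nat)" .
  then show ?thesis using assms by (intro ex_rainbow_cycle) simp
qed

end

lemma ex_bij_extending:
  assumes "finite A" "S \<subseteq> A" "inj_on g S" "g ` S \<subseteq> A"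
  shows "\<exists>h. bij_betw h A A \<and> (\<forall>x\<in>S. h x = g x)"
proof -
  have "card (A - S) = card (A - g ` S)"
    using assms by (simp add: card_Diff_subset finite_subset card_image)
  then obtain k where k: "bij_betw k (A - S) (A - g ` S)"
    using finite_same_card_bij[of "A - S" "A - g ` S"] assms(1) by auto
  define h where "h x = (if x \<in> S then g x else k x)" for x
  have "bij_betw h S (g ` S)"
    using assms(3) by (auto simp: bij_betw_def h_def inj_on_def)
  moreover have "bij_betw h (A - S) (A - g ` S)"
    using k by (rule bij_betw_cong[THEN iffD1, rotated]) (auto simp: h_def)
  ultimately have "bij_betw h (S \<union> (A - S)) (g ` S \<union> (A - g ` S))"
    by (rule bij_betw_combine) auto
  moreover have "S \<union> (A - S) = A" "g ` S \<union> (A - g ` S) = A" using assms by auto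
  ultimately show ?thesis by (intro exI[of _ h]) (simp add: h_def)
qed

context hull_points
begin

lemma bij_v: "bij_betw ((!) v) {..<n} X"
  using v_enumerates by (auto simp: bij_betw_def inj_on_def in_set_conv_nth)

lemma ex_merge_labelling:
  assumes "1 \<le> d" "2 * d + 4 \<le> n"
  obtains w where "bij_betw w {..<n} X" "w 0 = v ! 0" "w 1 = v ! 2" "w (n - 1) = v ! 3"
    "w (d + 1) = v ! (n - 1)" "w (d + 2) = v ! 1" "w (d + 3) = v ! (n - 2)"
proof -
  define g where "g = id(1 := 2, n - 1 := 3, d + 1 := n - 1, d + 2 := 1, d + 3 := n - 2)"
  let ?S = "{0, 1, n - 1, d + 1, d + 2, d + 3}"
  have "inj_on g ?S" "?S \<subseteq> {..<n}" "g ` ?S \<subseteq> {..<n}" using assms by (auto simp: g_def inj_on_def)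
  then obtain h where h: "bij_betw h {..<n} {..<n}" "\<forall>x\<in>?S. h x = g x"
    using ex_bij_extending[of "{..<n}" ?S g] by blast
  have "g 0 = 0" "g 1 = 2" "g (n - 1) = 3" "g (d + 1) = n - 1" "g (d + 2) = 1" "g (d + 3) = n - 2"
    using assms by (auto simp: g_def)
  then show thesis
    using h(2) by (intro that[OF bij_betw_trans[OF h(1) bij_v]]) simp_all
qed

lemma ex_rainbow_cycle_odd:
  assumes d: "1 \<le> d" "2 * d + 4 \<le> n"
  shows "\<exists>p. rainbow_cycle X (2 * d + 1) p"
proof -
  obtain w where bij: "bij_betw w {..<n} X"
    and w: "w 0 = v ! 0" "w 1 = v ! 2" "w (n - 1) = v ! 3"
      "w (d + 1) = v ! (n - 1)" "w (d + 2) = v ! 1" "w (d + 3) = v ! (n - 2)"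
    using d by (rule ex_merge_labelling)
  interpret labelled_points X w d using bij d by unfold_locales auto
  obtain es where es: "tour X es" "set es = circulant_arcs" using ex_tour by blast
  interpret tour X es True by (rule es(1))
  have adjacent_iff: "adjacent (w i) (w j) \<longleftrightarrow> (i, j) \<in> circulant n d \<or> (j, i) \<in> circulant n d"
    if "i < n" "j < n" for i j
    using that by (simp add: adjacent_def es(2) arc_iff)
  interpret merge X es v
  proof
    show "(v ! 0, v ! 2) \<in> set es"
      unfolding w[symmetric] es(2) using d by (subst arc_iff) (auto simp: circulant_def)
    show "\<not> adjacent (v ! 0) (v ! 1)" "\<not> adjacent (v ! 1) (v ! 2)" "\<not> adjacent (v ! 1) (v ! 3)"
      "\<not> adjacent (v ! 0) (v ! (n - 2))" "\<not> adjacent (v ! 2) (v ! (n - 2))"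
      "\<not> adjacent (v ! 0) (v ! (n - 1))"
      unfolding w[symmetric] using d by (subst adjacent_iff; auto simp: circulant_def)+
  qed
  show ?thesis using card_arcs_into es(2) ex_merged_rainbow_cycle[of "2 * d"] by simp
qed

end

subsection \<open>Four and five points\<close>

text \<open>Four or five points can be labelled so that only those edges cross that would cross if the
  points were in convex position in the order of the labels. Hence cycles found by a computer search
  for convex position serve all configurations. Edges are pairs of labels in increasing order, and
  the edges of a tree are listed in an order in which the tree grows.\<close>

definition interleaved :: "nat \<times> nat \<Rightarrow> nat \<times> nat \<Rightarrow> bool" where
  "interleaved e f \<longleftrightarrow> fst e < fst f \<and> fst f < snd e \<and> snd e < snd f \<or>
     fst f < fst e \<and> fst e < snd f \<and> snd f < snd e"

definition pairs_upto :: "nat \<Rightarrow> (nat \<times> nat) list" where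
  "pairs_upto n = concat (map (\<lambda>j. map (\<lambda>i. (i, j)) [0..<j]) [0..<n])"

fun grows :: "nat \<Rightarrow> nat list \<Rightarrow> (nat \<times> nat) list \<Rightarrow> bool" where
  "grows n vs [] \<longleftrightarrow> set vs = set [0..<n]"
| "grows n vs ((i, j) # es) \<longleftrightarrow>
     (if i \<in> set vs then j \<notin> set vs \<and> grows n (j # vs) es else j \<in> set vs \<and> grows n (i # vs) es)"

definition tree_ok :: "nat \<Rightarrow> (nat \<times> nat) list \<Rightarrow> bool" where
  "tree_ok n es \<longleftrightarrow> grows n [fst (hd es)] es \<and> set es \<subseteq> set (pairs_upto n) \<and>
     (\<forall>e\<in>set es. \<forall>f\<in>set es. \<not> interleaved e f)"

definition flip_ok :: "(nat \<times> nat) list \<Rightarrow> nat \<times> nat \<Rightarrow> (nat \<times> nat) list \<Rightarrow> bool" where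
  "flip_ok s l t \<longleftrightarrow> l \<notin> set s \<and> (\<exists>e\<in>set s. set t = insert l (set s - {e}))"

fun flips_ok :: "((nat \<times> nat) list \<times> nat \<times> nat) list \<Rightarrow> (nat \<times> nat) list \<Rightarrow> bool" where
  "flips_ok [] t \<longleftrightarrow> True"
| "flips_ok ((s, l) # xs) t \<longleftrightarrow> flip_ok s l (source xs t) \<and> flips_ok xs t"

definition cycle_ok :: "nat \<Rightarrow> nat \<Rightarrow> ((nat \<times> nat) list \<times> nat \<times> nat) list \<Rightarrow> bool" where
  "cycle_ok n r xs \<longleftrightarrow> xs \<noteq> [] \<and> (\<forall>(s, l)\<in>set xs. tree_ok n s \<and> l \<in> set (pairs_upto n)) \<and>
     flips_ok xs (source xs []) \<and> distinct (map (set \<circ> fst) xs) \<and>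
     (\<forall>e\<in>set (pairs_upto n). count_list (map snd xs) e = r)"

lemma set_pairs_upto: "set (pairs_upto n) = {(i, j). i < j \<and> j < n}"
  by (auto simp: pairs_upto_def)

lemma grows_subset: "grows n vs es \<Longrightarrow> set vs \<subseteq> {..<n}"
  by (induction n vs es rule: grows.induct) (auto split: if_splits)

lemma tree_on_if_grows:
  assumes "grows n vs es" "tree_on (p ` set vs) T" "inj_on p {..<n}"
  shows "tree_on (p ` {..<n}) (T \<union> (\<lambda>(i, j). {p i, p j}) ` set es)"
  using assms
proof (induction n vs es arbitrary: T rule: grows.induct)
  case (1 n vs)
  then show ?case by (simp add: atLeast0LessThan)
next
  case (2 n vs i j es)
  have new: "p y \<notin> p ` set vs" if "grows n (y # vs) es" "y \<notin> set vs" for y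
  proof -
    have "insert y (set vs) \<subseteq> {..<n}" using grows_subset[OF that(1)] by simp
    then have "inj_on p (insert y (set vs))" using "2.prems"(3) by (rule inj_on_subset[rotated])
    then show ?thesis using that(2) by simp
  qed
  show ?case
  proof (cases "i \<in> set vs")
    case True
    then have j: "j \<notin> set vs" "grows n (j # vs) es" using "2.prems"(1) by simp_all
    then have tree: "tree_on (p ` set (j # vs)) (insert {p i, p j} T)"
      using tree_on_insert[OF "2.prems"(2), of "p i" "p j"] True new by simp
    then show ?thesis using "2.IH"(1)[OF True j(2) tree "2.prems"(3)] by simp
  next
    case False
    then have i: "j \<in> set vs" "grows n (i # vs) es" using "2.prems"(1) by simp_all
    then have tree: "tree_on (p ` set (i # vs)) (insert {p j, p i} T)"
      using tree_on_insert[OF "2.prems"(2), of "p j" "p i"] False new by simp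
    then show ?thesis using "2.IH"(2)[OF False i(2) tree "2.prems"(3)] by (simp add: insert_commute)
  qed
qed

lemma source_map_prod: "source (map (map_prod f g) xs) (f t) = f (source xs t)"
  by (cases "(xs, t)" rule: source.cases) auto

lemma count_list_map_inj_on:
  "inj_on f A \<Longrightarrow> set xs \<subseteq> A \<Longrightarrow> x \<in> A \<Longrightarrow> count_list (map f xs) (f x) = count_list xs x"
  by (induction xs) (auto simp: inj_on_eq_iff)

locale convex_labelling = points +
  fixes n :: nat and p :: "nat \<Rightarrow> point"
  assumes bij_p: "bij_betw p {..<n} X"
    and interleaved_if_crossing: "\<And>i j k l. i < j \<Longrightarrow> j < n \<Longrightarrow> k < l \<Longrightarrow> l < n \<Longrightarrow>
      crossing {p i, p j} {p k, p l} \<Longrightarrow> interleaved (i, j) (k, l)"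
begin

definition edge :: "nat \<times> nat \<Rightarrow> point set" where
  "edge = (\<lambda>(i, j). {p i, p j})"

definition draw :: "(nat \<times> nat) list \<Rightarrow> point set set" where
  "draw es = edge ` set es"

lemma inj_on_edge: "inj_on edge (set (pairs_upto n))"
proof (rule inj_onI)
  fix e f assume "e \<in> set (pairs_upto n)" "f \<in> set (pairs_upto n)" "edge e = edge f"
  moreover have "p i = p j \<longleftrightarrow> i = j" if "i < n" "j < n" for i j
    using bij_p that by (auto simp: bij_betw_def inj_on_def)
  ultimately show "e = f" by (auto simp: edge_def set_pairs_upto doubleton_eq_iff)
qed

lemma ex_edge:
  assumes "f \<in> point_pairs X"
  shows "\<exists>e\<in>set (pairs_upto n). f = edge e"
proof -
  obtain x y where "f = {x, y}" "x \<noteq> y" "x \<in> X" "y \<in> X"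
    using assms by (auto simp: point_pairs_def card_2_iff)
  moreover from this obtain i j where "i < n" "x = p i" "j < n" "y = p j"
    using bij_betw_imp_surj_on[OF bij_p] by (metis imageE lessThan_iff)
  moreover from calculation have "i \<noteq> j" by auto
  ultimately have "(min i j, max i j) \<in> set (pairs_upto n)" "f = edge (min i j, max i j)"
    by (auto simp: set_pairs_upto edge_def min_def max_def)
  then show ?thesis by blast
qed

lemma plane_tree_draw:
  assumes "tree_ok n es"
  shows "plane_tree X (draw es)"
proof (rule plane_treeI)
  have "tree_on (p ` {..<n}) ({} \<union> (\<lambda>(i, j). {p i, p j}) ` set es)"
  proof (rule tree_on_if_grows)
    show "grows n [fst (hd es)] es" using assms by (simp add: tree_ok_def)
    show "tree_on (p ` set [fst (hd es)]) {}" by (simp add: tree_on_single)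
    show "inj_on p {..<n}" using bij_p by (simp add: bij_betw_def)
  qed
  then show "tree_on X (draw es)"
    using bij_betw_imp_surj_on[OF bij_p] by (simp add: draw_def edge_def)
  have "\<not> crossing (edge e) (edge f)" if "e \<in> set es" "f \<in> set es" for e f
  proof -
    have "\<not> interleaved e f" "e \<in> set (pairs_upto n)" "f \<in> set (pairs_upto n)"
      using assms that by (auto simp: tree_ok_def)
    then show ?thesis
      using interleaved_if_crossing[of "fst e" "snd e" "fst f" "snd f"]
      by (auto simp: edge_def set_pairs_upto)
  qed
  then show "cross_free (draw es) (draw es)" by (auto simp: cross_free_def draw_def)
qed

lemma flip_draw:
  assumes s: "set s \<subseteq> set (pairs_upto n)" and l: "l \<in> set (pairs_upto n)" and ok: "flip_ok s l t"
  shows "flip (draw s) (edge l) (draw t)"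
proof -
  obtain e where e: "e \<in> set s" "set t = insert l (set s - {e})" and new: "l \<notin> set s"
    using ok by (auto simp: flip_ok_def)
  have "edge l \<notin> draw s" unfolding draw_def using inj_on_image_mem_iff[OF inj_on_edge l s] new
    by simp
  moreover have "edge ` (set s - {e}) = draw s - {edge e}"
    using inj_on_image_set_diff[OF inj_on_edge, of "set s" "{e}"] s e(1) by (auto simp: draw_def)
  then have "draw t = insert (edge l) (draw s - {edge e})" by (simp add: draw_def e(2))
  ultimately show ?thesis using e(1) by (auto simp: flip_def draw_def)
qed

lemma flip_path_draw:
  assumes "flips_ok xs t" "\<forall>(s, l)\<in>set xs. tree_ok n s \<and> l \<in> set (pairs_upto n)"
  shows "flip_path X (map (map_prod draw edge) xs) (draw t)"
  using assms
proof (induction xs t rule: flips_ok.induct)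
  case (2 s l xs t)
  then show ?case
    using flip_draw[of s l "source xs t"]
    by (auto simp: source_map_prod plane_tree_draw tree_ok_def)
qed simp

lemma ex_rainbow_cycle:
  assumes ok: "cycle_ok n r xs"
  shows "\<exists>q. rainbow_cycle X r q"
proof (rule rainbow_cycleI)
  let ?ps = "map (map_prod draw edge) xs"
  have trees: "\<forall>(s, l)\<in>set xs. tree_ok n s \<and> l \<in> set (pairs_upto n)"
    using ok by (simp add: cycle_ok_def)
  show "?ps \<noteq> []" using ok by (simp add: cycle_ok_def)
  show "flip_path X ?ps (draw (source xs []))"
    using ok by (intro flip_path_draw) (auto simp: cycle_ok_def)
  show "source ?ps (draw (source xs [])) = draw (source xs [])"
    using ok by (cases xs) (auto simp: source_map_prod cycle_ok_def)
  have "set (map (set \<circ> fst) xs) \<subseteq> Pow (set (pairs_upto n))"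
    using trees by (fastforce simp: tree_ok_def)
  then have "inj_on ((`) edge) (set (map (set \<circ> fst) xs))"
    using inj_on_image_Pow[OF inj_on_edge] by (rule inj_on_subset[rotated])
  then have "distinct (map ((`) edge) (map (set \<circ> fst) xs))"
    using ok by (simp only: distinct_map cycle_ok_def)
  moreover have "map fst ?ps = map ((`) edge) (map (set \<circ> fst) xs)" by (simp add: draw_def)
  ultimately show "distinct (map fst ?ps)" by (simp only:)
  fix f assume "f \<in> point_pairs X"
  then obtain e where e: "e \<in> set (pairs_upto n)" "f = edge e" using ex_edge by blast
  have "set (map snd xs) \<subseteq> set (pairs_upto n)" using trees by auto
  then have "count_list (map edge (map snd xs)) f = count_list (map snd xs) e"
    unfolding e(2) by (intro count_list_map_inj_on[OF inj_on_edge] e(1))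
  then show "count_list (map snd ?ps) f = r" using ok e(1) by (simp add: cycle_ok_def comp_def)
qed

end

lemma not_crossing_if_same_side:
  assumes "orient a b c > 0 \<and> orient a b d > 0 \<or> orient a b c < 0 \<and> orient a b d < 0"
  shows "\<not> crossing {a, b} {c, d}"
proof -
  have "\<not> crossing {c, d} {a, b}" if "orient a b c < 0" "orient a b d < 0" for a b
    using that by (intro not_crossing_if_separated[of a b]) (auto simp: orient_self)
  then have "\<not> crossing {c, d} {a, b} \<or> \<not> crossing {c, d} {b, a}"
    using assms orient_flip[of b a] by auto
  then show ?thesis using crossing_commute[of "{a, b}"] by (simp add: insert_commute)
qed

context hull_points
begin

lemma convex_labelling_v:
  assumes "n \<le> 5" "n = 5 \<Longrightarrow> \<not> crossing {v ! 1, v ! 4} {v ! 2, v ! 3}"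
  shows "convex_labelling X n ((!) v)"
proof
  show "bij_betw ((!) v) {..<n} X" by (rule bij_v)
  have nested: "\<not> crossing {v ! i, v ! j} {v ! k, v ! l}"
    if "i < k" "k < l" "l < j" "j < n" for i j k l
  proof (cases "i = 0")
    case True
    then show ?thesis using not_crossing_nested_root[of k l j] that by simp
  next
    case False
    then have "i = 1" "k = 2" "l = 3" "j = 4" "n = 5" using that assms(1) by linarith+
    then show ?thesis using assms(2) by simp
  qed
  fix i j k l assume ij: "i < j" "j < n" and kl: "k < l" "l < n"
    and crossing: "crossing {v ! i, v ! j} {v ! k, v ! l}"
  have "{v ! i, v ! j} \<in> point_pairs X" "{v ! k, v ! l} \<in> point_pairs X"
    using ij kl by (auto simp: point_pairs_def)
  then have "{v ! i, v ! j} \<inter> {v ! k, v ! l} = {}" using not_crossing_if_meet crossing by blast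
  then have "i \<noteq> k" "i \<noteq> l" "j \<noteq> k" "j \<noteq> l" by auto
  moreover have "\<not> j < k" "\<not> l < i"
    using not_crossing_apart[of i j k l] not_crossing_apart[of k l i j] ij kl crossing
      crossing_commute by auto
  moreover have "\<not> (i < k \<and> l < j)" "\<not> (k < i \<and> j < l)"
    using nested[of i k l j] nested[of k i j l] ij kl crossing crossing_commute by auto
  ultimately show "interleaved (i, j) (k, l)" by (auto simp: interleaved_def)
qed

lemma five_points_eq:
  assumes "n = 5"
  shows "X = {v ! 0, v ! 1, v ! 2, v ! 3, v ! 4}"
proof -
  have "v = map ((!) v) [0..<5]" using v_enumerates(3) assms by (metis map_nth)
  then have "X = set (map ((!) v) [0..<5])" using v_enumerates(2) by metis
  then show ?thesis by (simp add: upt_rec numeral_eq_Suc)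
qed

lemma five_points_sides:
  assumes "n = 5" "crossing {v ! 1, v ! 4} {v ! 2, v ! 3}"
  obtains (third_inside) "orient (v ! 1) (v ! 4) (v ! 2) < 0" "orient (v ! 1) (v ! 4) (v ! 3) > 0"
    "orient (v ! 2) (v ! 3) (v ! 1) > 0" "orient (v ! 2) (v ! 3) (v ! 4) < 0"
  | (second_inside) "orient (v ! 1) (v ! 4) (v ! 2) > 0" "orient (v ! 1) (v ! 4) (v ! 3) < 0"
    "orient (v ! 2) (v ! 3) (v ! 1) < 0" "orient (v ! 2) (v ! 3) (v ! 4) > 0"
proof -
  let ?o = "\<lambda>i j k. orient (v ! i) (v ! j) (v ! k)"
  have nonzero: "?o 1 4 2 \<noteq> 0" "?o 1 4 3 \<noteq> 0" "?o 2 3 1 \<noteq> 0" "?o 2 3 4 \<noteq> 0"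
    using assms(1) by (intro orient_nonzero; simp)+
  have "\<not> (?o 1 4 2 > 0 \<and> ?o 1 4 3 > 0 \<or> ?o 1 4 2 < 0 \<and> ?o 1 4 3 < 0)"
    using not_crossing_if_same_side[of "v ! 1" "v ! 4" "v ! 2" "v ! 3"] assms(2) by blast
  moreover have "\<not> (?o 2 3 1 > 0 \<and> ?o 2 3 4 > 0 \<or> ?o 2 3 1 < 0 \<and> ?o 2 3 4 < 0)"
    using not_crossing_if_same_side[of "v ! 2" "v ! 3" "v ! 1" "v ! 4"] assms(2)
      crossing_commute[of "{v ! 1, v ! 4}"] by blast
  moreover have "?o 2 3 1 = ?o 2 3 4 + ?o 1 4 3 - ?o 1 4 2"
    by (simp add: orient_def algebra_simps)
  ultimately show thesis using nonzero that by linarith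
qed

lemma ex_hull_order_not_crossing:
  assumes n: "n = 5"
  shows "\<exists>w. hull_order X w \<and> \<not> crossing {w ! 1, w ! 4} {w ! 2, w ! 3}"
proof (cases "crossing {v ! 1, v ! 4} {v ! 2, v ! 3}")
  case True
  note X = five_points_eq[OF n]
  let ?o = "\<lambda>i j k. orient (v ! i) (v ! j) (v ! k)"
  have root: "?o 0 1 2 > 0" "?o 0 1 3 > 0" "?o 0 1 4 > 0" "?o 0 2 3 > 0" "?o 0 2 4 > 0"
    "?o 0 3 4 > 0"
    using n by (simp_all add: orient_v_pos)
  from n True show ?thesis
  proof (cases rule: five_points_sides)
    case third_inside
    let ?w = "[v ! 2, v ! 4, v ! 3, v ! 0, v ! 1]"
    have "?o 2 4 3 = - ?o 2 3 4" "?o 2 4 0 = ?o 0 2 4" "?o 2 4 1 = - ?o 1 4 2"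
      "?o 2 3 0 = ?o 0 2 3" "?o 2 0 1 = ?o 0 1 2"
      by (simp_all add: orient_def algebra_simps)
    then have "sorted_wrt (\<lambda>k l. orient (hd ?w) k l > 0) (tl ?w)" using third_inside root by simp
    moreover have "set ?w = X" unfolding X by auto
    moreover have "distinct ?w" using n by simp
    ultimately have "hull_order X ?w" by (simp only: hull_order_def)
    moreover have "?o 4 1 3 = - ?o 1 4 3" "?o 4 1 0 = - ?o 0 1 4"
      by (simp_all add: orient_def algebra_simps)
    then have "\<not> crossing {?w ! 1, ?w ! 4} {?w ! 2, ?w ! 3}"
      using third_inside root by (intro not_crossing_if_same_side) simp
    ultimately show ?thesis by blast
  next
    case second_inside
    let ?w = "[v ! 3, v ! 4, v ! 0, v ! 2, v ! 1]"
    have "?o 3 4 0 = ?o 0 3 4" "?o 3 4 2 = ?o 2 3 4" "?o 3 4 1 = - ?o 1 4 3"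
      "?o 3 0 2 = ?o 0 2 3" "?o 3 0 1 = ?o 0 1 3" "?o 3 2 1 = - ?o 2 3 1"
      by (simp_all add: orient_def algebra_simps)
    then have "sorted_wrt (\<lambda>k l. orient (hd ?w) k l > 0) (tl ?w)" using second_inside root by simp
    moreover have "set ?w = X" unfolding X by auto
    moreover have "distinct ?w" using n by simp
    ultimately have "hull_order X ?w" by (simp only: hull_order_def)
    moreover have "?o 4 1 0 = - ?o 0 1 4" "?o 4 1 2 = - ?o 1 4 2"
      by (simp_all add: orient_def algebra_simps)
    then have "\<not> crossing {?w ! 1, ?w ! 4} {?w ! 2, ?w ! 3}"
      using second_inside root by (intro not_crossing_if_same_side) simp
    ultimately show ?thesis by blast
  qed
qed (use hull_order in blast)

end

lemma (in points) ex_convex_labelling: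
  assumes "card X = 4 \<or> card X = 5"
  shows "\<exists>p. convex_labelling X (card X) p"
proof -
  have hull_points: "hull_points X w" if "hull_order X w" for w
    using that assms by unfold_locales auto
  obtain v where "hull_points X v" using ex_hull_points assms by auto
  then obtain w where "hull_order X w" "card X = 5 \<longrightarrow> \<not> crossing {w ! 1, w ! 4} {w ! 2, w ! 3}"
    using hull_points.ex_hull_order_not_crossing hull_points.hull_order by blast
  then have "convex_labelling X (card X) ((!) w)"
    using assms by (intro hull_points.convex_labelling_v hull_points) auto
  then show ?thesis by blast
qed

lemma (in points) ex_rainbow_cycle_if_cycle_ok:
  "card X = 4 \<or> card X = 5 \<Longrightarrow> cycle_ok (card X) r xs \<Longrightarrow> \<exists>p. rainbow_cycle X r p"
  using ex_convex_labelling convex_labelling.ex_rainbow_cycle by blast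

definition rotate_pair :: "nat \<Rightarrow> nat \<Rightarrow> nat \<times> nat \<Rightarrow> nat \<times> nat" where
  "rotate_pair n k = (\<lambda>(i, j).
     (min ((i + k) mod n) ((j + k) mod n), max ((i + k) mod n) ((j + k) mod n)))"

definition rotations ::
    "nat \<Rightarrow> ((nat \<times> nat) list \<times> nat \<times> nat) list \<Rightarrow> ((nat \<times> nat) list \<times> nat \<times> nat) list" where
  "rotations n xs =
     concat (map (\<lambda>k. map (map_prod (map (rotate_pair n k)) (rotate_pair n k)) xs) [0..<n])"

lemma cycle_ok_4_2: "cycle_ok 4 2
    [([(0, 1), (0, 2), (0, 3)], (2, 3)),
     ([(0, 1), (0, 2), (2, 3)], (0, 3)),
     ([(0, 1), (0, 3), (2, 3)], (1, 3)),
     ([(0, 1), (1, 3), (2, 3)], (1, 2)),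
     ([(0, 1), (1, 2), (1, 3)], (2, 3)),
     ([(0, 1), (1, 2), (2, 3)], (0, 2)),
     ([(0, 2), (1, 2), (2, 3)], (0, 3)),
     ([(0, 3), (2, 3), (1, 2)], (1, 3)),
     ([(0, 3), (1, 3), (2, 3)], (1, 2)),
     ([(0, 3), (1, 3), (1, 2)], (0, 1)),
     ([(0, 1), (0, 3), (1, 2)], (0, 2)),
     ([(0, 2), (0, 3), (1, 2)], (0, 1))]"
  by code_simp

lemma cycle_ok_5_2: "cycle_ok 5 2 (rotations 5
    [([(0, 1), (0, 2), (0, 3), (0, 4)], (3, 4)),
     ([(0, 1), (0, 2), (0, 3), (3, 4)], (1, 2)),
     ([(0, 1), (0, 3), (1, 2), (3, 4)], (1, 3)),
     ([(0, 1), (1, 2), (1, 3), (3, 4)], (1, 4))])"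
  by code_simp

lemma cycle_ok_5_3: "cycle_ok 5 3 (rotations 5
    [([(0, 1), (0, 2), (0, 3), (0, 4)], (3, 4)),
     ([(0, 1), (0, 2), (0, 3), (3, 4)], (0, 4)),
     ([(0, 1), (0, 2), (0, 4), (3, 4)], (2, 4)),
     ([(0, 1), (0, 2), (2, 4), (3, 4)], (1, 2)),
     ([(0, 1), (1, 2), (2, 4), (3, 4)], (1, 3)),
     ([(0, 1), (1, 2), (1, 3), (3, 4)], (1, 4))])"
  by code_simp

lemma cycle_ok_5_4: "cycle_ok 5 4 (rotations 5
    [([(0, 1), (0, 2), (0, 3), (0, 4)], (3, 4)),
     ([(0, 1), (0, 2), (0, 3), (3, 4)], (0, 4)),
     ([(0, 1), (0, 2), (0, 4), (3, 4)], (2, 3)),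
     ([(0, 1), (0, 2), (0, 4), (2, 3)], (0, 3)),
     ([(0, 1), (0, 3), (0, 4), (2, 3)], (1, 3)),
     ([(0, 1), (0, 4), (1, 3), (2, 3)], (1, 2)),
     ([(0, 1), (0, 4), (1, 2), (2, 3)], (1, 4)),
     ([(0, 1), (1, 2), (1, 4), (2, 3)], (1, 3))])"
  by code_simp

subsection \<open>All multiplicities\<close>

lemma (in points) ex_rainbow_cycle_at_least_6:
  assumes n: "card X \<ge> 6" and r: "2 \<le> r" "r \<le> (if odd (card X) then card X - 1 else card X - 2)"
  shows "\<exists>p. rainbow_cycle X r p"
proof -
  obtain v where "hull_points X v" using ex_hull_points n by auto
  then interpret hull_points X v .
  have labelled: "labelled_points X ((!) v) d" if "1 \<le> d" "2 * d < card X" for d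
    using that n bij_v by unfold_locales auto
  consider (even) d where "r = 2 * d"
    | (tournament) d where "r = 2 * d - 1" "card X = 2 * d + 1" "1 \<le> d"
    | (odd) d where "r = 2 * d + 1" "2 * d + 4 \<le> card X"
  proof (cases "even r")
    case False
    then obtain d where d: "r = 2 * d + 1" by (rule oddE)
    then have "card X = 2 * (d + 1) + 1 \<or> 2 * d + 4 \<le> card X"
      using r(2) n by (auto split: if_splits; presburger)
    then show ?thesis using that(2)[of "d + 1"] that(3)[of d] d by auto
  qed (use that(1) in blast)
  then show ?thesis
  proof cases
    case (even d)
    then have "1 \<le> d" "2 * d < card X" using r n by (auto split: if_splits)
    then show ?thesis using labelled_points.ex_rainbow_cycle_even[OF labelled] even by blast
  next
    case (tournament d)
    then show ?thesis using labelled_points.ex_rainbow_cycle_tournament[OF labelled, of d] by simp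
  next
    case (odd d)
    then show ?thesis using ex_rainbow_cycle_odd[of d] r(1) by simp
  qed
qed

theorem theorem2:
  fixes X :: "(real^2) set"
  assumes "finite X" and "general_position X"
  shows "(card X \<ge> 3 \<longrightarrow> (\<exists>p. rainbow_cycle X 1 p)) \<and>
         (card X \<ge> 4 \<longrightarrow>
           (\<forall>r \<in> {2..(if odd (card X) then card X - 1 else card X - 2)}.
              \<exists>p. rainbow_cycle X r p))"
proof (intro conjI impI ballI)
  interpret points X using assms by unfold_locales
  show "\<exists>p. rainbow_cycle X 1 p" if "card X \<ge> 3"
    using ex_hull_points[OF that] hull_points.ex_rainbow_cycle_1 by blast
  fix r assume "card X \<ge> 4" and r: "r \<in> {2..(if odd (card X) then card X - 1 else card X - 2)}"
  then consider (four) "card X = 4" | (five) "card X = 5" | (large) "card X \<ge> 6" by linarith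
  then show "\<exists>p. rainbow_cycle X r p"
  proof cases
    case four
    then show ?thesis using r cycle_ok_4_2 by (intro ex_rainbow_cycle_if_cycle_ok) auto
  next
    case five
    then have "r = 2 \<or> r = 3 \<or> r = 4" using r by auto
    then show ?thesis
      using five cycle_ok_5_2 cycle_ok_5_3 cycle_ok_5_4 ex_rainbow_cycle_if_cycle_ok by metis
  next
    case large
    then show ?thesis using r by (intro ex_rainbow_cycle_at_least_6) auto
  qed
qed

end
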